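(* Let $d\ge 3$ be an integer and let $K\subset\mathbb{R}^d$ be a convex, compact set with non-empty interior. Then, for $p=d-1$, $$\mathrm{cap}_{d-1}(K)\le d^{2-d}(d-1)2^{d-2}\,\frac{P(K)^{d-1}}{|K|^{d-2}}\Big(\log\big(I(K)^{-1}\big)\Big)^{2-d},$$ where $I(K)=\dfrac{\omega_d d^d|K|^{d-1}}{P(K)^d}$ is the isoperimetric ratio of $K$.
   Context: $|\cdot|$ denotes $d$-dimensional Lebesgue measure, $P(A)$ the perimeter of $A$, and $\omega_d=|B_1|$ the measure of the unit ball in $\mathbb{R}^d$. By the isoperimetric inequality $0<I(K)\le1$; if $I(K)=1$ the right-hand side is understood as $+\infty$. For $1<p<d$ and $K\subset\mathbb{R}^d$ compact, the $p$-capacity is $$\mathrm{cap}_p(K)=\inf\Big\{\int_{\mathbb{R}^d}|Du|^p:\ u\ge \mathbf 1_K,\ Du\in L^p(\mathbb{R}^d),\ u\in C^0(\mathbb{R}^d),\ u\text{ vanishing at }\infty\Big\},$$ where $\mathbf 1_K$ is the indicator function of $K$ and "$u$ vanishing at $\infty$" means $|\{u>\varepsilon\}|<\infty$ for every $\varepsilon>0$. *)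

theory Defs
  imports "HOL-Analysis.Analysis"
begin

text \<open>
  \<open>C_k k f\<close>: \<open>f\<close> is of class \<open>C^k\<close> on the whole space, expressed by iterated partial derivatives
  along the standard basis.
\<close>

primrec C_k :: "nat \<Rightarrow> ('a::euclidean_space \<Rightarrow> 'b::real_normed_vector) \<Rightarrow> bool" where
  "C_k 0 f \<longleftrightarrow> continuous_on UNIV f"
| "C_k (Suc k) f \<longleftrightarrow>
     f differentiable_on UNIV \<and> (\<forall>b\<in>Basis. C_k k (\<lambda>x. frechet_derivative f (at x) b))"

definition compactly_supported :: "('a::euclidean_space \<Rightarrow> 'b::real_normed_vector) \<Rightarrow> bool" where
  "compactly_supported f \<longleftrightarrow> compact (closure {x. f x \<noteq> 0})"

definition test_function :: "('a::euclidean_space \<Rightarrow> real) \<Rightarrow> bool" where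
  "test_function \<phi> \<longleftrightarrow> (\<forall>k. C_k k \<phi>) \<and> compactly_supported \<phi>"

definition locally_integrable :: "('a::euclidean_space \<Rightarrow> 'b::euclidean_space) \<Rightarrow> bool" where
  "locally_integrable f \<longleftrightarrow> (\<forall>C. compact C \<longrightarrow> set_integrable lborel C f)"

text \<open>\<open>g\<close> is (a representative of) the distributional gradient of \<open>u\<close>.\<close>

definition weak_gradient :: "('a::euclidean_space \<Rightarrow> real) \<Rightarrow> ('a \<Rightarrow> 'a) \<Rightarrow> bool" where
  "weak_gradient u g \<longleftrightarrow>
     locally_integrable u \<and> locally_integrable g \<and>
     (\<forall>\<phi>. test_function \<phi> \<longrightarrow>
        (\<forall>b\<in>Basis. (LINT x|lborel. u x * frechet_derivative \<phi> (at x) b)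
                   = - (LINT x|lborel. (g x \<bullet> b) * \<phi> x)))"

text \<open>
  The \<open>p\<close>-capacity, meaningful for compact \<open>K\<close> and \<open>1 < p < DIM('a)\<close>. The weak gradient is unique up
  to null sets, so letting \<open>g\<close> range over all its representatives does not affect the infimum.
\<close>

definition p_capacity :: "real \<Rightarrow> 'a::euclidean_space set \<Rightarrow> ennreal" where
  "p_capacity p K =
     Inf {\<integral>\<^sup>+ x. ennreal (norm (g x) powr p) \<partial>lborel | u g.
            (\<forall>x. indicator K x \<le> u x) \<and>
            weak_gradient u g \<and>
            (\<integral>\<^sup>+ x. ennreal (norm (g x) powr p) \<partial>lborel) < \<infinity> \<and>
            continuous_on UNIV u \<and>
            (\<forall>\<epsilon>>0. emeasure lborel {x. u x > \<epsilon>} < \<infinity>)}"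

definition divergence :: "('a::euclidean_space \<Rightarrow> 'a) \<Rightarrow> 'a \<Rightarrow> real" where
  "divergence \<phi> x = (\<Sum>b\<in>Basis. frechet_derivative \<phi> (at x) b \<bullet> b)"

text \<open>Perimeter in the sense of Caccioppoli and De Giorgi.\<close>

definition perimeter :: "'a::euclidean_space set \<Rightarrow> ereal" where
  "perimeter A =
     (SUP \<phi> \<in> {\<phi>. C_k 1 \<phi> \<and> compactly_supported \<phi> \<and> (\<forall>x. norm (\<phi> x) \<le> 1)}.
        ereal (LINT x:A|lborel. divergence \<phi> x))"

text \<open>
  The coercion \<^const>\<open>real_of_ereal\<close> is harmless for convex bodies, whose perimeter is finite.
\<close>

definition isoperimetric_ratio :: "'a::euclidean_space set \<Rightarrow> real" where
  "isoperimetric_ratio K =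
     measure lborel (ball (0::'a) 1) * real DIM('a) ^ DIM('a) * measure lborel K ^ (DIM('a) - 1)
       / real_of_ereal (perimeter K) ^ DIM('a)"

end

theory Submission
  imports Defs
begin

text \<open>
  Write \<open>d\<close> for the dimension, \<open>P\<close> for the perimeter of \<open>K\<close>, \<open>I\<close> for the isoperimetric ratio, \<open>c = P / (d |K|)\<close>,
  and let \<open>V t\<close> be the volume of the set of points at distance at most \<open>t\<close> from \<open>K\<close>. The test
  functions are \<open>f (dist x)\<close>, where \<open>dist x\<close> is the distance to \<open>K\<close>. Their energy is the integral of
  \<open>|f'| ^ (d - 1) V'\<close> over the half-line, so the task is to bound the surface area \<open>V' t\<close> of the
  parallel bodies in terms of \<open>P\<close>, \<open>|K|\<close> and \<open>I\<close>. Three facts about \<open>V\<close> enter.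

  First, Steiner's formula (\<open>steiner\<close>): \<open>V\<close> is a polynomial of degree \<open>d\<close> with nonnegative
  coefficients, whose leading coefficient is the volume of the unit ball. If the ball is replaced by a
  zonotope, this is elementary: adding a segment to a convex body changes the volume by an affine
  function of the length of the segment (\<open>vol_add_segment\<close>), so the volume is a polynomial in the lengths
  of all segments. The ball is a limit of zonotopes since the average of \<open>|y \<bullet> x|\<close> over the unit ball is
  a multiple of \<open>|x|\<close> (\<open>norm_approx_zonotope_support\<close>).

  Second, the Brunn--Minkowski inequality (\<open>brunn_minkowski_convex\<close>), proved by the Hadwiger--Ohmann
  induction on finite unions of boxes. It makes the \<open>d\<close>-th root of \<open>V\<close> concave, which gives
  \<open>V' t \<le> V' 0 (1 + t V' 0 / (d |K|)) ^ (d - 1)\<close> (\<open>V'_le\<close>).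

  Third, \<open>V' 0 \<le> P < \<infinity>\<close> (\<open>V'_le_perimeter\<close>, \<open>perimeter_finite\<close>). For the lower bound on the
  perimeter, which is a supremum over vector fields, one tests with the gradient of a smooth convex
  approximation of the distance to a slightly contracted copy of \<open>K\<close>, namely a smoothed maximum of
  finitely many affine functions.

  Consequently, in the variable \<open>s = c t\<close>, the polynomial \<open>Q = V' / P\<close> has degree \<open>d - 1\<close>, nonnegative
  coefficients, leading coefficient \<open>I\<close>, and satisfies \<open>Q s \<le> (1 + s) ^ (d - 1)\<close>. Letting \<open>s\<close> tend to
  infinity yields \<open>I \<le> 1\<close>. For \<open>s \<le> 1\<close> the bound is at most \<open>2 (1 + s) ^ (d - 2)\<close>. For \<open>s \<ge> 1\<close> the part
  of \<open>Q\<close> of degree at most \<open>d - 2\<close> is at most \<open>s ^ (d - 2) Q 1 \<le> 2 ^ (d - 1) s ^ (d - 2)\<close>. Both cases give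
  \<open>Q s \<le> (d - 1) 2 ^ (d - 2) ((1 + s) (1 + I s)) ^ (d - 2)\<close> (\<open>V'_le_profile\<close>). With this weight the optimal
  profile \<open>f\<close> is explicit, because the integral of \<open>1 / ((1 + s) (1 + I s))\<close> over the half-line is
  \<open>ln (1 / I) / (1 - I)\<close>. Its energy with respect to this weight is \<open>(1 - I) ^ (d - 2)\<close>
  times the right-hand side of the theorem (\<open>p_capacity_le\<close>).
\<close>

section \<open>The Brunn--Minkowski inequality\<close>

lemma compact_set_plus:
  fixes A B :: "'a::euclidean_space set"
  assumes "compact A" "compact B"
  shows "compact (A + B)"
proof -
  have "A + B = {x + y |x y. x \<in> A \<and> y \<in> B}"
    by (auto simp: set_plus_def)
  then show ?thesis using compact_sums[OF assms] by simp
qed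

lemma cbox_set_plus:
  fixes a b c e :: "'a::euclidean_space"
  assumes "cbox a b \<noteq> {}" "cbox c e \<noteq> {}"
  shows "cbox a b + cbox c e = cbox (a + c) (b + e)"
proof (intro equalityI subsetI)
  fix x assume "x \<in> cbox a b + cbox c e"
  then show "x \<in> cbox (a + c) (b + e)"
    by (auto simp: set_plus_def mem_box inner_add_left add_mono)
next
  fix x assume x: "x \<in> cbox (a + c) (b + e)"
  have ab: "\<And>i. i \<in> Basis \<Longrightarrow> a \<bullet> i \<le> b \<bullet> i" and ce: "\<And>i. i \<in> Basis \<Longrightarrow> c \<bullet> i \<le> e \<bullet> i"
    using assms by (auto simp: box_ne_empty)
  define y where "y = (\<Sum>i\<in>Basis. max (a \<bullet> i) (x \<bullet> i - e \<bullet> i) *\<^sub>R i)"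
  have y: "y \<bullet> i = max (a \<bullet> i) (x \<bullet> i - e \<bullet> i)" if "i \<in> Basis" for i
    unfolding y_def using that by (rule inner_sum_left_Basis)
  have "y \<in> cbox a b" using x ab ce
    by (auto simp: mem_box y inner_add_left algebra_simps)
  moreover have "x - y \<in> cbox c e"
    using x ab ce by (fastforce simp: mem_box y inner_add_left inner_diff_left algebra_simps max_def)
  ultimately have "y + (x - y) \<in> cbox a b + cbox c e" by (rule set_plus_intro)
  then show "x \<in> cbox a b + cbox c e" by simp
qed

text \<open>The arithmetic-geometric mean inequality, applied to the ratios \<open>x i / (x i + y i)\<close>
  and \<open>y i / (x i + y i)\<close>; this is the Brunn--Minkowski inequality for two boxes.\<close>

lemma prod_powr_superadditive:
  fixes x y :: "'b \<Rightarrow> real"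
  assumes I: "finite I" "I \<noteq> {}" and x: "\<And>i. i \<in> I \<Longrightarrow> x i > 0" and y: "\<And>i. i \<in> I \<Longrightarrow> y i > 0"
  shows "(\<Prod>i\<in>I. x i) powr (1 / card I) + (\<Prod>i\<in>I. y i) powr (1 / card I)
    \<le> (\<Prod>i\<in>I. x i + y i) powr (1 / card I)"
proof -
  let ?n = "card I" and ?z = "\<lambda>i. x i + y i"
  have z: "?z i > 0" if "i \<in> I" for i using x[OF that] y[OF that] by simp
  have n: "real ?n > 0" using I by (simp add: card_gt_0_iff)
  have 1: "(\<Prod>i\<in>I. x i / ?z i) powr (1 / ?n) \<le> (\<Sum>i\<in>I. x i / ?z i / ?n)"
    using arith_geom_mean[OF I, of "\<lambda>i. x i / ?z i"] x z by (force intro: less_imp_le divide_nonneg_pos)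
  have 2: "(\<Prod>i\<in>I. y i / ?z i) powr (1 / ?n) \<le> (\<Sum>i\<in>I. y i / ?z i / ?n)"
    using arith_geom_mean[OF I, of "\<lambda>i. y i / ?z i"] y z by (force intro: less_imp_le divide_nonneg_pos)
  have "(\<Sum>i\<in>I. x i / ?z i / ?n) + (\<Sum>i\<in>I. y i / ?z i / ?n) = (\<Sum>i\<in>I. 1 / ?n)"
    unfolding sum.distrib[symmetric]
    by (intro sum.cong refl) (use z in \<open>force simp: add_divide_distrib[symmetric]\<close>)
  also have "\<dots> = 1" using n by simp
  finally have 3: "(\<Prod>i\<in>I. x i / ?z i) powr (1 / ?n) + (\<Prod>i\<in>I. y i / ?z i) powr (1 / ?n) \<le> 1"
    using 1 2 by linarith
  have Z: "(\<Prod>i\<in>I. ?z i) powr (1 / ?n) > 0"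
    using prod_pos[of I ?z] z by simp
  have e1: "(\<Prod>i\<in>I. x i / ?z i) powr (1 / ?n) = (\<Prod>i\<in>I. x i) powr (1 / ?n) / (\<Prod>i\<in>I. ?z i) powr (1 / ?n)"
    by (simp add: prod_dividef powr_divide prod_nonneg less_imp_le x z)
  have e2: "(\<Prod>i\<in>I. y i / ?z i) powr (1 / ?n) = (\<Prod>i\<in>I. y i) powr (1 / ?n) / (\<Prod>i\<in>I. ?z i) powr (1 / ?n)"
    by (simp add: prod_dividef powr_divide prod_nonneg less_imp_le y z)
  show ?thesis
    using 3 Z unfolding e1 e2 by (simp add: field_simps)
qed

text \<open>The boxes are required to have nonempty interior so that any two of them lie on different sides
  of a coordinate hyperplane.\<close>

definition nonoverlapping_boxes :: "'a::euclidean_space set set \<Rightarrow> bool" where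
  "nonoverlapping_boxes D \<longleftrightarrow> finite D \<and> (\<forall>R\<in>D. \<exists>a b. R = cbox a b \<and> box a b \<noteq> {})
     \<and> pairwise (\<lambda>R S. interior R \<inter> interior S = {}) D"

lemma compact_boxes_Union: "nonoverlapping_boxes D \<Longrightarrow> compact (\<Union>D)"
  unfolding nonoverlapping_boxes_def by (intro compact_Union) auto

lemma boxes_measure_pos:
  assumes "nonoverlapping_boxes D" "D \<noteq> {}"
  shows "measure lebesgue (\<Union>D) > 0"
proof -
  obtain R where R: "R \<in> D" using assms(2) by blast
  then obtain a b where ab: "R = cbox a b" "box a b \<noteq> {}"
    using assms(1) unfolding nonoverlapping_boxes_def by metis
  have "interior (\<Union>D) \<noteq> {}"
    using ab R interior_mono[of R "\<Union>D"] by (auto simp: interior_cbox)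
  then have "\<not> negligible (\<Union>D)"
    using negligible_iff_null_sets[of "\<Union>D"] by (meson interior_subset negligible_subset open_interior open_not_negligible)
  then show ?thesis
    using negligible_iff_measure0[OF lmeasurable_compact[OF compact_boxes_Union[OF assms(1)]]]
    by (simp add: less_le)
qed

text \<open>Pieces without interior are dropped, so that cutting along a hyperplane that separates two of the
  boxes leaves fewer boxes on each side; the proof of the Brunn--Minkowski inequality is an induction
  on their number.\<close>

definition boxes_restrict :: "'a::euclidean_space set set \<Rightarrow> 'a set \<Rightarrow> 'a set set" where
  "boxes_restrict D H = {R \<inter> H |R. R \<in> D \<and> interior (R \<inter> H) \<noteq> {}}"

lemma boxes_restrict:
  assumes D: "nonoverlapping_boxes D" and H: "\<And>a b. \<exists>a' b'. cbox a b \<inter> H = cbox a' b'"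
  shows "nonoverlapping_boxes (boxes_restrict D H)"
    and "card (boxes_restrict D H) \<le> card D"
    and "\<Union>(boxes_restrict D H) \<subseteq> \<Union>D \<inter> H"
    and "measure lebesgue (\<Union>(boxes_restrict D H)) = measure lebesgue (\<Union>D \<inter> H)"
    and "\<And>R. R \<in> D \<Longrightarrow> interior (R \<inter> H) = {} \<Longrightarrow> card (boxes_restrict D H) < card D"
proof -
  let ?E = "boxes_restrict D H" and ?D = "{R\<in>D. interior (R \<inter> H) \<noteq> {}}"
  have fin: "finite D" using D by (simp add: nonoverlapping_boxes_def)
  have E: "?E = (\<lambda>R. R \<inter> H) ` ?D" by (auto simp: boxes_restrict_def)
  have box: "\<exists>a b. R \<inter> H = cbox a b" if "R \<in> D" for R
    using that D H unfolding nonoverlapping_boxes_def by metis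
  show boxes: "nonoverlapping_boxes ?E"
    unfolding nonoverlapping_boxes_def
  proof (intro conjI ballI)
    show "finite ?E" using fin by (simp add: E)
    fix R assume "R \<in> ?E"
    then obtain R' where R': "R = R' \<inter> H" "R' \<in> D" "interior R \<noteq> {}"
      by (auto simp: boxes_restrict_def)
    then obtain a b where "R = cbox a b" using box by metis
    then show "\<exists>a b. R = cbox a b \<and> box a b \<noteq> {}"
      using R'(3) interior_cbox by metis
  next
    show "pairwise (\<lambda>R S. interior R \<inter> interior S = {}) ?E"
    proof (rule pairwiseI)
      fix R S assume "R \<in> ?E" "S \<in> ?E" "R \<noteq> S"
      then obtain R' S' where *: "R = R' \<inter> H" "S = S' \<inter> H" "R' \<in> D" "S' \<in> D" "R' \<noteq> S'"
        by (auto simp: boxes_restrict_def)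
      then have "interior R' \<inter> interior S' = {}"
        using D by (auto simp: nonoverlapping_boxes_def pairwise_def)
      then show "interior R \<inter> interior S = {}" using * by (auto simp: interior_Int)
    qed
  qed
  have "card ?E \<le> card ?D" unfolding E using fin by (intro card_image_le) auto
  then show card: "card ?E \<le> card D" using card_mono[of D ?D] fin by auto
  show sub: "\<Union>?E \<subseteq> \<Union>D \<inter> H" by (auto simp: boxes_restrict_def)
  have neg: "negligible ((\<Union>D \<inter> H) - \<Union>?E)"
  proof (rule negligible_subset)
    show "negligible (\<Union>((\<lambda>R. R \<inter> H) ` {R\<in>D. interior (R \<inter> H) = {}}))"
    proof (rule negligible_Union)
      show "finite ((\<lambda>R. R \<inter> H) ` {R\<in>D. interior (R \<inter> H) = {}})" using fin by auto
      fix t assume "t \<in> (\<lambda>R. R \<inter> H) ` {R\<in>D. interior (R \<inter> H) = {}}"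
      then obtain R where R: "t = R \<inter> H" "R \<in> D" "interior t = {}" by auto
      then obtain a b where "t = cbox a b" using box by metis
      then show "negligible t" using R(3) negligible_convex_interior[of t] convex_box by simp
    qed
    show "(\<Union>D \<inter> H) - \<Union>?E \<subseteq> \<Union>((\<lambda>R. R \<inter> H) ` {R\<in>D. interior (R \<inter> H) = {}})"
      by (auto simp: boxes_restrict_def)
  qed
  have "\<Union>?E - (\<Union>D \<inter> H) = {}" using sub by blast
  then show "measure lebesgue (\<Union>?E) = measure lebesgue (\<Union>D \<inter> H)"
    using neg measure_negligible_symdiff[OF lmeasurable_compact[OF compact_boxes_Union[OF boxes]], of "\<Union>D \<inter> H"]
    by simp
  show "card ?E < card D" if "R \<in> D" "interior (R \<inter> H) = {}" for R
  proof -
    have "card ?D < card D" using that fin by (intro psubset_card_mono) auto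
    then show ?thesis using \<open>card ?E \<le> card ?D\<close> by simp
  qed
qed

text \<open>A slab of width \<open>h\<close> cut out of a bounded set lies in a box with one side \<open>h\<close>, so the function is
  Lipschitz. Continuity allows a set to be cut in a prescribed volume ratio.\<close>

lemma measure_slab_continuous:
  fixes S :: "'a::euclidean_space set"
  assumes S: "compact S" and k: "k \<in> Basis"
  shows "continuous_on UNIV (\<lambda>c. measure lebesgue (S \<inter> {x. x \<bullet> k \<le> c}))"
proof -
  let ?m = "\<lambda>c. measure lebesgue (S \<inter> {x. x \<bullet> k \<le> c})"
  obtain r where r: "r > 0" "S \<subseteq> cbox (- r *\<^sub>R One) (r *\<^sub>R One)"
  proof -
    obtain a :: 'a where a: "S \<subseteq> cbox (- a) a"
      using bounded_subset_cbox_symmetric[OF compact_imp_bounded[OF S]] by metis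
    define r where "r = norm a + 1"
    have "cbox (- a) a \<subseteq> cbox (- r *\<^sub>R One) (r *\<^sub>R One)"
      unfolding subset_box
    proof (intro impI ballI conjI)
      fix i :: 'a assume "i \<in> Basis"
      then have "\<bar>a \<bullet> i\<bar> \<le> r" using Basis_le_norm[of i a] by (simp add: r_def)
      then show "(- r *\<^sub>R One) \<bullet> i \<le> - a \<bullet> i" "a \<bullet> i \<le> (r *\<^sub>R One) \<bullet> i"
        using \<open>i \<in> Basis\<close> by simp_all
    qed
    moreover have "r > 0" by (simp add: r_def add_nonneg_pos)
    ultimately show ?thesis using that a by (meson order_trans)
  qed
  have fm: "S \<inter> {x. x \<bullet> k \<le> c} \<in> lmeasurable" for c
    using S by (intro lmeasurable_compact compact_Int_closed)
      (auto simp: inner_commute[of _ k] closed_halfspace_le)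
  define L where "L = (2 * r) ^ (DIM('a) - 1)"
  have le: "?m c' - ?m c \<le> L * (c' - c)" "?m c \<le> ?m c'" if "c \<le> c'" for c c'
  proof -
    let ?p = "\<Sum>i\<in>Basis. (if i = k then c else - r) *\<^sub>R i"
    let ?q = "\<Sum>i\<in>Basis. (if i = k then c' else r) *\<^sub>R (i::'a)"
    show "?m c \<le> ?m c'"
      by (rule measure_mono_fmeasurable) (use that fm[of c] fm[of c'] in auto)
    have "S \<inter> {x. x \<bullet> k \<le> c'} - S \<inter> {x. x \<bullet> k \<le> c} \<subseteq> cbox ?p ?q"
    proof
      fix x assume x: "x \<in> S \<inter> {x. x \<bullet> k \<le> c'} - S \<inter> {x. x \<bullet> k \<le> c}"
      then have "x \<in> cbox (- r *\<^sub>R One) (r *\<^sub>R One)" using r by auto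
      with x show "x \<in> cbox ?p ?q" by (auto simp: mem_box)
    qed
    then have "measure lebesgue (S \<inter> {x. x \<bullet> k \<le> c'} - S \<inter> {x. x \<bullet> k \<le> c}) \<le> measure lebesgue (cbox ?p ?q)"
      using fm by (intro measure_mono_fmeasurable) (auto intro: fmeasurable.Diff)
    also have "\<dots> = (\<Prod>i\<in>Basis. if i = k then c' - c else 2 * r)"
      using that r k by (simp add: content_cbox_cases) (intro prod.cong, auto)
    also have "\<dots> = (c' - c) * (\<Prod>i\<in>Basis - {k}. 2 * r)"
      using k by (simp add: prod.remove[of _ k])
    also have "\<dots> = L * (c' - c)" using k by (simp add: L_def)
    finally have "measure lebesgue (S \<inter> {x. x \<bullet> k \<le> c'} - S \<inter> {x. x \<bullet> k \<le> c}) \<le> L * (c' - c)" .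
    moreover have "S \<inter> {x. x \<bullet> k \<le> c} \<subseteq> S \<inter> {x. x \<bullet> k \<le> c'}" using that by auto
    ultimately show "?m c' - ?m c \<le> L * (c' - c)"
      using measurable_measure_Diff[OF fm fmeasurableD[OF fm]] by simp
  qed
  have "L-lipschitz_on UNIV ?m"
  proof (rule lipschitz_onI)
    show "0 \<le> L" using r by (simp add: L_def)
    fix c c' :: real
    show "dist (?m c) (?m c') \<le> L * dist c c'"
      using le[of c c'] le[of c' c] by (cases "c \<le> c'") (auto simp: dist_real_def)
  qed
  then show ?thesis by (rule lipschitz_on_continuous_on)
qed

lemma boxes_halfspace:
  fixes k :: "'a::euclidean_space" assumes "k \<in> Basis"
  shows "\<exists>a' b'. cbox a b \<inter> {x. x \<bullet> k \<le> c} = cbox a' b'"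
    and "\<exists>a' b'. cbox a b \<inter> {x. c \<le> x \<bullet> k} = cbox a' b'"
  using interval_split[OF assms, of a b c] by blast+

lemma measure_split_halfspace:
  fixes S :: "'a::euclidean_space set"
  assumes S: "compact S" and k: "k \<in> Basis"
  shows "measure lebesgue S = measure lebesgue (S \<inter> {x. x \<bullet> k \<le> c}) + measure lebesgue (S \<inter> {x. c \<le> x \<bullet> k})"
proof -
  have m: "S \<inter> {x. x \<bullet> k \<le> c} \<in> lmeasurable" "S \<inter> {x. c \<le> x \<bullet> k} \<in> lmeasurable"
    using S by (auto intro!: lmeasurable_compact compact_Int_closed
        simp: inner_commute[of _ k] closed_halfspace_le closed_halfspace_ge)
  have "negligible ((S \<inter> {x. x \<bullet> k \<le> c}) \<inter> (S \<inter> {x. c \<le> x \<bullet> k}))"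
    by (rule negligible_subset[OF negligible_standard_hyperplane[OF k, of c]]) auto
  then have "measure lebesgue ((S \<inter> {x. x \<bullet> k \<le> c}) \<union> (S \<inter> {x. c \<le> x \<bullet> k}))
     = measure lebesgue (S \<inter> {x. x \<bullet> k \<le> c}) + measure lebesgue (S \<inter> {x. c \<le> x \<bullet> k})"
    using m by (simp add: measure_Un3 negligible_imp_measure0)
  moreover have "(S \<inter> {x. x \<bullet> k \<le> c}) \<union> (S \<inter> {x. c \<le> x \<bullet> k}) = S" by auto
  ultimately show ?thesis by simp
qed

definition brunn_minkowski :: "'a::euclidean_space set \<Rightarrow> 'a set \<Rightarrow> bool" where
  "brunn_minkowski A B \<longleftrightarrow> measure lebesgue A powr (1 / DIM('a)) + measure lebesgue B powr (1 / DIM('a))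
     \<le> measure lebesgue (A + B) powr (1 / DIM('a))"

lemma brunn_minkowski_cbox:
  fixes a b c e :: "'a::euclidean_space"
  assumes "box a b \<noteq> {}" "box c e \<noteq> {}"
  shows "brunn_minkowski (cbox a b) (cbox c e)"
proof -
  have ne: "cbox a b \<noteq> {}" "cbox c e \<noteq> {}" using assms box_subset_cbox by blast+
  have pos: "a \<bullet> i < b \<bullet> i" "c \<bullet> i < e \<bullet> i" if "i \<in> Basis" for i
    using assms that by (auto simp: box_ne_empty)
  have 1: "measure lebesgue (cbox a b) = (\<Prod>i\<in>Basis. b \<bullet> i - a \<bullet> i)"
    and 2: "measure lebesgue (cbox c e) = (\<Prod>i\<in>Basis. e \<bullet> i - c \<bullet> i)"
    using ne by (simp_all add: content_cbox')
  have 3: "measure lebesgue (cbox (a + c) (b + e)) = (\<Prod>i\<in>Basis. (b \<bullet> i - a \<bullet> i) + (e \<bullet> i - c \<bullet> i))"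
    using pos by (subst measure_completion, simp, subst content_cbox)
      (auto intro!: prod.cong simp: inner_add_left intro: add_mono less_imp_le)
  show ?thesis
    unfolding brunn_minkowski_def cbox_set_plus[OF ne] 1 2 3
    by (rule prod_powr_superadditive) (use pos in auto)
qed

text \<open>The sums \<open>A1 + B1\<close> and \<open>A2 + B2\<close> are again separated by a hyperplane, so their volumes add up.
  Because the two sets are cut in the same volume ratio, the lower bounds for these volumes are the
  fractions \<open>l\<close> and \<open>1 - l\<close> of the one for \<open>A + B\<close>.\<close>

lemma brunn_minkowski_glue:
  fixes A B :: "'a::euclidean_space set"
  assumes k: "k \<in> Basis"
    and cpt: "compact A" "compact B" "compact A1" "compact A2" "compact B1" "compact B2"
    and sub: "A1 \<subseteq> A \<inter> {x. x \<bullet> k \<le> c}" "A2 \<subseteq> A \<inter> {x. c \<le> x \<bullet> k}"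
      "B1 \<subseteq> B \<inter> {x. x \<bullet> k \<le> c'}" "B2 \<subseteq> B \<inter> {x. c' \<le> x \<bullet> k}"
    and vol: "measure lebesgue A1 = l * measure lebesgue A" "measure lebesgue A2 = (1 - l) * measure lebesgue A"
      "measure lebesgue B1 = l * measure lebesgue B" "measure lebesgue B2 = (1 - l) * measure lebesgue B"
    and l: "0 \<le> l" "l \<le> 1"
    and bm: "brunn_minkowski A1 B1" "brunn_minkowski A2 B2"
  shows "brunn_minkowski A B"
proof -
  let ?n = "real DIM('a)"
  define s where "s = measure lebesgue A powr (1 / ?n) + measure lebesgue B powr (1 / ?n)"
  have n: "?n > 0" by simp
  have s0: "s \<ge> 0" by (simp add: s_def)
  have vpow: "(x powr (1 / ?n)) ^ DIM('a) = x" if "x \<ge> 0" for x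
    using that by (simp add: powr_realpow'[symmetric] powr_powr)
  have piece: "t * s ^ DIM('a) \<le> measure lebesgue (X + Y)"
    if "brunn_minkowski X Y" "measure lebesgue X = t * measure lebesgue A" "measure lebesgue Y = t * measure lebesgue B" "t \<ge> 0"
    for X Y :: "'a set" and t
  proof -
    have "t powr (1 / ?n) * s \<le> measure lebesgue (X + Y) powr (1 / ?n)"
      using that by (simp add: brunn_minkowski_def powr_mult s_def distrib_left)
    then have "(t powr (1 / ?n) * s) ^ DIM('a) \<le> (measure lebesgue (X + Y) powr (1 / ?n)) ^ DIM('a)"
      using s0 by (intro power_mono) auto
    then show ?thesis using that by (simp add: power_mult_distrib vpow)
  qed
  have split: "measure lebesgue (A + B) = measure lebesgue ((A + B) \<inter> {x. x \<bullet> k \<le> c + c'})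
      + measure lebesgue ((A + B) \<inter> {x. c + c' \<le> x \<bullet> k})"
    by (rule measure_split_halfspace) (use k cpt in \<open>auto intro: compact_set_plus\<close>)
  have "measure lebesgue (A1 + B1) \<le> measure lebesgue ((A + B) \<inter> {x. x \<bullet> k \<le> c + c'})"
  proof (rule measure_mono_fmeasurable)
    show "A1 + B1 \<subseteq> (A + B) \<inter> {x. x \<bullet> k \<le> c + c'}"
      using sub by (fastforce simp: set_plus_def inner_add_left)
    show "A1 + B1 \<in> sets lebesgue" using cpt by (intro fmeasurableD lmeasurable_compact compact_set_plus)
    show "(A + B) \<inter> {x. x \<bullet> k \<le> c + c'} \<in> lmeasurable"
      using cpt by (auto intro!: lmeasurable_compact compact_Int_closed compact_set_plus
        simp: inner_commute[of _ k] closed_halfspace_le)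
  qed
  moreover have "measure lebesgue (A2 + B2) \<le> measure lebesgue ((A + B) \<inter> {x. c + c' \<le> x \<bullet> k})"
  proof (rule measure_mono_fmeasurable)
    show "A2 + B2 \<subseteq> (A + B) \<inter> {x. c + c' \<le> x \<bullet> k}"
      using sub by (fastforce simp: set_plus_def inner_add_left)
    show "A2 + B2 \<in> sets lebesgue" using cpt by (intro fmeasurableD lmeasurable_compact compact_set_plus)
    show "(A + B) \<inter> {x. c + c' \<le> x \<bullet> k} \<in> lmeasurable"
      using cpt by (auto intro!: lmeasurable_compact compact_Int_closed compact_set_plus
        simp: inner_commute[of _ k] closed_halfspace_ge)
  qed
  moreover have "l * s ^ DIM('a) \<le> measure lebesgue (A1 + B1)"
    "(1 - l) * s ^ DIM('a) \<le> measure lebesgue (A2 + B2)"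
    using piece[OF bm(1)] piece[OF bm(2)] vol l by auto
  ultimately have "s ^ DIM('a) \<le> measure lebesgue (A + B)"
    unfolding split by (simp add: algebra_simps)
  then have "(s ^ DIM('a)) powr (1 / ?n) \<le> measure lebesgue (A + B) powr (1 / ?n)"
    using s0 by (intro powr_mono2) auto
  moreover have "(s ^ DIM('a)) powr (1 / ?n) = s"
    using s0 by (cases "s = 0") (simp_all add: powr_realpow[symmetric] powr_powr)
  ultimately show ?thesis by (simp add: brunn_minkowski_def s_def)
qed

text \<open>The step of the Hadwiger--Ohmann induction: a hyperplane between two boxes of \<open>D\<close> leaves fewer
  boxes of \<open>D\<close> on each side. The family \<open>E\<close> is cut by a parallel hyperplane in the same volume
  ratio, which does not increase the number of its boxes on either side.\<close>

lemma brunn_minkowski_boxes_step: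
  fixes D E :: "'a::euclidean_space set set"
  assumes D: "nonoverlapping_boxes D" "2 \<le> card D" and E: "nonoverlapping_boxes E" "E \<noteq> {}"
    and IH: "\<And>D' E' :: 'a set set. \<lbrakk>card D' < card D; card E' \<le> card E; nonoverlapping_boxes D';
      nonoverlapping_boxes E'; D' \<noteq> {}; E' \<noteq> {}\<rbrakk> \<Longrightarrow> brunn_minkowski (\<Union>D') (\<Union>E')"
  shows "brunn_minkowski (\<Union>D) (\<Union>E)"
proof -
  have cD: "compact (\<Union>D)" and cE: "compact (\<Union>E)"
    using D E by (simp_all add: compact_boxes_Union)
  have Dne: "D \<noteq> {}" using D by auto
  have posD: "measure lebesgue (\<Union>D) > 0" and posE: "measure lebesgue (\<Union>E) > 0"
    using boxes_measure_pos D E Dne by auto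
  obtain R1 R2 where R: "R1 \<in> D" "R2 \<in> D" "R1 \<noteq> R2"
    using D(2) by (metis card_le_Suc0_iff_eq card.infinite not_less_eq_eq numeral_2_eq_2 zero_le)
  obtain a1 b1 a2 b2 where R1: "R1 = cbox a1 b1" "box a1 b1 \<noteq> {}" and R2: "R2 = cbox a2 b2" "box a2 b2 \<noteq> {}"
    using D(1) R unfolding nonoverlapping_boxes_def by metis
  have "box a1 b1 \<inter> box a2 b2 = {}"
    using D(1) R R1 R2 unfolding nonoverlapping_boxes_def pairwise_def by (metis interior_cbox)
  then obtain k where k: "k \<in> Basis" "b1 \<bullet> k \<le> a2 \<bullet> k \<or> b2 \<bullet> k \<le> a1 \<bullet> k"
    using R1(2) R2(2) by (auto simp: disjoint_interval box_ne_empty)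
  have *: ?thesis if S: "S1 \<in> D" "S2 \<in> D" "S1 = cbox p1 q1" "S2 = cbox p2 q2" "box p1 q1 \<noteq> {}" "box p2 q2 \<noteq> {}"
      and sep: "q1 \<bullet> k \<le> p2 \<bullet> k" for S1 S2 p1 q1 p2 q2
  proof -
    define c where "c = p2 \<bullet> k"
    let ?Hm = "\<lambda>c. {x. x \<bullet> k \<le> c}" and ?Hp = "\<lambda>c. {x. c \<le> x \<bullet> k}"
    note rm = boxes_restrict[OF _ boxes_halfspace(1)[OF k(1)]]
    note rp = boxes_restrict[OF _ boxes_halfspace(2)[OF k(1)]]
    let ?Dm = "boxes_restrict D (?Hm c)" and ?Dp = "boxes_restrict D (?Hp c)"
    have hyp: "interior (X \<inter> {x. x \<bullet> k = c}) = {}" for X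
    proof -
      have "negligible (interior (X \<inter> {x. x \<bullet> k = c}))"
        by (rule negligible_subset[OF negligible_standard_hyperplane[OF k(1), of c]])
          (use interior_subset in fast)
      then show ?thesis using open_not_negligible open_interior by blast
    qed
    have "S2 \<inter> ?Hm c = S2 \<inter> {x. x \<bullet> k = c}" using S(4) k(1) by (force simp: mem_box c_def)
    then have i2: "interior (S2 \<inter> ?Hm c) = {}" using hyp by simp
    have "S1 \<inter> ?Hp c = S1 \<inter> {x. x \<bullet> k = c}" using S(3) k(1) sep by (force simp: mem_box c_def)
    then have i1: "interior (S1 \<inter> ?Hp c) = {}" using hyp by simp
    have s1: "S1 \<inter> ?Hm c = S1" using S(3) k(1) sep by (force simp: mem_box c_def)
    have s2: "S2 \<inter> ?Hp c = S2" using S(4) k(1) sep by (force simp: mem_box c_def)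
    have "S1 \<in> ?Dm" unfolding boxes_restrict_def
      using S(1) s1 S(5) unfolding S(3) by (intro CollectI exI[of _ S1]) (simp add: interior_cbox S(3))
    then have Dm: "?Dm \<noteq> {}" by blast
    have "S2 \<in> ?Dp" unfolding boxes_restrict_def
      using S(2) s2 S(6) unfolding S(4) by (intro CollectI exI[of _ S2]) (simp add: interior_cbox S(4))
    then have Dp: "?Dp \<noteq> {}" by blast
    define l where "l = measure lebesgue (\<Union>?Dm) / measure lebesgue (\<Union>D)"
    have sumD: "measure lebesgue (\<Union>D) = measure lebesgue (\<Union>?Dm) + measure lebesgue (\<Union>?Dp)"
      using measure_split_halfspace[OF cD k(1), of c] rm(4)[OF D(1)] rp(4)[OF D(1)] by simp
    have pDm: "measure lebesgue (\<Union>?Dm) > 0" and pDp: "measure lebesgue (\<Union>?Dp) > 0"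
      using boxes_measure_pos rm(1)[OF D(1)] rp(1)[OF D(1)] Dm Dp by auto
    have l: "0 < l" "l < 1" using pDm pDp sumD by (auto simp: l_def)
    have vD: "measure lebesgue (\<Union>?Dm) = l * measure lebesgue (\<Union>D)"
      "measure lebesgue (\<Union>?Dp) = (1 - l) * measure lebesgue (\<Union>D)"
      using posD sumD by (auto simp: l_def field_simps)
    \<comment> \<open>cut the other family in the same volume ratio\<close>
    obtain r where r: "\<And>x. x \<in> \<Union>E \<Longrightarrow> \<bar>x \<bullet> k\<bar> \<le> r"
      using compact_imp_bounded[OF cE] k(1) unfolding bounded_iff by (meson Basis_le_norm order_trans)
    have e1: "\<Union>E \<inter> ?Hm (- (\<bar>r\<bar> + 1)) = {}" using r by (force simp: disjoint_iff)
    have e2: "\<Union>E \<inter> ?Hm (\<bar>r\<bar> + 1) = \<Union>E" using r by force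
    have "\<exists>c'. - (\<bar>r\<bar> + 1) \<le> c' \<and> c' \<le> \<bar>r\<bar> + 1 \<and> measure lebesgue (\<Union>E \<inter> ?Hm c') = l * measure lebesgue (\<Union>E)"
    proof (rule IVT')
      show "measure lebesgue (\<Union>E \<inter> ?Hm (- (\<bar>r\<bar> + 1))) \<le> l * measure lebesgue (\<Union>E)"
        using e1 l posE by simp
      show "l * measure lebesgue (\<Union>E) \<le> measure lebesgue (\<Union>E \<inter> ?Hm (\<bar>r\<bar> + 1))"
        unfolding e2 using l posE by (simp add: mult_left_le_one_le)
      show "continuous_on {- (\<bar>r\<bar> + 1)..\<bar>r\<bar> + 1} (\<lambda>c. measure lebesgue (\<Union>E \<inter> ?Hm c))"
        using measure_slab_continuous[OF cE k(1)] continuous_on_subset by blast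
    qed simp
    then obtain c' where c': "measure lebesgue (\<Union>E \<inter> ?Hm c') = l * measure lebesgue (\<Union>E)" by blast
    let ?Em = "boxes_restrict E (?Hm c')" and ?Ep = "boxes_restrict E (?Hp c')"
    have vE: "measure lebesgue (\<Union>?Em) = l * measure lebesgue (\<Union>E)"
      "measure lebesgue (\<Union>?Ep) = (1 - l) * measure lebesgue (\<Union>E)"
      using c' measure_split_halfspace[OF cE k(1), of c'] rm(4)[OF E(1)] rp(4)[OF E(1)]
      by (auto simp: algebra_simps)
    have Em: "?Em \<noteq> {}" and Ep: "?Ep \<noteq> {}" using vE l posE by auto
    show ?thesis
    proof (rule brunn_minkowski_glue[OF k(1) cD cE])
      show "brunn_minkowski (\<Union>?Dm) (\<Union>?Em)"
        by (rule IH) (use rm[OF D(1)] rm[OF E(1)] i2 S Dm Em in auto)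
      show "brunn_minkowski (\<Union>?Dp) (\<Union>?Ep)"
        by (rule IH) (use rp[OF D(1)] rp[OF E(1)] i1 S Dp Ep in auto)
      show "\<Union>?Dm \<subseteq> \<Union>D \<inter> ?Hm c" "\<Union>?Em \<subseteq> \<Union>E \<inter> ?Hm c'" "\<Union>?Dp \<subseteq> \<Union>D \<inter> ?Hp c" "\<Union>?Ep \<subseteq> \<Union>E \<inter> ?Hp c'"
        by (rule rm(3)[OF D(1)] rm(3)[OF E(1)] rp(3)[OF D(1)] rp(3)[OF E(1)])+
      show "compact (\<Union>?Dm)" "compact (\<Union>?Em)" "compact (\<Union>?Dp)" "compact (\<Union>?Ep)"
        using rm(1)[OF D(1)] rm(1)[OF E(1)] rp(1)[OF D(1)] rp(1)[OF E(1)] by (simp_all add: compact_boxes_Union)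
    qed (use vD vE l in auto)
  qed
  show ?thesis
    using k(2) *[OF R(1,2) R1(1) R2(1) R1(2) R2(2)] *[OF R(2,1) R2(1) R1(1) R2(2) R1(2)] by blast
qed

lemma brunn_minkowski_commute: "brunn_minkowski A B \<longleftrightarrow> brunn_minkowski B A"
  by (simp add: brunn_minkowski_def add.commute)

lemma brunn_minkowski_boxes:
  fixes D E :: "'a::euclidean_space set set"
  assumes "nonoverlapping_boxes D" "nonoverlapping_boxes E" "D \<noteq> {}" "E \<noteq> {}"
  shows "brunn_minkowski (\<Union>D) (\<Union>E)"
  using assms
proof (induction "card D + card E" arbitrary: D E rule: less_induct)
  case less
  have fin: "finite D" "finite E" using less.prems by (auto simp: nonoverlapping_boxes_def)
  then have card: "card D \<ge> 1" "card E \<ge> 1" using less.prems by (auto simp: card_gt_0_iff Suc_le_eq)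
  consider "2 \<le> card D" | "2 \<le> card E" | "card D = 1" "card E = 1" using card by linarith
  then show ?case
  proof cases
    case 1
    show ?thesis
    proof (rule brunn_minkowski_boxes_step[OF less.prems(1) 1 less.prems(2,4)])
      fix D' E' :: "'a set set"
      assume "card D' < card D" "card E' \<le> card E" and *: "nonoverlapping_boxes D'"
        "nonoverlapping_boxes E'" "D' \<noteq> {}" "E' \<noteq> {}"
      then show "brunn_minkowski (\<Union>D') (\<Union>E')" by (intro less.hyps) auto
    qed
  next
    case 2
    have "brunn_minkowski (\<Union>E) (\<Union>D)"
    proof (rule brunn_minkowski_boxes_step[OF less.prems(2) 2 less.prems(1,3)])
      fix D' E' :: "'a set set"
      assume "card D' < card E" "card E' \<le> card D" and *: "nonoverlapping_boxes D'"
        "nonoverlapping_boxes E'" "D' \<noteq> {}" "E' \<noteq> {}"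
      then show "brunn_minkowski (\<Union>D') (\<Union>E')" by (intro less.hyps) auto
    qed
    then show ?thesis using brunn_minkowski_commute by blast
  next
    case 3
    then obtain R S where RS: "D = {R}" "E = {S}" by (metis card_1_singletonE)
    moreover obtain a b where "R = cbox a b" "box a b \<noteq> {}"
      using less.prems(1) by (auto simp: RS nonoverlapping_boxes_def)
    moreover obtain c e where "S = cbox c e" "box c e \<noteq> {}"
      using less.prems(2) by (auto simp: RS nonoverlapping_boxes_def)
    ultimately show ?thesis using brunn_minkowski_cbox by simp
  qed
qed

text \<open>The interior of \<open>A\<close> has the same volume and is a countable union of boxes; finitely many of
  these boxes carry almost all of the volume and can be subdivided into nonoverlapping ones.\<close>

lemma inner_boxes:
  fixes A :: "'a::euclidean_space set"
  assumes "compact A" "negligible (frontier A)" "e < measure lebesgue A"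
  obtains D where "nonoverlapping_boxes D" "\<Union>D \<subseteq> A" "e < measure lebesgue (\<Union>D)"
proof -
  have mint: "measure lebesgue (interior A) = measure lebesgue A"
    using assms by (intro measure_interior compact_imp_bounded)
  obtain C :: "'a set set" where C: "countable C" "C \<subseteq> Pow (interior A)" "\<And>X. X \<in> C \<Longrightarrow> \<exists>a b. X = cbox a b" "\<Union>C = interior A"
    using open_countable_Union_open_cbox[OF open_interior, of A] by metis
  show ?thesis
  proof (cases "measure lebesgue A = 0")
    case True
    with assms(3) show ?thesis by (intro that[of "{}"]) (auto simp: nonoverlapping_boxes_def)
  next
    case False
    then have "C \<noteq> {}" using mint C(4) by auto
    define F where "F n = (\<Union>i\<le>n. from_nat_into C i)" for n
    have Fc: "from_nat_into C i \<in> C" for i using \<open>C \<noteq> {}\<close> by (rule from_nat_into)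
    have "(\<Union>i. from_nat_into C i) = interior A"
      using range_from_nat_into[OF \<open>C \<noteq> {}\<close> C(1)] C(4) by simp
    moreover have "(\<Union>n. F n) = (\<Union>i. from_nat_into C i)" by (auto simp: F_def)
    ultimately have F: "(\<Union>n. F n) = interior A" by simp
    have Fm: "F n \<in> sets lebesgue" for n unfolding F_def
      using Fc C(3) by (intro sets.finite_UN) (auto, metis sets_completionI_sets fmeasurableD fmeasurable_cbox)
    have "(\<lambda>n. measure lebesgue (F n)) \<longlonglongrightarrow> measure lebesgue (\<Union>n. F n)"
    proof (rule Lim_measure_incseq)
      show "range F \<subseteq> sets lebesgue" using Fm by auto
      show "incseq F" unfolding incseq_def F_def by (intro allI impI UN_mono) auto
      have "interior A \<in> lmeasurable"
        using assms(1) by (intro lmeasurable_open bounded_subset[OF compact_imp_bounded interior_subset]) auto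
      then show "emeasure lebesgue (\<Union>n. F n) \<noteq> \<infinity>" unfolding F by (auto simp: fmeasurable_def)
    qed
    then have "eventually (\<lambda>n. e < measure lebesgue (F n)) sequentially"
      using assms(3) mint by (intro order_tendstoD(1)) (auto simp: F)
    then obtain n where n: "e < measure lebesgue (F n)" by (auto simp: eventually_sequentially)
    obtain p where p: "p division_of (\<Union>(from_nat_into C ` {..n}))"
      using elementary_unions_intervals[of "from_nat_into C ` {..n}"] Fc C(3) by blast
    have Fp: "\<Union>p = F n" using division_ofD(6)[OF p] by (simp add: F_def)
    define q where "q = {R\<in>p. interior R \<noteq> {}}"
    have fp: "finite p" using p by auto
    have q: "nonoverlapping_boxes q"
      unfolding nonoverlapping_boxes_def
    proof (intro conjI ballI pairwiseI)
      show "finite q" using fp by (simp add: q_def)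
      show "\<exists>a b. R = cbox a b \<and> box a b \<noteq> {}" if "R \<in> q" for R
        using that division_ofD(4)[OF p, of R] by (force simp: q_def interior_cbox)
      show "interior R \<inter> interior S = {}" if "R \<in> q" "S \<in> q" "R \<noteq> S" for R S
        using that division_ofD(5)[OF p] by (auto simp: q_def)
    qed
    have "negligible (\<Union>p - \<Union>q)"
    proof (rule negligible_subset)
      show "negligible (\<Union>{R\<in>p. interior R = {}})"
      proof (rule negligible_Union)
        fix t assume "t \<in> {R\<in>p. interior R = {}}"
        then show "negligible t"
          using division_ofD(4)[OF p, of t] negligible_convex_interior[of t] convex_box by auto
      qed (use fp in auto)
    qed (auto simp: q_def)
    moreover have "\<Union>q - \<Union>p = {}" by (auto simp: q_def)
    ultimately have "measure lebesgue (\<Union>p) = measure lebesgue (\<Union>q)"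
      using measure_negligible_symdiff[OF lmeasurable_compact[OF compact_boxes_Union[OF q]], of "\<Union>p"] by simp
    then have "e < measure lebesgue (\<Union>q)" using n Fp by simp
    moreover have "\<Union>q \<subseteq> A"
    proof -
      have "\<Union>q \<subseteq> F n" using Fp by (auto simp: q_def)
      also have "\<dots> \<subseteq> interior A" using F by blast
      finally show ?thesis using interior_subset by blast
    qed
    ultimately show ?thesis using q that by blast
  qed
qed

theorem brunn_minkowski_convex:
  fixes A B :: "'a::euclidean_space set"
  assumes A: "compact A" "convex A" "interior A \<noteq> {}" and B: "compact B" "convex B" "interior B \<noteq> {}"
  shows "brunn_minkowski A B"
proof -
  let ?n = "real DIM('a)" and ?m = "measure lebesgue"
  have posA: "?m A > 0" and posB: "?m B > 0"
    using A B by (auto simp: negligible_iff_measure0[symmetric] lmeasurable_compact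
        negligible_convex_interior zero_less_measure_iff)
  have approx: "a powr (1 / ?n) + b powr (1 / ?n) \<le> ?m (A + B) powr (1 / ?n)"
    if a: "0 < a" "a < ?m A" and b: "0 < b" "b < ?m B" for a b
  proof -
    obtain D where D: "nonoverlapping_boxes D" "\<Union>D \<subseteq> A" "a < ?m (\<Union>D)"
      using inner_boxes[OF A(1) negligible_convex_frontier[OF A(2)] a(2)] by blast
    obtain E where E: "nonoverlapping_boxes E" "\<Union>E \<subseteq> B" "b < ?m (\<Union>E)"
      using inner_boxes[OF B(1) negligible_convex_frontier[OF B(2)] b(2)] by blast
    have "D \<noteq> {}" "E \<noteq> {}" using D E a b by auto
    then have "?m (\<Union>D) powr (1 / ?n) + ?m (\<Union>E) powr (1 / ?n) \<le> ?m (\<Union>D + \<Union>E) powr (1 / ?n)"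
      using brunn_minkowski_boxes D(1) E(1) by (auto simp: brunn_minkowski_def)
    also have "\<dots> \<le> ?m (A + B) powr (1 / ?n)"
    proof (intro powr_mono2)
      show "?m (\<Union>D + \<Union>E) \<le> ?m (A + B)"
        using D(1,2) E(1,2) A(1) B(1)
        by (intro measure_mono_fmeasurable set_plus_mono2)
          (auto intro!: lmeasurable_compact compact_set_plus compact_boxes_Union fmeasurableD)
    qed auto
    finally have "?m (\<Union>D) powr (1 / ?n) + ?m (\<Union>E) powr (1 / ?n) \<le> ?m (A + B) powr (1 / ?n)" .
    moreover have "a powr (1 / ?n) \<le> ?m (\<Union>D) powr (1 / ?n)" "b powr (1 / ?n) \<le> ?m (\<Union>E) powr (1 / ?n)"
      using a b D E by (auto intro!: powr_mono2)
    ultimately show ?thesis by linarith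
  qed
  have lim: "((\<lambda>t. (t * ?m X) powr (1 / ?n)) \<longlongrightarrow> (1 * ?m X) powr (1 / ?n)) (at_left 1)" if "?m X > 0" for X
    using that by (intro tendsto_intros) auto
  have "(1 * ?m A) powr (1 / ?n) + (1 * ?m B) powr (1 / ?n) \<le> ?m (A + B) powr (1 / ?n)"
  proof (rule tendsto_le[OF _ tendsto_const tendsto_add[OF lim[OF posA] lim[OF posB]]])
    show "eventually (\<lambda>t. (t * ?m A) powr (1 / ?n) + (t * ?m B) powr (1 / ?n) \<le> ?m (A + B) powr (1 / ?n)) (at_left 1)"
      using eventually_at_left_real[OF zero_less_one]
    proof eventually_elim
      case (elim t)
      then show ?case using approx posA posB by auto
    qed
  qed simp
  then show ?thesis by (simp add: brunn_minkowski_def)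
qed

abbreviation vol :: "'a::euclidean_space set \<Rightarrow> real" where
  "vol \<equiv> measure lebesgue"

section \<open>Parallel bodies with respect to a zonotope\<close>

lemma additive_mono_imp_linear:
  fixes g :: "real \<Rightarrow> real"
  assumes add: "\<And>s t. 0 \<le> s \<Longrightarrow> 0 \<le> t \<Longrightarrow> g (s + t) = g s + g t"
    and mono: "\<And>s t. 0 \<le> s \<Longrightarrow> s \<le> t \<Longrightarrow> g s \<le> g t"
    and t: "0 \<le> t"
  shows "g t = t * g 1"
proof -
  have g0: "g 0 = 0" using add[of 0 0] by simp
  have g1: "g 1 \<ge> 0" using mono[of 0 1] g0 by simp
  have nat: "g (real n * x) = real n * g x" if "0 \<le> x" for n x
  proof (induction n)
    case (Suc n)
    have "g (real (Suc n) * x) = g (real n * x + x)" by (simp add: algebra_simps)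
    also have "\<dots> = g (real n * x) + g x" using that by (intro add) auto
    finally show ?case using Suc by (simp add: algebra_simps)
  qed (use g0 in simp)
  have bound: "\<bar>g t - t * g 1\<bar> \<le> g 1 / real n" if n: "n > 0" for n :: nat
  proof -
    define m where "m = nat \<lfloor>real n * t\<rfloor>"
    have m: "real m \<le> real n * t" "real n * t \<le> real m + 1"
      using t by (auto simp: m_def)
    have lo: "real m * g 1 \<le> real n * g t"
      using nat[of 1 m] nat[of t n] mono[of "real m" "real n * t"] m t by simp
    have up: "real n * g t \<le> (real m + 1) * g 1"
      using nat[of 1 "Suc m"] nat[of t n] mono[of "real n * t" "real (Suc m)"] m t by (simp add: algebra_simps)
    have "real m * g 1 \<le> real n * t * g 1" "real n * t * g 1 \<le> (real m + 1) * g 1"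
      using m g1 by (simp_all add: mult_right_mono)
    with lo up have "\<bar>real n * g t - real n * t * g 1\<bar> \<le> g 1"
      by (simp add: algebra_simps abs_le_iff)
    then have "real n * \<bar>g t - t * g 1\<bar> \<le> g 1"
      using abs_mult[of "real n" "g t - t * g 1"] by (simp add: right_diff_distrib mult.assoc)
    then show ?thesis using n by (simp add: field_simps)
  qed
  have "(\<lambda>n. g 1 / real n) \<longlonglongrightarrow> 0" by (rule lim_const_over_n)
  then have "\<bar>g t - t * g 1\<bar> \<le> 0"
    by (rule tendsto_lowerbound) (use bound in \<open>auto intro!: eventually_sequentiallyI[of 1]\<close>)
  then show ?thesis by simp
qed

lemma closed_segment_0_eq:
  fixes v :: "'a::euclidean_space"
  assumes "0 \<le> t"
  shows "closed_segment 0 (t *\<^sub>R v) = (\<lambda>s. s *\<^sub>R v) ` {0..t}"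
proof -
  have "closed_segment 0 (t *\<^sub>R v) = (\<lambda>s. s *\<^sub>R v) ` closed_segment 0 t"
    using closed_segment_linear_image[of "\<lambda>s. s *\<^sub>R v" 0 t] by (simp add: linear_scale_left)
  then show ?thesis using assms by (simp add: closed_segment_eq_real_ivl)
qed

lemma mem_plus_segment:
  fixes v :: "'a::euclidean_space"
  assumes "0 \<le> t"
  shows "x \<in> K + closed_segment 0 (t *\<^sub>R v) \<longleftrightarrow> (\<exists>s. 0 \<le> s \<and> s \<le> t \<and> x - s *\<^sub>R v \<in> K)"
  unfolding closed_segment_0_eq[OF assms] set_plus_def
  by (force simp: algebra_simps intro: exI[of _ "x - _"])

text \<open>A line parallel to \<open>v\<close> cannot leave the convex set \<open>K\<close> and come back. Therefore lengthening
  the segment by \<open>h\<close> adds the same set of new points, up to translation, whatever its length was.\<close>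

lemma segment_growth_translate:
  fixes K :: "'a::euclidean_space set"
  assumes K: "convex K" and t: "0 \<le> t" "0 \<le> h"
  shows "(K + closed_segment 0 ((t + h) *\<^sub>R v)) - (K + closed_segment 0 (t *\<^sub>R v))
     = (+) (t *\<^sub>R v) ` ((K + closed_segment 0 (h *\<^sub>R v)) - K)"
proof -
  have th: "0 \<le> t + h" using t by simp
  have A: "z \<in> (K + closed_segment 0 ((t + h) *\<^sub>R v)) - (K + closed_segment 0 (t *\<^sub>R v)) \<longleftrightarrow>
      (\<exists>s. 0 \<le> s \<and> s \<le> t + h \<and> z - s *\<^sub>R v \<in> K) \<and> (\<forall>s. 0 \<le> s \<longrightarrow> s \<le> t \<longrightarrow> z - s *\<^sub>R v \<notin> K)" for z
    by (simp only: Diff_iff mem_plus_segment[OF th] mem_plus_segment[OF t(1)]) blast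
  have B: "z \<in> (K + closed_segment 0 (h *\<^sub>R v)) - K \<longleftrightarrow>
      (\<exists>s. 0 \<le> s \<and> s \<le> h \<and> z - s *\<^sub>R v \<in> K) \<and> z \<notin> K" for z
    by (simp only: Diff_iff mem_plus_segment[OF t(2)])
  have "y + t *\<^sub>R v \<in> (K + closed_segment 0 ((t + h) *\<^sub>R v)) - (K + closed_segment 0 (t *\<^sub>R v))
     \<longleftrightarrow> y \<in> (K + closed_segment 0 (h *\<^sub>R v)) - K" for y
    unfolding A B
  proof (intro iffI conjI; (elim conjE exE)?)
    fix s assume s: "0 \<le> s" "s \<le> t + h" "y + t *\<^sub>R v - s *\<^sub>R v \<in> K"
      and out: "\<forall>s. 0 \<le> s \<longrightarrow> s \<le> t \<longrightarrow> y + t *\<^sub>R v - s *\<^sub>R v \<notin> K"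
    have "s > t" using out s by (meson not_le)
    moreover have "y - (s - t) *\<^sub>R v \<in> K" using s(3) by (simp add: algebra_simps)
    ultimately show "\<exists>s. 0 \<le> s \<and> s \<le> h \<and> y - s *\<^sub>R v \<in> K" using s by (intro exI[of _ "s - t"]) simp
    show "y \<notin> K" using out t(1) by (metis add_diff_cancel order_refl)
  next
    fix s assume s: "0 \<le> s" "s \<le> h" "y - s *\<^sub>R v \<in> K" and y: "y \<notin> K"
    show "\<exists>s. 0 \<le> s \<and> s \<le> t + h \<and> y + t *\<^sub>R v - s *\<^sub>R v \<in> K"
      using s t by (intro exI[of _ "s + t"]) (simp add: algebra_simps)
    show "\<forall>r. 0 \<le> r \<longrightarrow> r \<le> t \<longrightarrow> y + t *\<^sub>R v - r *\<^sub>R v \<notin> K"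
    proof (intro allI impI notI)
      fix r assume r: "0 \<le> r" "r \<le> t" and k': "y + t *\<^sub>R v - r *\<^sub>R v \<in> K"
      define q where "q = t - r"
      have "s \<noteq> 0" using s(3) y by auto
      then have "s + q > 0" using s(1) r by (simp add: q_def)
      have "(s / (s + q)) *\<^sub>R (y + q *\<^sub>R v) + (q / (s + q)) *\<^sub>R (y - s *\<^sub>R v) \<in> K"
      proof (rule convexD[OF K])
        show "y + q *\<^sub>R v \<in> K" using k' by (simp add: q_def algebra_simps)
        show "s / (s + q) + q / (s + q) = 1" using \<open>s + q > 0\<close> by (simp add: add_divide_distrib[symmetric])
        show "0 \<le> s / (s + q)" "0 \<le> q / (s + q)" using \<open>s + q > 0\<close> s(1) r by (simp_all add: q_def)
      qed (rule s(3))
      also have "(s / (s + q)) *\<^sub>R (y + q *\<^sub>R v) + (q / (s + q)) *\<^sub>R (y - s *\<^sub>R v)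
          = (s / (s + q) + q / (s + q)) *\<^sub>R y + ((s / (s + q)) * q - (q / (s + q)) * s) *\<^sub>R v"
        by (simp only: scaleR_add_left scaleR_diff_left scaleR_add_right scaleR_diff_right scaleR_scaleR) simp
      also have "\<dots> = y" using \<open>s + q > 0\<close> by (simp add: add_divide_distrib[symmetric])
      finally show False using y by simp
    qed
  qed
  then have "x \<in> (K + closed_segment 0 ((t + h) *\<^sub>R v)) - (K + closed_segment 0 (t *\<^sub>R v))
     \<longleftrightarrow> x - t *\<^sub>R v \<in> (K + closed_segment 0 (h *\<^sub>R v)) - K" for x
    by (metis diff_add_cancel)
  moreover have "x \<in> (+) w ` X \<longleftrightarrow> x - w \<in> X" for x w :: 'a and X
    by (auto intro: image_eqI[of _ _ "x - w"])
  ultimately show ?thesis by (intro set_eqI) (simp only:)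
qed

lemma lmeasurable_set_plus:
  "compact A \<Longrightarrow> compact B \<Longrightarrow> A + B \<in> lmeasurable"
  by (intro lmeasurable_compact compact_set_plus)

text \<open>By the previous lemma the gain in volume is an additive function of \<open>t\<close>, and it is monotone.\<close>

lemma vol_add_segment:
  fixes K :: "'a::euclidean_space set"
  assumes K: "convex K" "compact K" and t: "0 \<le> t"
  shows "vol (K + closed_segment 0 (t *\<^sub>R v)) = vol K + t * (vol (K + closed_segment 0 v) - vol K)"
proof -
  let ?S = "\<lambda>t. K + closed_segment 0 (t *\<^sub>R v)"
  have S0: "?S 0 = K" by (simp add: set_plus_def)
  have m: "?S t \<in> lmeasurable" for t using K by (intro lmeasurable_set_plus) auto
  have Km: "K \<in> lmeasurable" using K by (simp add: lmeasurable_compact)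
  have sub: "?S s \<subseteq> ?S t" if "0 \<le> s" "s \<le> t" for s t
    using that by (intro set_plus_mono2) (auto simp: closed_segment_0_eq)
  have diff: "vol (?S t - ?S s) = vol (?S t) - vol (?S s)" if "0 \<le> s" "s \<le> t" for s t
    using sub[OF that] m by (simp add: measurable_measure_Diff fmeasurableD)
  define g where "g t = vol (?S t) - vol K" for t
  have "g t = t * g 1"
  proof (rule additive_mono_imp_linear[OF _ _ t])
    fix s t :: real assume st: "0 \<le> s" "0 \<le> t"
    have "vol (?S (s + t)) - vol (?S s) = vol (?S t) - vol (?S 0)"
      using diff[of s "s + t"] diff[of 0 t] segment_growth_translate[OF K(1) st, of v] st
      by (simp add: measure_translation S0)
    then show "g (s + t) = g s + g t" by (simp add: g_def S0)
  next
    fix s t :: real assume "0 \<le> s" "s \<le> t"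
    then have "vol (?S s) \<le> vol (?S t)"
      using sub m by (intro measure_mono_fmeasurable) (auto intro: fmeasurableD)
    then show "g s \<le> g t" by (simp add: g_def)
  qed
  then show ?thesis by (simp add: g_def)
qed

lemma compact_set_sum:
  fixes S :: "'i \<Rightarrow> 'a::euclidean_space set"
  assumes "\<And>i. i \<in> I \<Longrightarrow> compact (S i)"
  shows "compact (\<Sum>i\<in>I. S i)"
  using assms by (induction I rule: infinite_finite_induct) (auto intro: compact_set_plus simp: set_zero)

text \<open>The other segments together with \<open>K\<close> form a convex body, so the volume is affine in each \<open>t j\<close>
  separately; an induction on \<open>J\<close> collects the coefficients.\<close>

lemma vol_add_zonotope_multiaffine:
  fixes v :: "'i \<Rightarrow> 'a::euclidean_space"
  assumes "finite J" "convex K" "compact K"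
  shows "\<exists>c. \<forall>t. (\<forall>j\<in>J. 0 \<le> t j) \<longrightarrow>
    vol (K + (\<Sum>j\<in>J. closed_segment 0 (t j *\<^sub>R v j))) = (\<Sum>S\<in>Pow J. c S * (\<Prod>j\<in>S. t j))"
  using assms
proof (induction J arbitrary: K rule: finite_induct)
  case empty
  then show ?case by (intro exI[of _ "\<lambda>_. vol K"]) simp
next
  case (insert i J)
  let ?Z = "\<lambda>t. \<Sum>j\<in>J. closed_segment 0 (t j *\<^sub>R v j)"
  obtain c1 where c1: "\<And>t. (\<forall>j\<in>J. 0 \<le> t j) \<Longrightarrow> vol (K + ?Z t) = (\<Sum>S\<in>Pow J. c1 S * (\<Prod>j\<in>S. t j))"
    using insert.IH[OF insert.prems] by blast
  have "convex (K + closed_segment 0 (v i))" "compact (K + closed_segment 0 (v i))"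
    using insert.prems by (auto intro: convex_set_plus compact_set_plus)
  from insert.IH[OF this] obtain c2 where c2: "\<And>t. (\<forall>j\<in>J. 0 \<le> t j) \<Longrightarrow>
      vol (K + closed_segment 0 (v i) + ?Z t) = (\<Sum>S\<in>Pow J. c2 S * (\<Prod>j\<in>S. t j))"
    by blast
  define c where "c S = (if i \<in> S then c2 (S - {i}) - c1 (S - {i}) else c1 S)" for S
  show ?case
  proof (intro exI[of _ c] allI impI)
    fix t :: "'i \<Rightarrow> real" assume t: "\<forall>j\<in>insert i J. 0 \<le> t j"
    have KZ: "convex (K + ?Z t)" "compact (K + ?Z t)"
      using insert.prems by (auto intro!: convex_set_plus convex_set_sum compact_set_plus compact_set_sum)
    have inj: "inj_on (insert i) (Pow J)" using insert.hyps by (auto simp: inj_on_def)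
    have iS: "i \<notin> S" "finite S" if "S \<in> Pow J" for S using that insert.hyps finite_subset by auto
    have "K + (\<Sum>j\<in>insert i J. closed_segment 0 (t j *\<^sub>R v j)) = (K + ?Z t) + closed_segment 0 (t i *\<^sub>R v i)"
      using insert.hyps by (simp add: ac_simps)
    then have "vol (K + (\<Sum>j\<in>insert i J. closed_segment 0 (t j *\<^sub>R v j)))
        = vol (K + ?Z t) + t i * (vol (K + ?Z t + closed_segment 0 (v i)) - vol (K + ?Z t))"
      using vol_add_segment[OF KZ, of "t i" "v i"] t by simp
    also have "K + ?Z t + closed_segment 0 (v i) = K + closed_segment 0 (v i) + ?Z t"
      by (simp add: ac_simps)
    also have "vol (K + ?Z t) + t i * (vol (K + closed_segment 0 (v i) + ?Z t) - vol (K + ?Z t))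
        = (\<Sum>S\<in>Pow J. c1 S * (\<Prod>j\<in>S. t j)) + (\<Sum>S\<in>Pow J. t i * ((c2 S - c1 S) * (\<Prod>j\<in>S. t j)))"
      using t by (simp add: c1 c2 sum_distrib_left sum_subtractf[symmetric] left_diff_distrib)
    also have "(\<Sum>S\<in>Pow J. c1 S * (\<Prod>j\<in>S. t j)) = (\<Sum>S\<in>Pow J. c S * (\<Prod>j\<in>S. t j))"
      using iS by (intro sum.cong) (auto simp: c_def)
    also have "(\<Sum>S\<in>Pow J. t i * ((c2 S - c1 S) * (\<Prod>j\<in>S. t j))) = (\<Sum>S\<in>Pow J. c (insert i S) * (\<Prod>j\<in>insert i S. t j))"
      using iS by (intro sum.cong) (auto simp: c_def)
    also have "\<dots> = (\<Sum>S\<in>insert i ` Pow J. c S * (\<Prod>j\<in>S. t j))"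
      using inj by (simp add: sum.reindex)
    finally show "vol (K + (\<Sum>j\<in>insert i J. closed_segment 0 (t j *\<^sub>R v j)))
        = (\<Sum>S\<in>Pow (insert i J). c S * (\<Prod>j\<in>S. t j))"
      unfolding Pow_insert using insert.hyps
      by (subst sum.union_disjoint) (auto simp: insert_eq_iff)
  qed
qed

lemma power_ratio_tendsto:
  assumes "k \<le> n"
  shows "((\<lambda>t::real. t ^ k / t ^ n) \<longlongrightarrow> (if k = n then 1 else 0)) at_top"
proof (cases "k = n")
  case True
  have "eventually (\<lambda>t::real. t ^ k / t ^ n = 1) at_top"
    using eventually_gt_at_top[of 0] by eventually_elim (simp add: True)
  then show ?thesis using True by (simp add: tendsto_eventually)
next
  case False
  with assms have "0 < n - k" by simp
  then have "((\<lambda>t::real. 1 / t ^ (n - k)) \<longlongrightarrow> 0) at_top"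
    by (intro tendsto_divide_0[OF tendsto_const] filterlim_at_top_imp_at_infinity filterlim_pow_at_top filterlim_ident)
  moreover have "eventually (\<lambda>t::real. 1 / t ^ (n - k) = t ^ k / t ^ n) at_top"
    using eventually_gt_at_top[of 0]
  proof eventually_elim
    case (elim t)
    have "t ^ n = t ^ k * t ^ (n - k)" using assms by (simp flip: power_add)
    then show ?case using elim by simp
  qed
  ultimately show ?thesis using False by (simp add: Lim_transform_eventually)
qed

text \<open>The coefficient of \<open>\<Prod>j\<in>S. t j\<close> is the limit of the volume divided by \<open>t ^ card S\<close> when
  \<open>t j = t\<close> for \<open>j \<in> S\<close> and \<open>t j = 0\<close> otherwise; hence it is nonnegative, and it vanishes when
  \<open>card S\<close> exceeds the dimension.\<close>

lemma vol_add_zonotope_poly: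
  fixes v :: "'i \<Rightarrow> 'a::euclidean_space"
  assumes J: "finite J" and K: "convex K" "compact K"
  shows "\<exists>a. (\<forall>k. 0 \<le> a k) \<and> (\<forall>t\<ge>0. vol (K + (\<Sum>j\<in>J. closed_segment 0 (t *\<^sub>R v j))) = (\<Sum>k\<le>DIM('a). a k * t ^ k))"
proof -
  obtain c where c: "\<And>t. (\<forall>j\<in>J. 0 \<le> t j) \<Longrightarrow>
    vol (K + (\<Sum>j\<in>J. closed_segment 0 (t j *\<^sub>R v j))) = (\<Sum>S\<in>Pow J. c S * (\<Prod>j\<in>S. t j))"
    using vol_add_zonotope_multiaffine[OF J K] by blast
  obtain r where r: "r > 0" "K \<subseteq> cball 0 r"
    using compact_imp_bounded[OF K(2)] unfolding bounded_pos by (auto simp: subset_iff)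
  define M where "M = (\<Sum>j\<in>J. norm (v j))"
  have M: "M \<ge> 0" by (simp add: M_def sum_nonneg)
  have bound: "vol (K + (\<Sum>j\<in>J. closed_segment 0 (t j *\<^sub>R v j))) \<le> vol (cball (0::'a) (r + M)) * (1 + s) ^ DIM('a)"
    if t: "\<And>j. j \<in> J \<Longrightarrow> 0 \<le> t j \<and> t j \<le> s" and s: "s \<ge> 0" for t s
  proof -
    have "K + (\<Sum>j\<in>J. closed_segment 0 (t j *\<^sub>R v j)) \<subseteq> (\<lambda>x. (1 + s) *\<^sub>R x + 0) ` cball 0 (r + M)"
    proof
      fix x assume "x \<in> K + (\<Sum>j\<in>J. closed_segment 0 (t j *\<^sub>R v j))"
      then obtain k z where x: "x = k + (\<Sum>j\<in>J. z j)" "k \<in> K" "\<And>j. j \<in> J \<Longrightarrow> z j \<in> closed_segment 0 (t j *\<^sub>R v j)"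
        by (auto simp: set_plus_def set_sum_alt[OF J])
      have "norm (z j) \<le> s * norm (v j)" if j: "j \<in> J" for j
      proof -
        obtain u where "0 \<le> u" "u \<le> t j" "z j = u *\<^sub>R v j"
          using x(3)[OF j] t[OF j] by (auto simp: closed_segment_0_eq)
        with t[OF j] show ?thesis by (simp add: mult_right_mono)
      qed
      then have "norm (\<Sum>j\<in>J. z j) \<le> s * M" unfolding M_def sum_distrib_left by (rule sum_norm_le)
      moreover have "norm k \<le> r" using x(2) r(2) by auto
      ultimately have "norm x \<le> r + s * M" unfolding x(1) by (intro norm_triangle_le) linarith
      also have "\<dots> \<le> (1 + s) * (r + M)" using r s M by (simp add: algebra_simps)
      finally show "x \<in> (\<lambda>x. (1 + s) *\<^sub>R x + 0) ` cball 0 (r + M)"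
        using s by (intro image_eqI[of _ _ "(1 / (1 + s)) *\<^sub>R x"]) (auto simp: field_simps)
    qed
    then have "vol (K + (\<Sum>j\<in>J. closed_segment 0 (t j *\<^sub>R v j))) \<le> vol ((\<lambda>x. (1 + s) *\<^sub>R x + 0) ` cball (0::'a) (r + M))"
      using K by (intro measure_mono_fmeasurable)
        (auto intro!: fmeasurableD lmeasurable_compact compact_set_plus compact_set_sum compact_continuous_image continuous_intros)
    also have "\<dots> = vol (cball (0::'a) (r + M)) * (1 + s) ^ DIM('a)"
      using s by (subst measure_lebesgue_affine) (simp add: abs_of_nonneg)
    finally show ?thesis .
  qed
  have cS: "c S \<ge> 0 \<and> (card S > DIM('a) \<longrightarrow> c S = 0)" if S: "S \<subseteq> J" for S
  proof -
    have fS: "finite S" using S J finite_subset by blast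
    define f where "f t = (\<Sum>T\<in>Pow S. c T * t ^ card T) / t ^ card S" for t :: real
    have lim: "(f \<longlongrightarrow> (\<Sum>T\<in>Pow S. if T = S then c S else 0)) at_top"
      unfolding f_def sum_divide_distrib
    proof (rule tendsto_sum)
      fix T assume T: "T \<in> Pow S"
      have card: "card T \<le> card S" "card T = card S \<longleftrightarrow> T = S"
        using T fS card_subset_eq[of S T] by (auto intro: card_mono)
      have "((\<lambda>t. c T * t ^ card T / t ^ card S) \<longlongrightarrow> c T * (if card T = card S then 1 else 0)) at_top"
        using tendsto_mult_left[OF power_ratio_tendsto[OF card(1)], of "c T"] by (simp only: times_divide_eq_right)
      also have "c T * (if card T = card S then 1 else 0) = (if T = S then c S else 0)" using card(2) by simp
      finally show "((\<lambda>t. c T * t ^ card T / t ^ card S) \<longlongrightarrow> (if T = S then c S else 0)) at_top" .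
    qed
    also have "(\<Sum>T\<in>Pow S. if T = S then c S else 0) = c S" using fS by simp
    finally have lim: "(f \<longlongrightarrow> c S) at_top" .
    have f: "f t = vol (K + (\<Sum>j\<in>J. closed_segment 0 ((if j \<in> S then t else 0) *\<^sub>R v j))) / t ^ card S" if "t \<ge> 0" for t
    proof -
      have "(\<Sum>T\<in>Pow J. c T * (\<Prod>j\<in>T. if j \<in> S then t else 0)) = (\<Sum>T\<in>Pow S. c T * t ^ card T)"
      proof (rule sum.mono_neutral_cong_right)
        show "finite (Pow J)" "Pow S \<subseteq> Pow J" using J S by auto
        show "\<forall>T\<in>Pow J - Pow S. c T * (\<Prod>j\<in>T. if j \<in> S then t else 0) = 0"
          using J by (auto intro!: prod_zero finite_subset[of _ J])
        fix T assume "T \<in> Pow S"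
        then have "(\<Prod>j\<in>T. if j \<in> S then t else 0) = (\<Prod>j\<in>T. t)" by (intro prod.cong) auto
        then show "c T * (\<Prod>j\<in>T. if j \<in> S then t else 0) = c T * t ^ card T" by simp
      qed
      with c[of "\<lambda>j. if j \<in> S then t else 0"] that show ?thesis by (simp add: f_def)
    qed
    have "c S \<ge> 0"
      by (rule tendsto_lowerbound[OF lim])
        (use eventually_ge_at_top[of 0] in \<open>eventually_elim, simp add: f\<close>, simp)
    moreover have "c S \<le> 0" if d: "card S > DIM('a)"
    proof (rule tendsto_le[OF _ _ lim])
      let ?C = "vol (cball (0::'a) (r + M)) * 2 ^ DIM('a)"
      show "((\<lambda>t. ?C / t) \<longlongrightarrow> 0) at_top"
        by (intro tendsto_divide_0[OF tendsto_const] filterlim_at_top_imp_at_infinity filterlim_ident)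
      show "eventually (\<lambda>t. f t \<le> ?C / t) at_top"
        using eventually_ge_at_top[of 1]
      proof eventually_elim
        case (elim t)
        have "f t \<le> vol (cball (0::'a) (r + M)) * (1 + t) ^ DIM('a) / t ^ card S"
          using elim bound[of "\<lambda>j. if j \<in> S then t else 0" t] by (simp add: f divide_right_mono)
        also have "\<dots> \<le> vol (cball (0::'a) (r + M)) * (2 * t) ^ DIM('a) / t ^ card S"
          using elim by (intro divide_right_mono mult_left_mono power_mono) auto
        also have "\<dots> \<le> vol (cball (0::'a) (r + M)) * (2 * t) ^ DIM('a) / t ^ Suc DIM('a)"
          using elim d by (intro divide_left_mono power_increasing mult_nonneg_nonneg) auto
        also have "\<dots> = ?C / t" using elim by (simp add: power_mult_distrib)
        finally show ?case .
      qed
    qed simp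
    ultimately show ?thesis by force
  qed
  define a where "a k = (\<Sum>S\<in>{S\<in>Pow J. card S = k}. c S)" for k
  show ?thesis
  proof (intro exI[of _ a] conjI allI impI)
    show "0 \<le> a k" for k unfolding a_def using cS by (intro sum_nonneg) auto
    fix t :: real assume t: "0 \<le> t"
    have "(\<Sum>k\<le>DIM('a). a k * t ^ k) = (\<Sum>k\<le>DIM('a). \<Sum>S\<in>{S\<in>{S\<in>Pow J. card S \<le> DIM('a)}. card S = k}. c S * t ^ card S)"
      unfolding a_def sum_distrib_right by (intro sum.cong refl) auto
    also have "\<dots> = (\<Sum>S\<in>{S\<in>Pow J. card S \<le> DIM('a)}. c S * t ^ card S)"
      using J by (intro sum.group) auto
    also have "\<dots> = (\<Sum>S\<in>Pow J. c S * t ^ card S)"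
      using J cS by (intro sum.mono_neutral_left) (auto simp: not_le)
    finally show "vol (K + (\<Sum>j\<in>J. closed_segment 0 (t *\<^sub>R v j))) = (\<Sum>k\<le>DIM('a). a k * t ^ k)"
      using c[of "\<lambda>_. t"] t by simp
  qed
qed

lemma set_sum_singleton: "(\<Sum>j\<in>J. {w j}) = {\<Sum>j\<in>J. w j :: 'a::comm_monoid_add}"
  by (induction J rule: infinite_finite_induct) (auto simp: set_plus_def set_zero)

corollary vol_add_symmetric_zonotope_poly:
  fixes v :: "'i \<Rightarrow> 'a::euclidean_space"
  assumes J: "finite J" and K: "convex K" "compact K"
  shows "\<exists>a. (\<forall>k. 0 \<le> a k) \<and> (\<forall>t\<ge>0. vol (K + (\<Sum>j\<in>J. closed_segment (- t *\<^sub>R v j) (t *\<^sub>R v j))) = (\<Sum>k\<le>DIM('a). a k * t ^ k))"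
proof -
  obtain a where a: "\<And>k. 0 \<le> a k" "\<And>t. t \<ge> 0 \<Longrightarrow> vol (K + (\<Sum>j\<in>J. closed_segment 0 (t *\<^sub>R (2 *\<^sub>R v j)))) = (\<Sum>k\<le>DIM('a). a k * t ^ k)"
    using vol_add_zonotope_poly[OF J K, of "\<lambda>j. 2 *\<^sub>R v j"] by blast
  have "vol (K + (\<Sum>j\<in>J. closed_segment (- t *\<^sub>R v j) (t *\<^sub>R v j))) = vol (K + (\<Sum>j\<in>J. closed_segment 0 (t *\<^sub>R (2 *\<^sub>R v j))))" for t
  proof -
    have "closed_segment (- t *\<^sub>R v j) (t *\<^sub>R v j) = {- t *\<^sub>R v j} + closed_segment 0 (t *\<^sub>R (2 *\<^sub>R v j))" for j
    proof -
      have "closed_segment (- t *\<^sub>R v j + 0) (- t *\<^sub>R v j + t *\<^sub>R (2 *\<^sub>R v j)) = (\<lambda>x. - t *\<^sub>R v j + x) ` closed_segment 0 (t *\<^sub>R (2 *\<^sub>R v j))"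
        by (rule closed_segment_translation)
      moreover have "- t *\<^sub>R v j + t *\<^sub>R (2 *\<^sub>R v j) = t *\<^sub>R v j"
        by (simp flip: scaleR_diff_left)
      ultimately show ?thesis by (auto simp: set_plus_def)
    qed
    then have "K + (\<Sum>j\<in>J. closed_segment (- t *\<^sub>R v j) (t *\<^sub>R v j))
        = {\<Sum>j\<in>J. - t *\<^sub>R v j} + (K + (\<Sum>j\<in>J. closed_segment 0 (t *\<^sub>R (2 *\<^sub>R v j))))"
      by (simp only: sum.distrib set_sum_singleton ac_simps)
    also have "\<dots> = (+) (\<Sum>j\<in>J. - t *\<^sub>R v j) ` (K + (\<Sum>j\<in>J. closed_segment 0 (t *\<^sub>R (2 *\<^sub>R v j))))"
      by (auto simp: set_plus_def)
    finally show ?thesis by (simp only: measure_translation)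
  qed
  with a show ?thesis by auto
qed

section \<open>Approximation of the ball by zonotopes\<close>

lemma nn_integral_lborel_add:
  fixes f :: "'a::euclidean_space \<Rightarrow> ennreal"
  assumes [measurable]: "f \<in> borel_measurable borel"
  shows "(\<integral>\<^sup>+x. f (c + x) \<partial>lborel) = (\<integral>\<^sup>+x. f x \<partial>lborel)"
proof -
  have "(\<integral>\<^sup>+x. f x \<partial>distr lborel borel ((+) c)) = (\<integral>\<^sup>+x. f (c + x) \<partial>lborel)"
    by (rule nn_integral_distr) auto
  then show ?thesis by (simp add: lborel_distr_plus)
qed

lemma nn_integral_lborel_minus:
  fixes f :: "'a::euclidean_space \<Rightarrow> ennreal"
  assumes [measurable]: "f \<in> borel_measurable borel"
  shows "(\<integral>\<^sup>+x. f (c - x) \<partial>lborel) = (\<integral>\<^sup>+x. f x \<partial>lborel)"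
proof -
  have "lborel = distr lborel borel (\<lambda>x::'a. c + (-1) *\<^sub>R x)"
    using lborel_affine[of "-1" c] by (simp add: density_1)
  then have "(\<integral>\<^sup>+x. f x \<partial>lborel) = (\<integral>\<^sup>+x. f x \<partial>distr lborel borel (\<lambda>x. c + (-1) *\<^sub>R x))" by simp
  also have "\<dots> = (\<integral>\<^sup>+x. f (c - x) \<partial>lborel)"
    by (subst nn_integral_distr) auto
  finally show ?thesis by simp
qed

text \<open>As in the proof of uniqueness of Haar measure, evaluating the double integral of \<open>1\<^sub>A (f x) 1\<^sub>B (y + f x)\<close> in both
  orders yields \<open>|f A| |B| = |f B| |A|\<close>; then take for \<open>B\<close> the unit ball, which \<open>f\<close> preserves.\<close>

lemma distr_lborel_isometric_involution:
  fixes f :: "'a::euclidean_space \<Rightarrow> 'a"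
  assumes f: "linear f" "\<And>x. f (f x) = x" "\<And>x. norm (f x) = norm x"
  shows "distr lborel borel f = lborel"
proof (rule measure_eqI)
  have [measurable]: "f \<in> borel_measurable borel"
    using linear_continuous_on[OF linear_conv_bounded_linear[THEN iffD1, OF f(1)]]
    by (rule borel_measurable_continuous_onI)
  fix A assume "A \<in> sets (distr lborel borel f)"
  then have [measurable]: "A \<in> sets borel" by simp
  define B where "B = ball (0::'a) 1"
  have [measurable]: "B \<in> sets borel" by (simp add: B_def)
  let ?I = "\<lambda>A x. indicator A x :: ennreal"
  have "(\<integral>\<^sup>+x. ?I A (f x) \<partial>lborel) * (\<integral>\<^sup>+y. ?I B y \<partial>lborel) = (\<integral>\<^sup>+x. \<integral>\<^sup>+y. ?I A (f x) * ?I B y \<partial>lborel \<partial>lborel)"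
    by (simp add: nn_integral_cmult nn_integral_multc)
  also have "\<dots> = (\<integral>\<^sup>+x. \<integral>\<^sup>+y. ?I A (f x) * ?I B (f x + y) \<partial>lborel \<partial>lborel)"
    by (subst nn_integral_lborel_add[of "\<lambda>y. _ * ?I B y"]) auto
  also have "\<dots> = (\<integral>\<^sup>+y. \<integral>\<^sup>+x. ?I A (f x) * ?I B (f x + y) \<partial>lborel \<partial>lborel)"
    by (rule lborel_pair.Fubini'[symmetric]) simp
  also have "\<dots> = (\<integral>\<^sup>+y. \<integral>\<^sup>+x. ?I A (f x - y) * ?I B (f x) \<partial>lborel \<partial>lborel)"
  proof (rule nn_integral_cong)
    fix y
    have "(\<integral>\<^sup>+x. ?I A (f x) * ?I B (f x + y) \<partial>lborel) = (\<integral>\<^sup>+x. ?I A (f (- f y + x)) * ?I B (f (- f y + x) + y) \<partial>lborel)"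
      by (rule nn_integral_lborel_add[symmetric]) simp
    also have "\<dots> = (\<integral>\<^sup>+x. ?I A (f x - y) * ?I B (f x) \<partial>lborel)"
      by (simp add: linear_add[OF f(1)] linear_neg[OF f(1)] linear_diff[OF f(1)] f(2))
    finally show "(\<integral>\<^sup>+x. ?I A (f x) * ?I B (f x + y) \<partial>lborel) = (\<integral>\<^sup>+x. ?I A (f x - y) * ?I B (f x) \<partial>lborel)" .
  qed
  also have "\<dots> = (\<integral>\<^sup>+x. \<integral>\<^sup>+y. ?I A (f x - y) * ?I B (f x) \<partial>lborel \<partial>lborel)"
    by (rule lborel_pair.Fubini') simp
  also have "\<dots> = (\<integral>\<^sup>+x. \<integral>\<^sup>+y. ?I A y * ?I B (f x) \<partial>lborel \<partial>lborel)"
    by (subst nn_integral_lborel_minus[of "\<lambda>y. ?I A y * _"]) auto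
  also have "\<dots> = (\<integral>\<^sup>+y. ?I A y \<partial>lborel) * (\<integral>\<^sup>+x. ?I B (f x) \<partial>lborel)"
    by (simp add: nn_integral_cmult nn_integral_multc)
  also have "(\<integral>\<^sup>+x. ?I B (f x) \<partial>lborel) = (\<integral>\<^sup>+x. ?I B x \<partial>lborel)"
    by (simp add: B_def indicator_def f(3))
  finally have "emeasure lborel (f -` A) * emeasure lborel B = emeasure lborel A * emeasure lborel B"
    using measurable_sets_borel[OF \<open>f \<in> borel_measurable borel\<close> \<open>A \<in> sets borel\<close>]
    by (simp add: indicator_vimage[symmetric] comp_def)
  moreover have "emeasure lborel B \<noteq> \<infinity>" "emeasure lborel B \<noteq> 0"
    using emeasure_bounded_finite[of B] content_ball_pos[of 1 "0::'a"]
    by (auto simp: B_def measure_def)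
  ultimately have "emeasure lborel (f -` A) = emeasure lborel A"
    by (metis ennreal_mult_cancel_left infinity_ennreal_def mult.commute)
  then show "emeasure (distr lborel borel f) A = emeasure lborel A"
    by (simp add: emeasure_distr)
qed simp

definition mean_abs_inner :: "'a::euclidean_space \<Rightarrow> real" where
  "mean_abs_inner x = (LINT y|lborel. indicator (cball 0 1) y * \<bar>y \<bullet> x\<bar>)"

lemma integrable_indicator_abs_inner:
  fixes x :: "'a::euclidean_space"
  assumes [measurable]: "P \<in> sets borel" and P: "P \<subseteq> cball 0 1"
  shows "integrable lborel (\<lambda>y. indicator P y * \<bar>y \<bullet> x\<bar>)"
proof (rule Bochner_Integration.integrable_bound[where f = "\<lambda>y. indicator (cball 0 1) y * norm x"])
  show "integrable lborel (\<lambda>y::'a. indicator (cball 0 1) y * norm x)"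
    using emeasure_bounded_finite[of "cball (0::'a) 1"] by simp
  show "AE y in lborel. norm (indicator P y * \<bar>y \<bullet> x\<bar>) \<le> norm (indicator (cball 0 1) y * norm x)"
  proof (rule AE_I2)
    fix y
    show "norm (indicator P y * \<bar>y \<bullet> x\<bar>) \<le> norm (indicator (cball 0 1) y * norm x)"
      using P Cauchy_Schwarz_ineq2[of y x] mult_right_mono[of "norm y" 1 "norm x"]
      by (auto simp: indicator_def)
  qed
qed simp

lemma mean_abs_inner_rotation_invariant:
  fixes x y :: "'a::euclidean_space"
  assumes "norm x = norm y"
  shows "mean_abs_inner x = mean_abs_inner y"
proof (cases "x = y")
  case False
  \<comment> \<open>the Householder reflection exchanging \<open>x\<close> and \<open>y\<close>\<close>
  define n where "n = x - y"
  define f where "f z = z - (2 * (z \<bullet> n) / (n \<bullet> n)) *\<^sub>R n" for z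
  have nn: "n \<bullet> n \<noteq> 0" using False by (simp add: n_def)
  have lin: "linear f"
    by (rule linearI) (simp_all add: f_def inner_add_left add_divide_distrib algebra_simps)
  have inv: "f (f z) = z" for z
    using nn by (simp add: f_def inner_diff_left)
  have iso: "f z \<bullet> f w = z \<bullet> w" for z w
    using nn by (simp add: f_def inner_diff_left inner_diff_right inner_commute field_simps power2_eq_square)
  have norm: "norm (f z) = norm z" for z by (simp add: norm_eq_sqrt_inner iso)
  have "n \<bullet> n = 2 * (x \<bullet> n)"
    using assms by (simp add: n_def norm_eq_sqrt_inner algebra_simps inner_diff_left inner_diff_right inner_commute)
  then have "f x = y" using nn by (simp add: f_def n_def)
  then have xy: "f z \<bullet> y = z \<bullet> x" for z using iso[of z x] by simp
  have [measurable]: "f \<in> borel_measurable borel"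
    using linear_continuous_on[OF linear_conv_bounded_linear[THEN iffD1, OF lin]]
    by (rule borel_measurable_continuous_onI)
  have "mean_abs_inner y = (LINT z|distr lborel borel f. indicator (cball 0 1) z * \<bar>z \<bullet> y\<bar>)"
    unfolding mean_abs_inner_def using distr_lborel_isometric_involution[OF lin inv norm] by simp
  also have "\<dots> = mean_abs_inner x"
    unfolding mean_abs_inner_def
    by (subst integral_distr) (auto simp: xy norm indicator_def intro!: Bochner_Integration.integral_cong)
  finally show ?thesis by simp
qed simp

text \<open>On a small ball around a point in the direction of \<open>x\<close> the integrand exceeds \<open>norm x / 4\<close>.\<close>

lemma mean_abs_inner_pos:
  fixes x :: "'a::euclidean_space"
  assumes "x \<noteq> 0"
  shows "mean_abs_inner x > 0"
proof -
  let ?b = "(1 / (2 * norm x)) *\<^sub>R x"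
  have "0 < (LINT y|lborel. indicator (ball ?b (1/4)) y * (norm x / 4))"
    using assms content_ball_pos[of "1/4" ?b] emeasure_bounded_finite[of "ball ?b (1/4)"] by simp
  also have "\<dots> \<le> mean_abs_inner x"
    unfolding mean_abs_inner_def
  proof (rule integral_mono)
    show "integrable lborel (\<lambda>y. indicator (ball ?b (1/4)) y * (norm x / 4))"
      using emeasure_bounded_finite[of "ball ?b (1/4)"] by simp
    show "integrable lborel (\<lambda>y. indicator (cball 0 1) y * \<bar>y \<bullet> x\<bar>)"
      by (rule integrable_indicator_abs_inner) auto
    fix y
    show "indicator (ball ?b (1/4)) y * (norm x / 4) \<le> indicator (cball 0 1) y * \<bar>y \<bullet> x\<bar>"
    proof (cases "y \<in> ball ?b (1/4)")
      case True
      then have d: "norm (y - ?b) < 1/4" by (simp add: dist_norm norm_minus_commute)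
      have "norm ?b = 1/2" using assms by simp
      then have "norm y \<le> 1" using d norm_triangle_ineq2[of y ?b] by linarith
      moreover have "norm x / 4 \<le> y \<bullet> x"
      proof -
        have "?b \<bullet> x = norm x / 2"
          using assms by (simp add: dot_square_norm power2_eq_square)
        moreover have "\<bar>(y - ?b) \<bullet> x\<bar> \<le> 1/4 * norm x"
          using Cauchy_Schwarz_ineq2[of "y - ?b" x] d mult_right_mono[of "norm (y - ?b)" "1/4" "norm x"] by simp
        moreover have "y \<bullet> x = ?b \<bullet> x + (y - ?b) \<bullet> x" by (simp only: inner_diff_left)
        ultimately show ?thesis by linarith
      qed
      ultimately show ?thesis using True abs_ge_self[of "y \<bullet> x"] by (simp add: indicator_def)
    qed simp
  qed
  finally show ?thesis .
qed

text \<open>The norm is, up to a constant factor, the average of \<open>|y \<bullet> x|\<close> over the unit ball; a Riemann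
  sum for this average is the support function of a zonotope.\<close>

lemma norm_approx_zonotope_support:
  fixes e :: real
  assumes "e > 0"
  shows "\<exists>J v. finite (J :: nat set) \<and> (\<forall>x::'a::euclidean_space. (1 - e) * norm x \<le> (\<Sum>j\<in>J. \<bar>v j \<bullet> x\<bar>) \<and> (\<Sum>j\<in>J. \<bar>v j \<bullet> x\<bar>) \<le> (1 + e) * norm x)"
proof -
  obtain b :: 'a where b: "b \<in> Basis" by (rule ex_in_conv[THEN iffD2, OF nonempty_Basis, THEN exE])
  define k where "k = mean_abs_inner b"
  have k: "k > 0" unfolding k_def using b by (intro mean_abs_inner_pos) auto
  have kx: "mean_abs_inner x = k * norm x" for x :: 'a
  proof -
    have "mean_abs_inner x = mean_abs_inner (norm x *\<^sub>R b)"
      using b by (intro mean_abs_inner_rotation_invariant) simp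
    also have "\<dots> = norm x * mean_abs_inner b"
      by (simp add: mean_abs_inner_def abs_mult ac_simps)
    finally show ?thesis by (simp add: k_def)
  qed
  let ?B = "cball (0::'a) 1"
  define w where "w = measure lborel ?B"
  have w: "w > 0" using content_cball_pos[of 1 "0::'a"] by (simp add: w_def)
  define r where "r = e * k / w"
  have r: "r > 0" using assms k w by (simp add: r_def)
  obtain C where C: "finite C" "?B \<subseteq> (\<Union>c\<in>C. ball c r)"
    using compact_cball[of "0::'a" 1] r unfolding compact_eq_totally_bounded by metis
  have "C \<noteq> {}" using C(2) by auto
  define c where "c = from_nat_into C"
  obtain N where N: "C = c ` {..<N}"
    using C(1) \<open>C \<noteq> {}\<close> unfolding c_def
    by (metis bij_betw_from_nat_into_finite bij_betw_imp_surj_on)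
  define P where "P i = disjointed (\<lambda>i. ?B \<inter> ball (c i) r) i" for i
  have Pm [measurable]: "P i \<in> sets borel" for i
    unfolding P_def disjointed_def by measurable
  have PB: "P i \<subseteq> ?B" "P i \<subseteq> ball (c i) r" for i
    unfolding P_def disjointed_def by auto
  have Psum: "(\<Sum>i<N. indicator (P i) y) = (indicator ?B y :: real)" for y
  proof -
    have "(\<Union>i<N. P i) = ?B"
    proof -
      have "(\<Union>i<N. P i) = (\<Union>i<N. ?B \<inter> ball (c i) r)"
        unfolding P_def lessThan_atLeast0 by (rule finite_UN_disjointed_eq)
      also have "\<dots> = ?B" using C(2) N by auto
      finally show ?thesis .
    qed
    moreover have "disjoint_family_on P {..<N}"
      unfolding P_def by (rule disjoint_family_on_mono[OF subset_UNIV disjoint_family_disjointed])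
    ultimately have "(indicator (\<Union>i<N. P i) y :: real) = (\<Sum>i<N. indicator (P i) y)"
      by (intro indicator_UN_disjoint) auto
    with \<open>(\<Union>i<N. P i) = ?B\<close> show ?thesis by simp
  qed
  define v where "v i = (measure lborel (P i) / k) *\<^sub>R c i" for i
  have main: "\<bar>(\<Sum>i<N. \<bar>v i \<bullet> x\<bar>) - norm x\<bar> \<le> e * norm x" for x
  proof -
    have fin: "emeasure lborel (P i) < \<infinity>" for i
      using PB(1) by (intro emeasure_bounded_finite bounded_subset[OF bounded_cball])
    have int: "integrable lborel (\<lambda>y. indicator (P i) y * \<bar>y \<bullet> x\<bar>)" for i
      using PB(1) by (intro integrable_indicator_abs_inner) auto
    have int1: "integrable lborel (\<lambda>y. indicator (P i) y :: real)" for i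
      using fin by simp
    have meas: "(LINT y|lborel. indicator (P i) y :: real) = measure lborel (P i)" for i
      using fin by simp
    have "k * norm x = (LINT y|lborel. (\<Sum>i<N. indicator (P i) y) * \<bar>y \<bullet> x\<bar>)"
      using kx[of x] by (simp add: mean_abs_inner_def Psum)
    also have "\<dots> = (\<Sum>i<N. LINT y|lborel. indicator (P i) y * \<bar>y \<bullet> x\<bar>)"
      unfolding sum_distrib_right by (rule Bochner_Integration.integral_sum) (rule int)
    finally have 1: "k * norm x = (\<Sum>i<N. LINT y|lborel. indicator (P i) y * \<bar>y \<bullet> x\<bar>)" .
    have "\<bar>measure lborel (P i) * \<bar>c i \<bullet> x\<bar> - (LINT y|lborel. indicator (P i) y * \<bar>y \<bullet> x\<bar>)\<bar> \<le> measure lborel (P i) * (r * norm x)" for i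
    proof -
      have "measure lborel (P i) * \<bar>c i \<bullet> x\<bar> - (LINT y|lborel. indicator (P i) y * \<bar>y \<bullet> x\<bar>)
          = (LINT y|lborel. indicator (P i) y * \<bar>c i \<bullet> x\<bar> - indicator (P i) y * \<bar>y \<bullet> x\<bar>)"
        using int int1 by (simp add: meas)
      also have "\<bar>\<dots>\<bar> \<le> (LINT y|lborel. indicator (P i) y * (r * norm x))"
      proof (rule integral_abs_bound[THEN order_trans], rule integral_mono)
        show "integrable lborel (\<lambda>y. \<bar>indicator (P i) y * \<bar>c i \<bullet> x\<bar> - indicator (P i) y * \<bar>y \<bullet> x\<bar>\<bar>)"
          using int int1 by (intro integrable_abs Bochner_Integration.integrable_diff integrable_mult_left) auto
        show "integrable lborel (\<lambda>y. indicator (P i) y * (r * norm x))"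
          using int1 by (intro integrable_mult_left) auto
        fix y
        show "\<bar>indicator (P i) y * \<bar>c i \<bullet> x\<bar> - indicator (P i) y * \<bar>y \<bullet> x\<bar>\<bar> \<le> indicator (P i) y * (r * norm x)"
        proof (cases "y \<in> P i")
          case True
          then have "norm (c i - y) \<le> r" using PB(2)[of i] by (auto simp: dist_norm)
          then have "\<bar>(c i - y) \<bullet> x\<bar> \<le> r * norm x"
            using Cauchy_Schwarz_ineq2[of "c i - y" x] mult_right_mono[of "norm (c i - y)" r "norm x"] by simp
          then show ?thesis using True by (simp add: inner_diff_left)
        qed simp
      qed
      also have "\<dots> = measure lborel (P i) * (r * norm x)" using meas[of i] by simp
      finally show ?thesis .
    qed
    then have "\<bar>\<Sum>i<N. measure lborel (P i) * \<bar>c i \<bullet> x\<bar> - (LINT y|lborel. indicator (P i) y * \<bar>y \<bullet> x\<bar>)\<bar>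
        \<le> (\<Sum>i<N. measure lborel (P i) * (r * norm x))"
      by (intro order_trans[OF sum_abs] sum_mono)
    moreover have "(\<Sum>i<N. measure lborel (P i)) = w"
    proof -
      have "(\<Sum>i<N. measure lborel (P i)) = (LINT y|lborel. (\<Sum>i<N. indicator (P i) y))"
        by (simp only: Bochner_Integration.integral_sum[OF int1] meas)
      also have "\<dots> = w" unfolding Psum w_def using emeasure_bounded_finite[of ?B] by simp
      finally show ?thesis .
    qed
    ultimately have "\<bar>(\<Sum>i<N. measure lborel (P i) * \<bar>c i \<bullet> x\<bar>) - k * norm x\<bar> \<le> w * (r * norm x)"
      by (simp add: 1 sum_subtractf sum_distrib_right[symmetric])
    moreover have "(\<Sum>i<N. measure lborel (P i) * \<bar>c i \<bullet> x\<bar>) = k * (\<Sum>i<N. \<bar>v i \<bullet> x\<bar>)"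
      unfolding sum_distrib_left v_def using k by (intro sum.cong) (auto simp: abs_mult)
    ultimately have "k * \<bar>(\<Sum>i<N. \<bar>v i \<bullet> x\<bar>) - norm x\<bar> \<le> k * (e * norm x)"
      using k w abs_mult[of k "(\<Sum>i<N. \<bar>v i \<bullet> x\<bar>) - norm x"] by (simp add: right_diff_distrib r_def ac_simps)
    then show ?thesis using k by simp
  qed
  have "(1 - e) * norm x \<le> (\<Sum>j\<in>{..<N}. \<bar>v j \<bullet> x\<bar>) \<and> (\<Sum>j\<in>{..<N}. \<bar>v j \<bullet> x\<bar>) \<le> (1 + e) * norm x" for x
    using main[of x] by (simp add: algebra_simps abs_le_iff)
  then show ?thesis by (intro exI[of _ "{..<N}"] exI[of _ v]) simp
qed

lemma mem_symmetric_segment: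
  fixes v :: "'a::real_vector"
  shows "z \<in> closed_segment (- v) v \<longleftrightarrow> (\<exists>s. \<bar>s\<bar> \<le> 1 \<and> z = s *\<^sub>R v)"
proof
  assume "z \<in> closed_segment (- v) v"
  then obtain u where u: "0 \<le> u" "u \<le> 1" "z = (1 - u) *\<^sub>R (- v) + u *\<^sub>R v" unfolding in_segment by blast
  have "(1 - u) *\<^sub>R (- v) + u *\<^sub>R v = (u - (1 - u)) *\<^sub>R v"
    by (simp only: scaleR_diff_left scaleR_minus_right) simp
  then show "\<exists>s. \<bar>s\<bar> \<le> 1 \<and> z = s *\<^sub>R v"
    using u by (intro exI[of _ "u - (1 - u)"]) simp
next
  assume "\<exists>s. \<bar>s\<bar> \<le> 1 \<and> z = s *\<^sub>R v"
  then obtain s where s: "\<bar>s\<bar> \<le> 1" "z = s *\<^sub>R v" by blast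
  have "(1 - (1 + s) / 2) *\<^sub>R (- v) + ((1 + s) / 2) *\<^sub>R v = ((1 + s) / 2 - (1 - (1 + s) / 2)) *\<^sub>R v"
    by (simp only: scaleR_diff_left scaleR_minus_right) simp
  also have "(1 + s) / 2 - (1 - (1 + s) / 2) = s" by (simp add: field_simps)
  also have "s *\<^sub>R v = z" using s by simp
  finally show "z \<in> closed_segment (- v) v"
    unfolding in_segment using s by (intro exI[of _ "(1 + s) / 2"]) auto
qed

text \<open>The sum is the support function of the zonotope in direction \<open>x\<close>. For the outer ball, test it
  against an element of the zonotope; for the inner ball, separate a point outside the zonotope by
  a hyperplane.\<close>

lemma zonotope_between_balls:
  fixes v :: "'i \<Rightarrow> 'a::euclidean_space"
  assumes J: "finite J"
    and h: "\<And>x. r * norm x \<le> (\<Sum>j\<in>J. \<bar>v j \<bullet> x\<bar>)" "\<And>x. (\<Sum>j\<in>J. \<bar>v j \<bullet> x\<bar>) \<le> R * norm x"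
  shows "cball 0 r \<subseteq> (\<Sum>j\<in>J. closed_segment (- v j) (v j))"
    and "(\<Sum>j\<in>J. closed_segment (- v j) (v j)) \<subseteq> cball 0 R"
proof -
  let ?Z = "\<Sum>j\<in>J. closed_segment (- v j) (v j)"
  show "?Z \<subseteq> cball 0 R"
  proof
    fix z assume "z \<in> ?Z"
    then obtain s where s: "z = (\<Sum>j\<in>J. s j)" "\<And>j. j \<in> J \<Longrightarrow> s j \<in> closed_segment (- v j) (v j)"
      by (auto simp: set_sum_alt[OF J])
    have "s j \<bullet> z \<le> \<bar>v j \<bullet> z\<bar>" if j: "j \<in> J" for j
    proof -
      obtain q where "\<bar>q\<bar> \<le> 1" "s j = q *\<^sub>R v j" using s(2)[OF j] by (auto simp: mem_symmetric_segment)
      then have "s j \<bullet> z = q * (v j \<bullet> z)" by simp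
      also have "\<dots> \<le> \<bar>q\<bar> * \<bar>v j \<bullet> z\<bar>" by (metis abs_ge_self abs_mult)
      also have "\<dots> \<le> 1 * \<bar>v j \<bullet> z\<bar>" using \<open>\<bar>q\<bar> \<le> 1\<close> by (intro mult_right_mono) auto
      finally show ?thesis by simp
    qed
    then have "z \<bullet> z \<le> (\<Sum>j\<in>J. \<bar>v j \<bullet> z\<bar>)"
      by (subst (1) s(1)) (simp add: inner_sum_left sum_mono)
    then have "norm z * norm z \<le> R * norm z"
      using h(2)[of z] by (simp add: dot_square_norm power2_eq_square)
    moreover have "0 \<le> R"
    proof -
      have "0 \<le> (\<Sum>j\<in>J. \<bar>v j \<bullet> (SOME b. b \<in> Basis)\<bar>)" by (intro sum_nonneg) auto
      also have "\<dots> \<le> R * norm (SOME b. b \<in> (Basis :: 'a set))" by (rule h(2))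
      finally show ?thesis by (simp add: SOME_Basis)
    qed
    ultimately show "z \<in> cball 0 R" by (cases "norm z = 0") auto
  qed
  show "cball 0 r \<subseteq> ?Z"
  proof
    fix y :: 'a assume y: "y \<in> cball 0 r"
    show "y \<in> ?Z"
    proof (rule ccontr)
      assume "y \<notin> ?Z"
      have "convex ?Z" "closed ?Z"
        by (auto intro!: convex_set_sum compact_imp_closed compact_set_sum)
      then obtain a b where ab: "a \<bullet> y < b" "\<And>x. x \<in> ?Z \<Longrightarrow> b < a \<bullet> x"
        using separating_hyperplane_closed_point[of ?Z y] \<open>y \<notin> ?Z\<close> by auto
      have "(\<Sum>j\<in>J. (- sgn (v j \<bullet> a)) *\<^sub>R v j) \<in> ?Z"
      proof -
        have "(- sgn (v j \<bullet> a)) *\<^sub>R v j \<in> closed_segment (- v j) (v j)" for j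
          unfolding mem_symmetric_segment by (intro exI[of _ "- sgn (v j \<bullet> a)"]) (simp add: abs_sgn_eq)
        then show ?thesis unfolding set_sum_alt[OF J] by blast
      qed
      then have "b < a \<bullet> (\<Sum>j\<in>J. (- sgn (v j \<bullet> a)) *\<^sub>R v j)" by (rule ab(2))
      also have "\<dots> = (\<Sum>j\<in>J. - \<bar>v j \<bullet> a\<bar>)"
        unfolding inner_sum_right by (intro sum.cong refl) (simp add: inner_commute abs_sgn mult.commute)
      also have "\<dots> \<le> - (r * norm a)" using h(1)[of a] by (simp add: sum_negf)
      finally have "a \<bullet> y < - (r * norm a)" using ab(1) by simp
      then have "r * norm a < \<bar>a \<bullet> y\<bar>" by simp
      also have "\<dots> \<le> norm a * norm y" by (rule Cauchy_Schwarz_ineq2)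
      also have "\<dots> \<le> norm a * r" using y by (intro mult_left_mono) auto
      finally show False by (simp add: mult.commute)
    qed
  qed
qed

section \<open>Steiner's formula\<close>

lemma convergent_subsequence_finitely_many:
  fixes a :: "nat \<Rightarrow> nat \<Rightarrow> real"
  assumes "\<And>n k. \<bar>a n k\<bar> \<le> C"
  shows "\<exists>r. strict_mono r \<and> (\<forall>k<m. convergent (\<lambda>n. a (r n) k))"
proof (induction m)
  case 0
  then show ?case by (intro exI[of _ id]) (simp add: strict_mono_def)
next
  case (Suc m)
  then obtain r where r: "strict_mono r" "\<And>k. k < m \<Longrightarrow> convergent (\<lambda>n. a (r n) k)" by blast
  have "bounded (range (\<lambda>n. a (r n) m))" using assms by (auto simp: bounded_iff)
  then obtain s l where s: "strict_mono s" "((\<lambda>n. a (r n) m) \<circ> s) \<longlonglongrightarrow> l"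
    using bounded_imp_convergent_subsequence by blast
  have "convergent (\<lambda>n. a ((r \<circ> s) n) k)" if "k < Suc m" for k
  proof (cases "k = m")
    case True
    then show ?thesis using s(2) by (auto simp: comp_def convergent_def)
  next
    case False
    then show ?thesis using r(2)[of k] that s(1) convergent_subseq_convergent[of "\<lambda>n. a (r n) k" s]
      by (simp add: comp_def)
  qed
  then show ?case using r(1) s(1) by (intro exI[of _ "r \<circ> s"] conjI strict_mono_o) simp_all
qed

lemma vol_translate: "vol ({w} + A) = vol A"
proof -
  have "{w} + A = (+) w ` A" by (auto simp: set_plus_def)
  then show ?thesis by (simp add: measure_translation)
qed

lemma vol_mono: "A \<subseteq> B \<Longrightarrow> compact A \<Longrightarrow> compact B \<Longrightarrow> vol A \<le> vol B"
  by (rule measure_mono_fmeasurable) (auto intro: lmeasurable_compact fmeasurableD)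

lemma vol_plus_mono:
  "A \<subseteq> B \<Longrightarrow> compact K \<Longrightarrow> compact A \<Longrightarrow> compact B \<Longrightarrow> vol (K + A) \<le> vol (K + B)"
  by (intro vol_mono set_plus_mono2 compact_set_plus order_refl)

lemma vol_scaleR: "vol ((*\<^sub>R) m ` S) = \<bar>m\<bar> ^ DIM('a) * vol S" for S :: "'a::euclidean_space set"
  using measure_lebesgue_affine[of m 0 S] by simp

lemma cball_plus_cball: "0 \<le> s \<Longrightarrow> 0 \<le> t \<Longrightarrow> cball 0 s + cball 0 t = cball (0::'a::euclidean_space) (s + t)"
proof (intro equalityI subsetI)
  fix x :: 'a assume st: "0 \<le> s" "0 \<le> t" and x: "x \<in> cball 0 (s + t)"
  show "x \<in> cball 0 s + cball 0 t"
  proof (cases "s + t = 0")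
    case True
    with st x have "s = 0" "t = 0" "x = 0" by auto
    then show ?thesis by (simp add: set_plus_def)
  next
    case False
    with st have "s + t > 0" by simp
    have "(s / (s + t)) *\<^sub>R x + (t / (s + t)) *\<^sub>R x = x"
      using False by (simp add: add_divide_distrib[symmetric] flip: scaleR_add_left)
    moreover have "(s / (s + t)) *\<^sub>R x \<in> cball 0 s" "(t / (s + t)) *\<^sub>R x \<in> cball 0 t"
      using st x \<open>s + t > 0\<close> mult_left_mono[of "norm x" "s + t" s] mult_left_mono[of "norm x" "s + t" t]
      by (simp_all add: field_simps)
    ultimately show ?thesis by (metis set_plus_intro)
  qed
next
  fix x :: 'a assume "x \<in> cball 0 s + cball 0 t"
  then show "x \<in> cball 0 (s + t)"
    by (auto simp: set_plus_def intro: norm_triangle_le add_mono)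
qed

text \<open>Since \<open>0 \<in> K\<close>, the set \<open>K\<close> is contained in its dilate by \<open>l\<close>.\<close>

lemma vol_parallel_scale_le:
  fixes K :: "'a::euclidean_space set"
  assumes K: "convex K" "compact K" "0 \<in> K" and l: "1 \<le> l" and t: "0 \<le> t"
  shows "vol (K + cball 0 (l * t)) \<le> l ^ DIM('a) * vol (K + cball 0 t)"
proof -
  have "K + cball 0 (l * t) \<subseteq> (*\<^sub>R) l ` (K + cball 0 t)"
  proof
    fix x assume "x \<in> K + cball 0 (l * t)"
    then obtain k z where kz: "x = k + z" "k \<in> K" "norm z \<le> l * t" by (auto simp: set_plus_def)
    have "(1 / l) *\<^sub>R k + (1 - 1 / l) *\<^sub>R 0 \<in> K"
      using K l kz by (intro convexD) auto
    then have "(1 / l) *\<^sub>R k \<in> K" by simp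
    moreover have "(1 / l) *\<^sub>R z \<in> cball 0 t" using kz l by (simp add: field_simps)
    ultimately have "(1 / l) *\<^sub>R k + (1 / l) *\<^sub>R z \<in> K + cball 0 t" by (rule set_plus_intro)
    moreover have "x = l *\<^sub>R ((1 / l) *\<^sub>R k + (1 / l) *\<^sub>R z)"
      using kz l by (simp add: scaleR_add_right)
    ultimately show "x \<in> (*\<^sub>R) l ` (K + cball 0 t)" by blast
  qed
  then have "vol (K + cball 0 (l * t)) \<le> vol ((*\<^sub>R) l ` (K + cball 0 t))"
    using K by (intro vol_mono) (auto intro!: compact_set_plus compact_scaling)
  then show ?thesis using l by (simp add: vol_scaleR)
qed

text \<open>The polynomial is the volume of \<open>K\<close> plus a zonotope that lies between the balls of radius
  \<open>(1 - e) t\<close> and \<open>(1 + e) t\<close>.\<close>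

lemma vol_parallel_between_polys:
  fixes K :: "'a::euclidean_space set"
  assumes K: "convex K" "compact K" "0 \<in> K" and e: "0 < e" "e < 1"
  shows "\<exists>a. (\<forall>k. 0 \<le> a k) \<and> (\<forall>t\<ge>0. (1 - e) ^ DIM('a) * vol (K + cball 0 t) \<le> (\<Sum>k\<le>DIM('a). a k * t ^ k)
      \<and> (\<Sum>k\<le>DIM('a). a k * t ^ k) \<le> (1 + e) ^ DIM('a) * vol (K + cball 0 t))"
proof -
  obtain J :: "nat set" and v where J: "finite J"
    and v: "\<And>x::'a. (1 - e) * norm x \<le> (\<Sum>j\<in>J. \<bar>v j \<bullet> x\<bar>)" "\<And>x. (\<Sum>j\<in>J. \<bar>v j \<bullet> x\<bar>) \<le> (1 + e) * norm x"
    using norm_approx_zonotope_support[OF e(1)] by blast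
  let ?Z = "\<lambda>t. \<Sum>j\<in>J. closed_segment (- t *\<^sub>R v j) (t *\<^sub>R v j)"
  obtain a where a: "\<And>k. 0 \<le> a k" "\<And>t. t \<ge> 0 \<Longrightarrow> vol (K + ?Z t) = (\<Sum>k\<le>DIM('a). a k * t ^ k)"
    using vol_add_symmetric_zonotope_poly[OF J K(1,2), of v] by blast
  have "(1 - e) ^ DIM('a) * vol (K + cball 0 t) \<le> vol (K + ?Z t)
      \<and> vol (K + ?Z t) \<le> (1 + e) ^ DIM('a) * vol (K + cball 0 t)" if t: "t \<ge> 0" for t
  proof -
    have sub: "cball 0 ((1 - e) * t) \<subseteq> ?Z t" "?Z t \<subseteq> cball 0 ((1 + e) * t)"
    proof -
      have s: "(\<Sum>j\<in>J. \<bar>(t *\<^sub>R v j) \<bullet> x\<bar>) = t * (\<Sum>j\<in>J. \<bar>v j \<bullet> x\<bar>)" for x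
        using t by (simp add: sum_distrib_left abs_mult)
      have 1: "((1 - e) * t) * norm x \<le> (\<Sum>j\<in>J. \<bar>(t *\<^sub>R v j) \<bullet> x\<bar>)" for x
        unfolding s using mult_left_mono[OF v(1) t, of x] by (simp add: ac_simps)
      have 2: "(\<Sum>j\<in>J. \<bar>(t *\<^sub>R v j) \<bullet> x\<bar>) \<le> ((1 + e) * t) * norm x" for x
        unfolding s using mult_left_mono[OF v(2) t, of x] by (simp add: ac_simps)
      show "cball 0 ((1 - e) * t) \<subseteq> ?Z t" "?Z t \<subseteq> cball 0 ((1 + e) * t)"
        using zonotope_between_balls[OF J, of "(1 - e) * t" "\<lambda>j. t *\<^sub>R v j" "(1 + e) * t", OF 1 2] by simp_all
    qed
    have cZ: "compact (?Z t)" by (intro compact_set_sum compact_segment)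
    have "vol (K + cball 0 ((1 - e) * t)) \<le> vol (K + ?Z t)"
      "vol (K + ?Z t) \<le> vol (K + cball 0 ((1 + e) * t))"
      using vol_plus_mono[OF sub(1) K(2) compact_cball cZ] vol_plus_mono[OF sub(2) K(2) cZ compact_cball]
      by simp_all
    moreover have "vol (K + cball 0 ((1 + e) * t)) \<le> (1 + e) ^ DIM('a) * vol (K + cball 0 t)"
      using e t by (intro vol_parallel_scale_le K) auto
    moreover have "(1 - e) ^ DIM('a) * vol (K + cball 0 t) \<le> vol (K + cball 0 ((1 - e) * t))"
    proof -
      have "vol (K + cball 0 ((1 / (1 - e)) * ((1 - e) * t))) \<le> (1 / (1 - e)) ^ DIM('a) * vol (K + cball 0 ((1 - e) * t))"
        using e t by (intro vol_parallel_scale_le K) auto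
      also have "(1 / (1 - e)) * ((1 - e) * t) = t" using e by simp
      finally have "(1 - e) ^ DIM('a) * vol (K + cball 0 t)
          \<le> (1 - e) ^ DIM('a) * ((1 / (1 - e)) ^ DIM('a) * vol (K + cball 0 ((1 - e) * t)))"
        using e by (intro mult_left_mono) auto
      then show ?thesis using e by (simp add: power_one_over)
    qed
    ultimately show ?thesis by linarith
  qed
  then show ?thesis using a(1) by (intro exI[of _ a] conjI allI impI) (simp_all add: a(2)[symmetric])
qed

text \<open>The coefficients of the polynomials above are bounded, so a subsequence of
  them converges as \<open>e\<close> tends to \<open>0\<close>. The leading coefficient is found by letting \<open>t\<close> tend to
  infinity.\<close>

theorem steiner:
  fixes K :: "'a::euclidean_space set"
  assumes K: "convex K" "compact K" "K \<noteq> {}"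
  obtains a where "\<And>k. 0 \<le> a k" "\<And>t. 0 \<le> t \<Longrightarrow> vol (K + cball 0 t) = (\<Sum>k\<le>DIM('a). a k * t ^ k)"
    "a 0 = vol K" "a (DIM('a)) = vol (ball (0::'a) 1)"
proof -
  have main: "\<exists>a. (\<forall>k. 0 \<le> a k) \<and> (\<forall>t\<ge>0. vol (L + cball 0 t) = (\<Sum>k\<le>DIM('a). a k * t ^ k))"
    if L: "convex L" "compact L" "0 \<in> L" for L :: "'a set"
  proof -
    let ?V = "\<lambda>t. vol (L + cball 0 t)" and ?d = "DIM('a)"
    define e where "e n = 1 / real (n + 2)" for n
    have e: "0 < e n" "e n < 1" for n by (auto simp: e_def)
    have e0: "e \<longlonglongrightarrow> 0" unfolding e_def using LIMSEQ_ignore_initial_segment[OF lim_const_over_n[of 1], of 2] by simp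
    have "\<forall>n. \<exists>a. (\<forall>k. 0 \<le> a k) \<and> (\<forall>t\<ge>0. (1 - e n) ^ ?d * ?V t \<le> (\<Sum>k\<le>?d. a k * t ^ k)
      \<and> (\<Sum>k\<le>?d. a k * t ^ k) \<le> (1 + e n) ^ ?d * ?V t)"
      using vol_parallel_between_polys[OF L e] by blast
    from choice[OF this] obtain a where "\<forall>n. (\<forall>k. 0 \<le> a n k) \<and> (\<forall>t\<ge>0. (1 - e n) ^ ?d * ?V t \<le> (\<Sum>k\<le>?d. a n k * t ^ k)
      \<and> (\<Sum>k\<le>?d. a n k * t ^ k) \<le> (1 + e n) ^ ?d * ?V t)" ..
    then have a: "0 \<le> a n k"
      "t \<ge> 0 \<Longrightarrow> (1 - e n) ^ ?d * ?V t \<le> (\<Sum>k\<le>?d. a n k * t ^ k)"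
      "t \<ge> 0 \<Longrightarrow> (\<Sum>k\<le>?d. a n k * t ^ k) \<le> (1 + e n) ^ ?d * ?V t" for n k t
      by simp_all
    define b where "b n k = (if k \<le> ?d then a n k else 0)" for n k
    have "\<bar>b n k\<bar> \<le> 2 ^ ?d * ?V 1" for n k
    proof (cases "k \<le> ?d")
      case True
      have "a n k \<le> (\<Sum>k\<le>?d. a n k * 1 ^ k)"
        using a(1) True by (simp add: member_le_sum)
      also have "\<dots> \<le> (1 + e n) ^ ?d * ?V 1" by (rule a(3)) simp
      also have "\<dots> \<le> 2 ^ ?d * ?V 1" using e[of n] by (intro mult_right_mono power_mono) auto
      finally show ?thesis using a(1) True by (simp add: b_def)
    qed (simp add: b_def)
    then obtain r where r: "strict_mono r" "\<And>k. k < Suc ?d \<Longrightarrow> convergent (\<lambda>n. b (r n) k)"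
      using convergent_subsequence_finitely_many[of b "2 ^ ?d * ?V 1" "Suc ?d"] by blast
    define c where "c k = (if k \<le> ?d then lim (\<lambda>n. b (r n) k) else 0)" for k
    have lim: "(\<lambda>n. a (r n) k) \<longlonglongrightarrow> c k" if "k \<le> ?d" for k
      using r(2)[of k] that by (simp add: c_def b_def convergent_LIMSEQ_iff)
    have "0 \<le> c k" for k
    proof (cases "k \<le> ?d")
      case True
      show ?thesis by (rule LIMSEQ_le_const[OF lim[OF True]]) (use a(1) in auto)
    qed (simp add: c_def)
    moreover have "?V t = (\<Sum>k\<le>?d. c k * t ^ k)" if t: "t \<ge> 0" for t
    proof (rule LIMSEQ_unique)
      show "(\<lambda>n. \<Sum>k\<le>?d. a (r n) k * t ^ k) \<longlonglongrightarrow> (\<Sum>k\<le>?d. c k * t ^ k)"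
        by (intro tendsto_sum tendsto_mult lim tendsto_const) simp
      have er: "(\<lambda>n. e (r n)) \<longlonglongrightarrow> 0"
        using LIMSEQ_subseq_LIMSEQ[OF e0 r(1)] by (simp add: comp_def)
      show "(\<lambda>n. \<Sum>k\<le>?d. a (r n) k * t ^ k) \<longlonglongrightarrow> ?V t"
      proof (rule tendsto_sandwich)
        show "\<forall>\<^sub>F n in sequentially. (1 - e (r n)) ^ ?d * ?V t \<le> (\<Sum>k\<le>?d. a (r n) k * t ^ k)"
          "\<forall>\<^sub>F n in sequentially. (\<Sum>k\<le>?d. a (r n) k * t ^ k) \<le> (1 + e (r n)) ^ ?d * ?V t"
          using a(2,3) t by auto
        have "(\<lambda>n. (1 - e (r n)) ^ ?d * ?V t) \<longlonglongrightarrow> (1 - 0) ^ ?d * ?V t"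
          by (intro tendsto_intros er)
        then show "(\<lambda>n. (1 - e (r n)) ^ ?d * ?V t) \<longlonglongrightarrow> ?V t" by simp
        have "(\<lambda>n. (1 + e (r n)) ^ ?d * ?V t) \<longlonglongrightarrow> (1 + 0) ^ ?d * ?V t"
          by (intro tendsto_intros er)
        then show "(\<lambda>n. (1 + e (r n)) ^ ?d * ?V t) \<longlonglongrightarrow> ?V t" by simp
      qed
    qed
    ultimately show ?thesis by blast
  qed
  obtain x0 where x0: "x0 \<in> K" using K by blast
  let ?L = "{- x0} + K"
  have "convex ?L" "compact ?L"
    using K by (intro convex_set_plus compact_set_plus; simp)+
  moreover have "0 \<in> ?L" using x0 by (auto simp: set_plus_def)
  ultimately have "convex ?L" "compact ?L" "0 \<in> ?L" .
  from main[OF this] obtain a where a: "\<And>k. 0 \<le> a k" "\<And>t. t \<ge> 0 \<Longrightarrow> vol (?L + cball 0 t) = (\<Sum>k\<le>DIM('a). a k * t ^ k)"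
    by blast
  have V: "vol (K + cball 0 t) = (\<Sum>k\<le>DIM('a). a k * t ^ k)" if "t \<ge> 0" for t
    using a(2)[OF that] vol_translate[of "- x0" "K + cball 0 t"] by (simp add: add.assoc)
  have "vol K = (\<Sum>k\<le>DIM('a). a k * 0 ^ k)" using V[of 0] by simp
  also have "\<dots> = a 0" by (subst sum.remove[of _ 0]) (auto intro: sum.neutral)
  finally have a0: "a 0 = vol K" by simp
  obtain R where R: "R > 0" "K \<subseteq> cball 0 R"
    using compact_imp_bounded[OF K(2)] unfolding bounded_pos by (auto simp: subset_iff)
  let ?w = "vol (ball (0::'a) 1)" and ?d = "DIM('a)"
  have ball: "vol (cball (0::'a) t) = t ^ ?d * ?w" if "t > 0" for t
  proof -
    have "vol (cball (0::'a) t) = vol (ball (0::'a) t)"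
      by (metis bounded_ball closure_ball measure_closure negligible_convex_frontier convex_ball that)
    then show ?thesis using that content_ball_conv_unit_ball[of t "0::'a"] by simp
  qed
  have lim1: "((\<lambda>t. (\<Sum>k\<le>?d. a k * t ^ k) / t ^ ?d) \<longlongrightarrow> (\<Sum>k\<le>?d. if k = ?d then a ?d else 0)) at_top"
    unfolding sum_divide_distrib
  proof (rule tendsto_sum)
    fix k assume k: "k \<in> {..?d}"
    then have "((\<lambda>t. a k * t ^ k / t ^ ?d) \<longlongrightarrow> a k * (if k = ?d then 1 else 0)) at_top"
      using tendsto_mult_left[OF power_ratio_tendsto[of k ?d], of "a k"] by (simp only: times_divide_eq_right atMost_iff)
    also have "a k * (if k = ?d then 1 else 0) = (if k = ?d then a ?d else 0)" by simp
    finally show "((\<lambda>t. a k * t ^ k / t ^ ?d) \<longlongrightarrow> (if k = ?d then a ?d else 0)) at_top" .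
  qed
  have lim2: "((\<lambda>t. (\<Sum>k\<le>?d. a k * t ^ k) / t ^ ?d) \<longlongrightarrow> ?w) at_top"
  proof (rule tendsto_sandwich)
    show "eventually (\<lambda>t. ?w \<le> (\<Sum>k\<le>?d. a k * t ^ k) / t ^ ?d) at_top"
      using eventually_gt_at_top[of 0]
    proof eventually_elim
      case (elim t)
      have "vol ({x0} + cball 0 t) \<le> vol (K + cball 0 t)"
        using K(2) x0 by (intro vol_mono set_plus_mono2 compact_set_plus) auto
      then have "t ^ ?d * ?w \<le> (\<Sum>k\<le>?d. a k * t ^ k)"
        using elim V[of t] ball[of t] by (simp only: vol_translate less_imp_le)
      then show ?case using elim by (simp add: field_simps)
    qed
    show "eventually (\<lambda>t. (\<Sum>k\<le>?d. a k * t ^ k) / t ^ ?d \<le> (R / t + 1) ^ ?d * ?w) at_top"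
      using eventually_gt_at_top[of 0]
    proof eventually_elim
      case (elim t)
      have "vol (K + cball 0 t) \<le> vol (cball 0 R + cball (0::'a) t)"
        using K(2) R by (intro vol_mono set_plus_mono2 compact_set_plus) auto
      also have "\<dots> = (R + t) ^ ?d * ?w" using R elim ball[of "R + t"] by (simp add: cball_plus_cball)
      also have "\<dots> = ((R / t + 1) ^ ?d * ?w) * t ^ ?d"
        using elim by (simp add: field_simps flip: power_mult_distrib)
      finally show ?case using elim V[of t] by (simp add: pos_divide_le_eq)
    qed
    have "((\<lambda>t. (R / t + 1) ^ ?d * ?w) \<longlongrightarrow> (0 + 1) ^ ?d * ?w) at_top"
      by (intro tendsto_intros tendsto_divide_0[OF tendsto_const] filterlim_at_top_imp_at_infinity filterlim_ident)
    then show "((\<lambda>t. (R / t + 1) ^ ?d * ?w) \<longlongrightarrow> ?w) at_top" by simp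
  qed simp
  have "(\<Sum>k\<le>?d. if k = ?d then a ?d else 0) = ?w"
    by (rule tendsto_unique[OF _ lim1 lim2]) simp
  then have "a ?d = ?w" by simp
  then show ?thesis using that a(1) V a0 by blast
qed

section \<open>The distance to a convex body\<close>

lemma has_derivative_sandwich:
  fixes f g h :: "'a::real_normed_vector \<Rightarrow> real"
  assumes f: "(f has_derivative D) (at x)" and h: "(h has_derivative D) (at x)"
    and le: "\<And>y. f y \<le> g y" "\<And>y. g y \<le> h y" and eq: "f x = g x" "h x = g x"
  shows "(g has_derivative D) (at x)"
proof -
  have f': "((\<lambda>y. (1 / norm (y - x)) *\<^sub>R (f y - (f x + D (y - x)))) \<longlongrightarrow> 0) (at x)"
    and h': "((\<lambda>y. (1 / norm (y - x)) *\<^sub>R (h y - (h x + D (y - x)))) \<longlongrightarrow> 0) (at x)"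
    and D: "bounded_linear D"
    using f h by (auto simp: has_derivative_within)
  have "((\<lambda>y. (1 / norm (y - x)) *\<^sub>R (g y - (g x + D (y - x)))) \<longlongrightarrow> 0) (at x)"
    by (rule tendsto_sandwich[OF _ _ f' h'])
      (use le eq in \<open>auto intro!: always_eventually divide_right_mono\<close>)
  with D show ?thesis by (simp add: has_derivative_within)
qed

locale convex_body =
  fixes K :: "'a::euclidean_space set"
  assumes convex: "convex K" and compact: "compact K" and interior_nonempty: "interior K \<noteq> {}"
begin

lemma closed: "closed K" using compact by (rule compact_imp_closed)

lemma nonempty: "K \<noteq> {}" using interior_nonempty interior_subset by blast

abbreviation proj :: "'a \<Rightarrow> 'a" where "proj \<equiv> closest_point K"

abbreviation dist_K :: "'a \<Rightarrow> real" where "dist_K x \<equiv> infdist x K"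

lemma proj_in: "proj x \<in> K" using closed nonempty by (rule closest_point_in_set)

lemma dist_K_eq: "dist_K x = norm (x - proj x)"
  using setdist_closest_point[OF closed nonempty, of x] by (simp add: infdist_eq_setdist dist_norm)

lemma dist_K_le: "k \<in> K \<Longrightarrow> dist_K x \<le> norm (x - k)"
  using infdist_le[of k K x] by (simp add: dist_norm)

lemma dist_K_pos_iff: "0 < dist_K x \<longleftrightarrow> x \<notin> K"
  using in_closed_iff_infdist_zero[OF closed nonempty, of x] infdist_nonneg[of x K] by linarith

lemma dist_K_Lipschitz: "\<bar>dist_K x - dist_K y\<bar> \<le> norm (x - y)"
proof -
  have "dist_K x \<le> dist_K y + norm (x - y)" for x y
    using infdist_triangle[of x K y] by (simp add: dist_norm)
  from this[of x y] this[of y x] show ?thesis by (simp add: norm_minus_commute abs_le_iff)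
qed

lemma continuous_dist_K: "continuous_on S (\<lambda>x. dist_K x)"
  by (intro continuous_on_infdist continuous_on_id)

lemma dist_K_measurable [measurable]: "(\<lambda>x. dist_K x) \<in> borel_measurable borel"
  using continuous_dist_K by (rule borel_measurable_continuous_onI)

lemma parallel_eq:
  assumes "0 \<le> t" shows "{x. dist_K x \<le> t} = K + cball 0 t"
proof (intro equalityI subsetI)
  fix x assume "x \<in> {x. dist_K x \<le> t}"
  then have "x - proj x \<in> cball 0 t" by (simp add: dist_K_eq)
  with proj_in have "proj x + (x - proj x) \<in> K + cball 0 t" by (rule set_plus_intro)
  then show "x \<in> K + cball 0 t" by simp
next
  fix x assume "x \<in> K + cball 0 t"
  then obtain k z where "x = k + z" "k \<in> K" "norm z \<le> t" by (auto simp: set_plus_def)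
  then show "x \<in> {x. dist_K x \<le> t}" using dist_K_le[of k x] by simp
qed

text \<open>The outer unit normal field \<open>\<nabla> dist_K\<close>, extended by \<open>0\<close> to \<open>K\<close>.\<close>

definition normal :: "'a \<Rightarrow> 'a" where
  "normal x = (1 / dist_K x) *\<^sub>R (x - proj x)"

lemma norm_normal: "x \<notin> K \<Longrightarrow> norm (normal x) = 1"
  using dist_K_pos_iff[of x] by (simp add: normal_def dist_K_eq)

lemma normal_in: "x \<in> K \<Longrightarrow> normal x = 0"
  by (simp add: normal_def closest_point_self)

lemma normal_measurable [measurable]: "normal \<in> borel_measurable borel"
proof -
  have [measurable]: "proj \<in> borel_measurable borel"
    using continuous_on_closest_point[OF convex closed nonempty, of UNIV]
    by (rule borel_measurable_continuous_onI)
  show ?thesis unfolding normal_def by measurable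
qed

lemma inner_normal_le:
  assumes "x \<notin> K" "k \<in> K" shows "(k - proj x) \<bullet> normal x \<le> 0"
proof -
  have "(x - proj x) \<bullet> (k - proj x) \<le> 0" by (rule closest_point_dot[OF convex closed assms(2)])
  moreover have "(k - proj x) \<bullet> normal x = (1 / dist_K x) * ((x - proj x) \<bullet> (k - proj x))"
    by (simp add: normal_def inner_commute)
  ultimately show ?thesis using dist_K_pos_iff[of x] assms by (simp add: divide_nonpos_pos)
qed

text \<open>Near \<open>x\<close> the distance to \<open>K\<close> lies between the distances to a supporting half-space and to the
  point \<open>proj x\<close>, which have the same derivative at \<open>x\<close>.\<close>

lemma dist_K_has_derivative:
  assumes x: "x \<notin> K"
  shows "((\<lambda>y. dist_K y) has_derivative (\<lambda>h. normal x \<bullet> h)) (at x)"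
proof (rule has_derivative_sandwich)
  show "((\<lambda>y. normal x \<bullet> (y - proj x)) has_derivative (\<lambda>h. normal x \<bullet> h)) (at x)"
    by (auto intro!: derivative_eq_intros)
  have ne: "x - proj x \<noteq> 0" using x dist_K_pos_iff[of x] dist_K_eq[of x] by auto
  have "((\<lambda>y. y - proj x) has_derivative (\<lambda>h. h)) (at x)"
    by (auto intro!: derivative_eq_intros)
  from has_derivative_compose[OF this has_derivative_norm[OF ne]]
  have "((\<lambda>y. norm (y - proj x)) has_derivative (\<lambda>h. h \<bullet> sgn (x - proj x))) (at x)" .
  moreover have "sgn (x - proj x) = normal x"
    by (simp add: normal_def dist_K_eq sgn_div_norm divide_inverse)
  ultimately show "((\<lambda>y. norm (y - proj x)) has_derivative (\<lambda>h. normal x \<bullet> h)) (at x)"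
    by (simp add: inner_commute)
  show "normal x \<bullet> (y - proj x) \<le> dist_K y" for y
  proof -
    have "normal x \<bullet> (y - proj x) = normal x \<bullet> (y - proj y) + normal x \<bullet> (proj y - proj x)"
      by (simp add: inner_diff_right)
    also have "\<dots> \<le> normal x \<bullet> (y - proj y)"
      using inner_normal_le[OF x proj_in[of y]] by (simp add: inner_commute)
    also have "\<dots> \<le> norm (normal x) * norm (y - proj y)" by (rule norm_cauchy_schwarz)
    finally show ?thesis using norm_normal[OF x] by (simp add: dist_K_eq)
  qed
  show "dist_K y \<le> norm (y - proj x)" for y by (rule dist_K_le[OF proj_in])
  show "normal x \<bullet> (x - proj x) = dist_K x"
    using ne by (simp add: normal_def dist_K_eq dot_square_norm power2_eq_square)
  show "norm (x - proj x) = dist_K x" by (simp add: dist_K_eq)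
qed

lemma dist_K_has_derivative_interior:
  assumes x: "x \<in> interior K"
  shows "((\<lambda>y. dist_K y) has_derivative (\<lambda>h. normal x \<bullet> h)) (at x)"
proof -
  have "((\<lambda>y. 0::real) has_derivative (\<lambda>h. normal x \<bullet> h)) (at x)"
    using x interior_subset[of K] by (auto simp: normal_in)
  then show ?thesis
    by (rule has_derivative_transform_within_open[OF _ open_interior x])
      (use interior_subset[of K] in \<open>auto simp: infdist_zero\<close>)
qed

lemma AE_not_frontier: "AE x in lborel. x \<notin> frontier K"
proof -
  have "frontier K \<in> null_sets lebesgue"
    using negligible_convex_frontier[OF convex] by (simp add: negligible_iff_null_sets)
  then have "frontier K \<in> null_sets lborel"
    by (simp add: null_sets_completion_iff)
  then show ?thesis by (rule AE_not_in)
qed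

end

section \<open>Weak gradients of Lipschitz functions\<close>

lemma directional_difference_quotient_tendsto:
  fixes f :: "'a::real_normed_vector \<Rightarrow> real"
  assumes f: "(f has_derivative f') (at x)" and h: "h \<longlonglongrightarrow> 0" "\<And>n. h n \<noteq> 0"
  shows "(\<lambda>n. (f (x + h n *\<^sub>R b) - f x) / h n) \<longlonglongrightarrow> f' b"
proof -
  have "((\<lambda>t::real. x + t *\<^sub>R b) has_derivative (\<lambda>t. t *\<^sub>R b)) (at 0)"
    by (auto intro!: derivative_eq_intros)
  moreover have "(f has_derivative f') (at (x + 0 *\<^sub>R b))" using f by simp
  ultimately have "((\<lambda>t. f (x + t *\<^sub>R b)) has_derivative (\<lambda>t. f' (t *\<^sub>R b))) (at 0)"
    by (rule has_derivative_compose)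
  moreover have "(\<lambda>t. f' (t *\<^sub>R b)) = (*) (f' b)"
    by (simp add: fun_eq_iff linear_cmul[OF has_derivative_linear[OF f]])
  ultimately have "((\<lambda>t. f (x + t *\<^sub>R b)) has_field_derivative f' b) (at 0)"
    by (simp only: has_field_derivative_def)
  then have "((\<lambda>t. (f (x + t *\<^sub>R b) - f x) / t) \<longlongrightarrow> f' b) (at 0)"
    by (simp add: has_field_derivative_iff)
  moreover have "filterlim h (at 0) sequentially" using h by (simp add: filterlim_at)
  ultimately show ?thesis by (rule filterlim_compose)
qed

text \<open>The integral is the limit of integrals of difference quotients, which vanish by translation
  invariance.\<close>

lemma integral_directional_derivative_eq_0:
  fixes w :: "'a::euclidean_space \<Rightarrow> real"
  assumes C: "bounded C" "\<And>x. x \<notin> C \<Longrightarrow> w x = 0"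
    and lip: "\<And>x y. \<bar>w x - w y\<bar> \<le> M * norm (x - y)"
    and deriv: "AE x in lborel. (w has_derivative w' x) (at x)"
    and meas [measurable]: "(\<lambda>x. w' x b) \<in> borel_measurable borel"
  shows "integrable lborel (\<lambda>x. w' x b)" "(LINT x|lborel. w' x b) = 0"
proof -
  define h where "h n = inverse (real (Suc n))" for n
  have h: "h n > 0" "h n \<le> 1" for n by (auto simp: h_def field_simps)
  have h0: "h \<longlonglongrightarrow> 0" "\<And>n. h n \<noteq> 0"
    using h(1) LIMSEQ_inverse_real_of_nat unfolding h_def[abs_def] by auto
  obtain r where r: "\<And>x. x \<in> C \<Longrightarrow> norm x \<le> r" using C(1) by (auto simp: bounded_iff)
  let ?B = "cball (0::'a) (r + norm b)"
  define s where "s n x = (w (x + h n *\<^sub>R b) - w x) / h n" for n x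
  have M: "0 \<le> M * norm b" using lip[of "b" 0] by (simp add: order_trans[OF abs_ge_zero])
  have cont: "continuous_on UNIV w"
  proof (rule lipschitz_on_continuous_on)
    show "(max M 0)-lipschitz_on UNIV w"
    proof (rule lipschitz_onI)
      fix x y :: 'a
      have "\<bar>w x - w y\<bar> \<le> M * norm (x - y)" by (rule lip)
      also have "\<dots> \<le> max M 0 * norm (x - y)" by (intro mult_right_mono) auto
      finally show "dist (w x) (w y) \<le> max M 0 * dist x y" by (simp add: dist_norm)
    qed simp
  qed
  then have [measurable]: "w \<in> borel_measurable borel" by (rule borel_measurable_continuous_onI)
  have far: "w x = 0" if "norm x > r" for x
    using C(2)[of x] r[of x] that by (meson not_le)
  have "bounded (w ` ?B)"
    by (intro compact_imp_bounded compact_continuous_image continuous_on_subset[OF cont]) auto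
  then obtain c where c: "\<And>x. x \<in> ?B \<Longrightarrow> \<bar>w x\<bar> \<le> c" unfolding bounded_iff by (metis imageI real_norm_def)
  have int: "integrable lborel w"
  proof (rule Bochner_Integration.integrable_bound)
    show "integrable lborel (\<lambda>x. indicator ?B x * c)"
      using emeasure_bounded_finite[of ?B] by simp
    have "norm (w x) \<le> norm (indicator ?B x * c)" for x
    proof (cases "x \<in> ?B")
      case True
      then show ?thesis using c[OF True] by simp
    next
      case False
      then show ?thesis using far[of x] norm_ge_zero[of b] by simp
    qed
    then show "AE x in lborel. norm (w x) \<le> norm (indicator ?B x * c)" by simp
  qed simp
  have zero: "(LINT x|lborel. s n x) = 0" for n
  proof -
    have eq: "distr lborel borel (\<lambda>x. x + h n *\<^sub>R b) = lborel"
    proof -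
      have "(\<lambda>x. x + h n *\<^sub>R b) = (+) (h n *\<^sub>R b)" by (simp add: fun_eq_iff add.commute)
      then show ?thesis by (simp only: lborel_distr_plus)
    qed
    have "integrable (distr lborel borel (\<lambda>x. x + h n *\<^sub>R b)) w" unfolding eq by (rule int)
    then have i: "integrable lborel (\<lambda>x. w (x + h n *\<^sub>R b))"
      by (rule integrable_distr[rotated]) auto
    have "(LINT x|lborel. w (x + h n *\<^sub>R b)) = (LINT x|distr lborel borel (\<lambda>x. x + h n *\<^sub>R b). w x)"
      by (rule integral_distr[symmetric]) auto
    also have "\<dots> = (LINT x|lborel. w x)" by (simp add: eq)
    finally show ?thesis unfolding s_def using i int by simp
  qed
  have bound: "norm (s n x) \<le> indicator ?B x * (M * norm b)" for n x
  proof (cases "x \<in> ?B")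
    case True
    have "\<bar>w (x + h n *\<^sub>R b) - w x\<bar> \<le> M * norm b * h n"
      using lip[of "x + h n *\<^sub>R b" x] h[of n] by (simp add: ac_simps)
    then show ?thesis using True h[of n] by (simp add: s_def pos_divide_le_eq)
  next
    case False
    then have "norm x > r + norm b" by simp
    moreover have "norm (x + h n *\<^sub>R b) \<ge> norm x - norm b"
    proof -
      have "norm (h n *\<^sub>R b) \<le> 1 * norm b" using h[of n] by (simp add: mult_left_le_one_le)
      then show ?thesis using norm_diff_ineq[of x "h n *\<^sub>R b"] by linarith
    qed
    ultimately have "w x = 0" "w (x + h n *\<^sub>R b) = 0"
      using norm_ge_zero[of b] by (intro far; linarith)+
    then show ?thesis using False by (simp add: s_def)
  qed
  have lim: "AE x in lborel. (\<lambda>n. s n x) \<longlonglongrightarrow> w' x b"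
    using deriv
  proof eventually_elim
    case (elim x)
    then show ?case unfolding s_def by (rule directional_difference_quotient_tendsto[OF _ h0])
  qed
  have ib: "integrable lborel (\<lambda>x. indicator ?B x * (M * norm b))"
    using emeasure_bounded_finite[of ?B] by simp
  have sm: "s n \<in> borel_measurable lborel" for n unfolding s_def by measurable
  show "integrable lborel (\<lambda>x. w' x b)"
    by (rule integrable_dominated_convergence[OF _ sm ib lim]) (auto intro!: AE_I2 bound[simplified])
  have "(\<lambda>n. LINT x|lborel. s n x) \<longlonglongrightarrow> (LINT x|lborel. w' x b)"
    by (rule integral_dominated_convergence[OF _ sm ib lim]) (auto intro!: AE_I2 bound[simplified])
  then show "(LINT x|lborel. w' x b) = 0" by (simp add: zero LIMSEQ_const_iff)
qed

lemma C_1_has_derivative: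
  assumes "C_k 1 f" shows "(f has_derivative frechet_derivative f (at x)) (at x)"
  using assms by (simp add: frechet_derivative_works[symmetric] differentiable_on_def)

lemma C_1_continuous: "C_k 1 f \<Longrightarrow> continuous_on S f"
  using continuous_on_subset[OF differentiable_imp_continuous_on, of f UNIV S] by simp

lemma C_1_continuous_derivative:
  "C_k 1 f \<Longrightarrow> b \<in> Basis \<Longrightarrow> continuous_on S (\<lambda>x. frechet_derivative f (at x) b)"
  using continuous_on_subset by auto

lemma compactly_supported_derivative_eq_0:
  assumes "x \<notin> closure {x. f x \<noteq> 0}"
  shows "frechet_derivative f (at x) = (\<lambda>_. 0)"
proof (rule frechet_derivative_at[symmetric])
  have "((\<lambda>_. 0) has_derivative (\<lambda>_. 0)) (at x)" by simp
  then show "(f has_derivative (\<lambda>_. 0)) (at x)"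
    by (rule has_derivative_transform_within_open[where s = "- closure {x. f x \<noteq> 0}"])
      (use assms closure_subset[of "{x. f x \<noteq> 0}"] in auto)
qed

lemma C_1_compact_support_bounds:
  fixes f :: "'a::euclidean_space \<Rightarrow> 'b::real_normed_vector"
  assumes f: "C_k 1 f" "compactly_supported f"
  obtains M where "M \<ge> 0" "\<And>x. norm (f x) \<le> M" "\<And>x b. b \<in> Basis \<Longrightarrow> norm (frechet_derivative f (at x) b) \<le> M"
    "\<And>x y. norm (f x - f y) \<le> M * norm (x - y)"
proof -
  let ?S = "closure {x. f x \<noteq> 0}" and ?D = "\<lambda>x. frechet_derivative f (at x)"
  have S: "compact ?S" using f(2) by (simp add: compactly_supported_def)
  have "bounded (f ` ?S)"
    by (intro compact_imp_bounded compact_continuous_image S C_1_continuous f)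
  then obtain M0 where M0: "\<And>x. x \<in> ?S \<Longrightarrow> norm (f x) \<le> M0" by (auto simp: bounded_iff)
  have "\<exists>m. \<forall>x\<in>?S. norm (?D x b) \<le> m" if "b \<in> Basis" for b
  proof -
    have "bounded ((\<lambda>x. ?D x b) ` ?S)"
      by (intro compact_imp_bounded compact_continuous_image S C_1_continuous_derivative f that)
    then show ?thesis by (auto simp: bounded_iff)
  qed
  then obtain m where m: "\<And>b x. b \<in> Basis \<Longrightarrow> x \<in> ?S \<Longrightarrow> norm (?D x b) \<le> m b" by metis
  define M where "M = \<bar>M0\<bar> + (\<Sum>b\<in>Basis. \<bar>m b\<bar>)"
  have M: "\<bar>M0\<bar> \<le> M" "(\<Sum>b\<in>Basis. \<bar>m b\<bar>) \<le> M" "M \<ge> 0"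
    by (auto simp: M_def sum_nonneg)
  have D: "norm (?D x b) \<le> \<bar>m b\<bar>" if "b \<in> Basis" for x b
  proof (cases "x \<in> ?S")
    case True
    then show ?thesis using m[OF that] by (meson abs_ge_self order_trans)
  next
    case False
    then show ?thesis by (simp add: compactly_supported_derivative_eq_0)
  qed
  have "norm (f x) \<le> M" for x
  proof (cases "x \<in> ?S")
    case True
    then show ?thesis using M0[of x] M(1) by linarith
  next
    case False
    then have "f x = 0" using closure_subset[of "{x. f x \<noteq> 0}"] by auto
    then show ?thesis using M by simp
  qed
  moreover have "norm (?D x b) \<le> M" if "b \<in> Basis" for x b
    using D[OF that, of x] member_le_sum[of b Basis "\<lambda>b. \<bar>m b\<bar>"] that M(2) by auto
  moreover have "norm (f x - f y) \<le> M * norm (x - y)" for x y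
  proof (rule differentiable_bound)
    show "convex (UNIV :: 'a set)" by simp
    show "(f has_derivative ?D x) (at x within UNIV)" for x using C_1_has_derivative[OF f(1)] by simp
    show "onorm (?D x) \<le> M" for x
    proof (rule onorm_le)
      fix h
      have lin: "linear (?D x)" by (rule has_derivative_linear[OF C_1_has_derivative[OF f(1)]])
      have "?D x h = (\<Sum>b\<in>Basis. (h \<bullet> b) *\<^sub>R ?D x b)"
        by (subst euclidean_representation[of h, symmetric]) (simp add: linear_sum[OF lin] linear_cmul[OF lin])
      also have "norm \<dots> \<le> (\<Sum>b\<in>Basis. \<bar>m b\<bar> * norm h)"
        by (intro sum_norm_le) (auto simp: mult.commute intro!: mult_mono Basis_le_norm D)
      also have "\<dots> \<le> M * norm h" using M(2) by (simp add: sum_distrib_right[symmetric] mult_right_mono)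
      finally show "norm (?D x h) \<le> M * norm h" .
    qed
  qed auto
  ultimately show ?thesis using that M(3) by blast
qed

lemma integrable_bounded_compact_support:
  fixes f :: "'a::euclidean_space \<Rightarrow> 'b::euclidean_space"
  assumes [measurable]: "f \<in> borel_measurable borel" and f: "\<And>x. norm (f x) \<le> M" and C: "bounded C" "\<And>x. x \<notin> C \<Longrightarrow> f x = 0"
  shows "integrable lborel f"
proof -
  obtain r where r: "C \<subseteq> cball 0 r" using C(1) by (auto simp: bounded_iff subset_iff)
  show ?thesis
  proof (rule Bochner_Integration.integrable_bound)
    show "integrable lborel (\<lambda>x. indicator (cball (0::'a) r) x * M)"
      using emeasure_bounded_finite[of "cball (0::'a) r"] by simp
    show "AE x in lborel. norm (f x) \<le> norm (indicator (cball 0 r) x * M)"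
      using r C(2) f by (intro AE_I2) (auto simp: indicator_def subset_iff intro: order_trans[OF f abs_ge_self])
  qed simp
qed

text \<open>For a test function \<open>\<phi>\<close> the product \<open>u \<phi>\<close> is Lipschitz with compact support, so the integrals
  of its directional derivatives vanish; the product rule turns this into the defining identity.\<close>

lemma weak_gradient_Lipschitz:
  fixes u :: "'a::euclidean_space \<Rightarrow> real"
  assumes lip: "\<And>x y. \<bar>u x - u y\<bar> \<le> L * norm (x - y)" and bdd: "\<And>x. \<bar>u x\<bar> \<le> B"
    and deriv: "AE x in lborel. (u has_derivative (\<lambda>h. g x \<bullet> h)) (at x)"
    and meas [measurable]: "u \<in> borel_measurable borel" "g \<in> borel_measurable borel" and g: "\<And>x. norm (g x) \<le> L"
  shows "weak_gradient u g"
  unfolding weak_gradient_def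
proof (intro conjI allI impI ballI)
  have loc: "locally_integrable f" if [measurable]: "f \<in> borel_measurable borel" and "\<And>x. norm (f x) \<le> M"
    for f :: "'a \<Rightarrow> 'c::euclidean_space" and M
    unfolding locally_integrable_def set_integrable_def
  proof (intro allI impI)
    fix C :: "'a set" assume C: "compact C"
    then have [measurable]: "C \<in> sets borel" by (simp add: borel_compact)
    show "integrable lborel (\<lambda>x. indicator C x *\<^sub>R f x)"
      using that(2) order_trans[OF norm_ge_zero that(2)]
      by (intro integrable_bounded_compact_support[OF _ _ compact_imp_bounded[OF C], of _ M]) (auto simp: indicator_def)
  qed
  show "locally_integrable u" using bdd by (intro loc[of u B]) auto
  show "locally_integrable g" using g by (intro loc[of g L]) auto
  fix \<phi> :: "'a \<Rightarrow> real" and b :: 'a assume phi: "test_function \<phi>" and b: "b \<in> Basis"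
  then have C1: "C_k 1 \<phi>" and cs: "compactly_supported \<phi>" by (auto simp: test_function_def)
  let ?D = "\<lambda>x. frechet_derivative \<phi> (at x)" and ?S = "closure {x. \<phi> x \<noteq> 0}"
  have S: "bounded ?S" using cs by (simp add: compactly_supported_def compact_imp_bounded)
  have S0: "\<phi> x = 0" "?D x b = 0" if "x \<notin> ?S" for x
    using that closure_subset[of "{x. \<phi> x \<noteq> 0}"] compactly_supported_derivative_eq_0[OF that] by auto
  obtain M where M: "M \<ge> 0" "\<And>x. norm (\<phi> x) \<le> M" "\<And>x b. b \<in> Basis \<Longrightarrow> norm (?D x b) \<le> M"
    "\<And>x y. norm (\<phi> x - \<phi> y) \<le> M * norm (x - y)"
    using C_1_compact_support_bounds[OF C1 cs] by metis
  have m: "\<phi> \<in> borel_measurable borel" "(\<lambda>x. ?D x b) \<in> borel_measurable borel"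
    by (intro borel_measurable_continuous_onI C_1_continuous C_1_continuous_derivative C1 b)+
  have gm: "(\<lambda>x. g x \<bullet> b) \<in> borel_measurable borel" by measurable
  have B: "0 \<le> B" using bdd[of 0] by linarith
  have int: "integrable lborel (\<lambda>x. u x * ?D x b)" "integrable lborel (\<lambda>x. (g x \<bullet> b) * \<phi> x)"
  proof -
    have *: "norm (u x * ?D x b) \<le> B * M" for x
      using bdd[of x] M(3)[OF b, of x] B by (simp add: abs_mult mult_mono)
    show "integrable lborel (\<lambda>x. u x * ?D x b)"
      by (rule integrable_bounded_compact_support[OF borel_measurable_times[OF meas(1) m(2)] * S])
        (drule S0(2), simp)
    have "\<bar>g x \<bullet> b\<bar> \<le> L" for x using Basis_le_norm[OF b, of "g x"] g[of x] by linarith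
    then have **: "norm ((g x \<bullet> b) * \<phi> x) \<le> L * M" for x
      using M(1) M(2)[of x] order_trans[OF norm_ge_zero g[of x]] by (simp add: abs_mult mult_mono)
    show "integrable lborel (\<lambda>x. (g x \<bullet> b) * \<phi> x)"
      by (rule integrable_bounded_compact_support[OF borel_measurable_times[OF gm m(1)] ** S])
        (drule S0(1), simp)
  qed
  have "(LINT x|lborel. (\<lambda>h. u x * ?D x h + (g x \<bullet> h) * \<phi> x) b) = 0"
  proof (rule integral_directional_derivative_eq_0(2)[where w = "\<lambda>x. u x * \<phi> x"])
    show "bounded ?S" by (rule S)
    show "u x * \<phi> x = 0" if "x \<notin> ?S" for x using S0(1)[OF that] by (simp only: mult_zero_right)
    show "\<bar>u x * \<phi> x - u y * \<phi> y\<bar> \<le> (B * M + M * L) * norm (x - y)" for x y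
    proof -
      have "u x * \<phi> x - u y * \<phi> y = u x * (\<phi> x - \<phi> y) + \<phi> y * (u x - u y)" by (simp add: algebra_simps)
      also have "\<bar>\<dots>\<bar> \<le> \<bar>u x\<bar> * \<bar>\<phi> x - \<phi> y\<bar> + \<bar>\<phi> y\<bar> * \<bar>u x - u y\<bar>"
        by (rule order_trans[OF abs_triangle_ineq]) (simp add: abs_mult)
      also have "\<dots> \<le> B * (M * norm (x - y)) + M * (L * norm (x - y))"
        using bdd M B lip by (intro add_mono mult_mono) (auto simp: real_norm_def)
      finally show ?thesis by (simp add: algebra_simps)
    qed
    show "AE x in lborel. ((\<lambda>x. u x * \<phi> x) has_derivative (\<lambda>h. u x * ?D x h + (g x \<bullet> h) * \<phi> x)) (at x)"
      using deriv by eventually_elim (rule has_derivative_mult[OF _ C_1_has_derivative[OF C1]])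
    show "(\<lambda>x. u x * ?D x b + (g x \<bullet> b) * \<phi> x) \<in> borel_measurable borel"
      by (intro borel_measurable_add borel_measurable_times meas(1) m gm)
  qed
  then show "(LINT x|lborel. u x * ?D x b) = - (LINT x|lborel. (g x \<bullet> b) * \<phi> x)"
    using int by simp
qed

section \<open>The volume of the parallel bodies\<close>

context convex_body
begin

lemma vol_pos: "0 < vol K"
proof -
  have "\<not> negligible K" using convex interior_nonempty negligible_convex_interior by blast
  then show ?thesis
    using negligible_iff_measure0[OF lmeasurable_compact[OF compact]] by (simp add: less_le)
qed

text \<open>For \<open>t \<ge> 0\<close> the number \<open>V t\<close> is the volume of the parallel body at distance \<open>t\<close>. It is defined
  by Steiner's polynomial, which is differentiable on both sides of \<open>t = 0\<close>.\<close>

definition coeff :: "nat \<Rightarrow> real" where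
  "coeff = (SOME a. (\<forall>k. 0 \<le> a k) \<and> (\<forall>t\<ge>0. vol (K + cball 0 t) = (\<Sum>k\<le>DIM('a). a k * t ^ k))
     \<and> a 0 = vol K \<and> a DIM('a) = vol (ball (0::'a) 1))"

definition V :: "real \<Rightarrow> real" where "V t = (\<Sum>k\<le>DIM('a). coeff k * t ^ k)"

definition V' :: "real \<Rightarrow> real" where "V' t = (\<Sum>k\<le>DIM('a). coeff k * (real k * t ^ (k - 1)))"

lemma coeff: "0 \<le> coeff k" "0 \<le> t \<Longrightarrow> vol (K + cball 0 t) = V t" "coeff 0 = vol K"
  "coeff DIM('a) = vol (ball (0::'a) 1)"
proof -
  have "\<exists>a. (\<forall>k. 0 \<le> a k) \<and> (\<forall>t\<ge>0. vol (K + cball 0 t) = (\<Sum>k\<le>DIM('a). a k * t ^ k))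
     \<and> a 0 = vol K \<and> a DIM('a) = vol (ball (0::'a) 1)"
    using steiner[OF convex compact nonempty] by metis
  from someI_ex[OF this, folded coeff_def]
  show "0 \<le> coeff k" "0 \<le> t \<Longrightarrow> vol (K + cball 0 t) = V t" "coeff 0 = vol K"
    "coeff DIM('a) = vol (ball (0::'a) 1)" by (auto simp: V_def)
qed

lemma V_0: "V 0 = vol K"
proof -
  have "V 0 = coeff 0" unfolding V_def by (subst sum.remove[of _ 0]) (auto intro: sum.neutral)
  then show ?thesis by (simp add: coeff(3))
qed

lemma V_mono: "0 \<le> s \<Longrightarrow> s \<le> t \<Longrightarrow> V s \<le> V t"
  unfolding V_def using coeff(1) by (intro sum_mono mult_left_mono power_mono) auto

lemma V_pos: "0 \<le> t \<Longrightarrow> 0 < V t"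
  using V_mono[of 0 t] V_0 vol_pos by simp

lemma V_has_derivative: "(V has_real_derivative V' t) (at t)"
  unfolding V_def V'_def by (auto intro!: derivative_eq_intros DERIV_sum simp: ac_simps)

lemma V'_nonneg: "0 \<le> t \<Longrightarrow> 0 \<le> V' t"
  unfolding V'_def using coeff(1) by (intro sum_nonneg mult_nonneg_nonneg) auto

lemma V'_ge: "0 \<le> t \<Longrightarrow> V' 0 \<le> V' t"
  unfolding V'_def using coeff(1) by (intro sum_mono mult_left_mono) (auto intro: power_mono)

lemma V'_measurable [measurable]: "V' \<in> borel_measurable borel"
  unfolding V'_def by measurable

text \<open>Brunn--Minkowski applies because the convex combination of the parallel bodies at distances \<open>a\<close>
  and \<open>b\<close> is contained in the parallel body at distance \<open>(1 - l) a + l b\<close>.\<close>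

lemma V_root_concave:
  assumes ab: "0 \<le> a" "0 \<le> b" and l: "0 < l" "l < 1"
  shows "(1 - l) * V a powr (1 / DIM('a)) + l * V b powr (1 / DIM('a)) \<le> V ((1 - l) * a + l * b) powr (1 / DIM('a))"
proof -
  let ?K = "\<lambda>t. K + cball 0 t" and ?p = "1 / real DIM('a)"
  have K: "convex ((*\<^sub>R) c ` ?K t)" "compact ((*\<^sub>R) c ` ?K t)" for c t
    using convex compact by (auto intro!: convex_scaling compact_scaling convex_set_plus compact_set_plus)
  have vK: "vol ((*\<^sub>R) c ` ?K t) = c ^ DIM('a) * V t" if "0 < c" "0 \<le> t" for c t
    using that by (simp add: vol_scaleR coeff(2))
  have int: "interior ((*\<^sub>R) c ` ?K t) \<noteq> {}" if "0 < c" "0 \<le> t" for c t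
  proof
    assume "interior ((*\<^sub>R) c ` ?K t) = {}"
    then have "vol ((*\<^sub>R) c ` ?K t) = 0"
      using negligible_convex_interior[OF K(1)] negligible_imp_measure0 by blast
    then show False using vK[OF that] V_pos[OF that(2)] that by simp
  qed
  have root: "(c ^ DIM('a) * x) powr ?p = c * x powr ?p" if "0 < c" "0 \<le> x" for c x :: real
    using that by (simp add: powr_mult powr_realpow[symmetric] powr_powr)
  have "brunn_minkowski ((*\<^sub>R) (1 - l) ` ?K a) ((*\<^sub>R) l ` ?K b)"
    using ab l by (intro brunn_minkowski_convex K int) auto
  then have "(1 - l) * V a powr ?p + l * V b powr ?p \<le> vol ((*\<^sub>R) (1 - l) ` ?K a + (*\<^sub>R) l ` ?K b) powr ?p"
    using ab l V_pos by (simp add: brunn_minkowski_def vK root less_imp_le)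
  also have "\<dots> \<le> V ((1 - l) * a + l * b) powr ?p"
  proof (intro powr_mono2)
    have "(*\<^sub>R) (1 - l) ` ?K a + (*\<^sub>R) l ` ?K b \<subseteq> ?K ((1 - l) * a + l * b)"
    proof
      fix x assume "x \<in> (*\<^sub>R) (1 - l) ` ?K a + (*\<^sub>R) l ` ?K b"
      then obtain k z k' z' where x: "x = (1 - l) *\<^sub>R (k + z) + l *\<^sub>R (k' + z')"
        "k \<in> K" "k' \<in> K" "norm z \<le> a" "norm z' \<le> b"
        by (auto simp: set_plus_def)
      have "(1 - l) *\<^sub>R k + l *\<^sub>R k' \<in> K" using x l by (intro convexD[OF convex]) auto
      moreover have "(1 - l) *\<^sub>R z + l *\<^sub>R z' \<in> cball 0 ((1 - l) * a + l * b)"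
        using x l by (auto intro!: norm_triangle_le add_mono mult_left_mono)
      ultimately have "((1 - l) *\<^sub>R k + l *\<^sub>R k') + ((1 - l) *\<^sub>R z + l *\<^sub>R z') \<in> ?K ((1 - l) * a + l * b)"
        by (rule set_plus_intro)
      then show "x \<in> ?K ((1 - l) * a + l * b)" using x(1) by (simp add: scaleR_add_right ac_simps)
    qed
    then have "vol ((*\<^sub>R) (1 - l) ` ?K a + (*\<^sub>R) l ` ?K b) \<le> vol (?K ((1 - l) * a + l * b))"
      using K compact by (intro vol_mono compact_set_plus) auto
    then show "vol ((*\<^sub>R) (1 - l) ` ?K a + (*\<^sub>R) l ` ?K b) \<le> V ((1 - l) * a + l * b)"
      using ab l by (simp add: coeff(2))
  qed auto
  finally show ?thesis .
qed

lemma V_root_tangent: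
  assumes ab: "0 \<le> a" "0 \<le> b"
  shows "V b powr (1 / DIM('a)) - V a powr (1 / DIM('a))
    \<le> (1 / DIM('a)) * V a powr (1 / DIM('a) - 1) * V' a * (b - a)"
proof -
  let ?p = "1 / real DIM('a)"
  let ?f = "\<lambda>t. V t powr ?p"
  let ?g = "\<lambda>l. ?f (a + l * (b - a))"
  have "((\<lambda>t. V t powr ?p) has_real_derivative ?p * V a powr (?p - 1) * V' a) (at a)"
    using V_has_derivative[of a] V_pos[OF ab(1)] by (auto intro!: derivative_eq_intros)
  then have f: "(?f has_real_derivative ?p * V a powr (?p - 1) * V' a) (at (a + 0 * (b - a)))" by simp
  have "((\<lambda>l. a + l * (b - a)) has_real_derivative (b - a)) (at 0)"
    by (auto intro!: derivative_eq_intros)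
  from DERIV_chain2[OF f this]
  have "(?g has_real_derivative ?p * V a powr (?p - 1) * V' a * (b - a)) (at 0)" by simp
  then have "((\<lambda>l. (?g l - ?f a) / l) \<longlongrightarrow> ?p * V a powr (?p - 1) * V' a * (b - a)) (at 0)"
    by (simp add: has_field_derivative_iff)
  then have lim: "((\<lambda>l. (?g l - ?f a) / l) \<longlongrightarrow> ?p * V a powr (?p - 1) * V' a * (b - a)) (at_right 0)"
    by (rule filterlim_mono[OF _ order_refl]) (simp add: at_le)
  show ?thesis
  proof (rule tendsto_lowerbound[OF lim])
    show "\<forall>\<^sub>F l in at_right 0. ?f b - ?f a \<le> (?g l - ?f a) / l"
      using eventually_at_right_real[OF zero_less_one]
    proof eventually_elim
      case (elim l)
      then have l: "0 < l" "l < 1" by auto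
      have "(1 - l) * a + l * b = a + l * (b - a)" by (simp add: algebra_simps)
      with V_root_concave[OF ab l] have "(1 - l) * ?f a + l * ?f b \<le> ?g l" by simp
      then have "l * (?f b - ?f a) \<le> ?g l - ?f a" by (simp add: algebra_simps)
      then show ?case using l by (simp add: field_simps)
    qed
  qed simp
qed

text \<open>The derivative of the concave function \<open>V powr (1 / d)\<close> decreases; this bounds \<open>V' t\<close> in terms
  of \<open>V t\<close>. By concavity \<open>V t\<close> is in turn bounded in terms of the tangent at \<open>0\<close>.\<close>

lemma V'_le:
  assumes t: "0 \<le> t"
  shows "V' t \<le> V' 0 * (1 + t * V' 0 / (DIM('a) * vol K)) ^ (DIM('a) - 1)"
proof -
  let ?d = "real DIM('a)"
  define f where "f s = V s powr (1 / ?d)" for s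
  define f' where "f' s = (1 / ?d) * V s powr (1 / ?d - 1) * V' s" for s
  have d: "?d > 0" by simp
  have fpos: "f s > 0" if "0 \<le> s" for s using V_pos[OF that] by (simp add: f_def)
  have f'0: "0 \<le> f' s" if "0 \<le> s" for s using V'_nonneg[OF that] by (simp add: f'_def)
  have le1: "f t \<le> f 0 + t * f' 0" using V_root_tangent[of 0 t] t by (simp add: f_def f'_def ac_simps)
  have "t * f' t \<le> f t - f 0" using V_root_tangent[of t 0] t by (simp add: f_def f'_def algebra_simps)
  then have "t * f' t \<le> t * f' 0" using le1 by simp
  then have le2: "f' t \<le> f' 0" using t by (cases "t = 0") auto
  have fpow: "f s ^ (DIM('a) - 1) = V s powr (1 - 1 / ?d)" if "0 \<le> s" for s
  proof -
    have "f s ^ (DIM('a) - 1) = f s powr real (DIM('a) - 1)" using fpos[OF that] by (rule powr_realpow[symmetric])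
    also have "\<dots> = V s powr (1 / ?d * real (DIM('a) - 1))" by (simp only: f_def powr_powr)
    also have "1 / ?d * real (DIM('a) - 1) = 1 - 1 / ?d" by (simp add: of_nat_diff field_simps)
    finally show ?thesis .
  qed
  have V'eq: "V' s = ?d * f' s * f s ^ (DIM('a) - 1)" if "0 \<le> s" for s
  proof -
    have "V s powr (1 / ?d - 1) * V s powr (1 - 1 / ?d) = 1"
      using V_pos[OF that] by (simp add: powr_add[symmetric])
    then have "f' s * f s ^ (DIM('a) - 1) = 1 / ?d * V' s"
      unfolding f'_def fpow[OF that] by (simp add: ac_simps)
    then show ?thesis by (simp add: mult.assoc)
  qed
  have f0: "f' 0 = f 0 * (V' 0 / (?d * vol K))"
  proof -
    have "vol K powr (1 / ?d - 1) = vol K powr (1 / ?d) / vol K" using vol_pos by (simp add: powr_diff)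
    then show ?thesis by (simp add: f'_def f_def V_0)
  qed
  have "V' t = ?d * f' t * f t ^ (DIM('a) - 1)" by (rule V'eq[OF t])
  also have "\<dots> \<le> ?d * f' 0 * (f 0 + t * f' 0) ^ (DIM('a) - 1)"
    using le1 le2 fpos[OF t] f'0[of 0] f'0[OF t] by (intro mult_mono power_mono) auto
  also have "f 0 + t * f' 0 = f 0 * (1 + t * V' 0 / (?d * vol K))" by (simp add: f0 algebra_simps)
  also have "?d * f' 0 * (f 0 * (1 + t * V' 0 / (?d * vol K))) ^ (DIM('a) - 1)
      = V' 0 * (1 + t * V' 0 / (?d * vol K)) ^ (DIM('a) - 1)"
    using V'eq[of 0] by (simp add: power_mult_distrib)
  finally show ?thesis .
qed

lemma sublevel_closed: "closed {x. dist_K x \<le> t}"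
  by (intro closed_Collect_le continuous_dist_K continuous_on_const)

lemma emeasure_sublevel: "0 \<le> t \<Longrightarrow> emeasure lborel {x. dist_K x \<le> t} = ennreal (V t)"
proof -
  assume t: "0 \<le> t"
  have c: "compact {x. dist_K x \<le> t}" unfolding parallel_eq[OF t] using compact by (intro compact_set_plus) auto
  then have "emeasure lborel {x. dist_K x \<le> t} = ennreal (measure lborel {x. dist_K x \<le> t})"
    using emeasure_compact_finite by (intro emeasure_eq_ennreal_measure) (auto simp: less_top)
  also have "measure lborel {x. dist_K x \<le> t} = vol {x. dist_K x \<le> t}"
    using c by (simp add: borel_compact)
  finally show ?thesis using coeff(2)[OF t] parallel_eq[OF t] by simp
qed

lemma emeasure_shell:
  assumes "0 \<le> s" "s \<le> t"
  shows "emeasure lborel {x. s < dist_K x \<and> dist_K x \<le> t} = ennreal (V t - V s)"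
proof -
  have "{x. s < dist_K x \<and> dist_K x \<le> t} = {x. dist_K x \<le> t} - {x. dist_K x \<le> s}" by auto
  also have "emeasure lborel \<dots> = emeasure lborel {x. dist_K x \<le> t} - emeasure lborel {x. dist_K x \<le> s}"
    using assms sublevel_closed by (intro emeasure_Diff) (auto simp: emeasure_sublevel)
  also have "\<dots> = ennreal (V t - V s)"
    using assms V_pos[of s] by (simp add: emeasure_sublevel ennreal_minus less_imp_le)
  finally show ?thesis .
qed

lemma nn_integral_V':
  assumes "0 \<le> s" "s \<le> t"
  shows "(\<integral>\<^sup>+x. ennreal (V' x) * indicator {s<..t} x \<partial>lborel) = ennreal (V t - V s)"
proof -
  have "(\<integral>\<^sup>+x. ennreal (V' x) * indicator {s<..t} x \<partial>lborel) = (\<integral>\<^sup>+x. ennreal (V' x) * indicator {s..t} x \<partial>lborel)"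
    by (rule nn_integral_cong_AE) (use AE_lborel_singleton[of s] in \<open>eventually_elim, auto simp: indicator_def\<close>)
  also have "\<dots> = ennreal (V t - V s)"
    using assms by (intro nn_integral_FTC_Icc) (auto intro: V'_nonneg has_field_derivative_at_within[OF V_has_derivative])
  finally show ?thesis .
qed

text \<open>The image of Lebesgue measure on the shell under the distance function has density \<open>V'\<close>,
  because the two measures agree on half-lines.\<close>

lemma nn_integral_dist_bounded:
  assumes [measurable]: "F \<in> borel_measurable borel" and T: "0 \<le> T"
  shows "(\<integral>\<^sup>+x. F (dist_K x) * indicator {0<..T} (dist_K x) \<partial>lborel)
    = (\<integral>\<^sup>+t. F t * indicator {0<..T} t * ennreal (V' t) \<partial>lborel)"
proof -
  let ?M = "density lborel (\<lambda>x. indicator {0<..T} (dist_K x) :: ennreal)"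
  let ?M1 = "distr ?M borel (\<lambda>x. dist_K x)"
  let ?M2 = "density lborel (\<lambda>t. ennreal (V' t) * indicator {0<..T} t)"
  have 1: "emeasure ?M1 {s<..} = (if s \<le> T then ennreal (V T - V (max s 0)) else 0)" for s
  proof -
    have "emeasure ?M1 {s<..} = emeasure ?M {x. s < dist_K x}"
      by (subst emeasure_distr) (auto simp: vimage_def)
    also have "\<dots> = (\<integral>\<^sup>+x. indicator {0<..T} (dist_K x) * indicator {x. s < dist_K x} x \<partial>lborel)"
      by (subst emeasure_density) auto
    also have "\<dots> = (\<integral>\<^sup>+x. indicator {x. max s 0 < dist_K x \<and> dist_K x \<le> T} x \<partial>lborel)"
      by (intro nn_integral_cong) (auto simp: indicator_def)
    also have "\<dots> = emeasure lborel {x. max s 0 < dist_K x \<and> dist_K x \<le> T}"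
      by (rule nn_integral_indicator) measurable
    finally have "emeasure ?M1 {s<..} = emeasure lborel {x. max s 0 < dist_K x \<and> dist_K x \<le> T}" .
    moreover have "emeasure lborel {x. max s 0 < dist_K x \<and> dist_K x \<le> T} = 0" if "\<not> s \<le> T"
    proof -
      have "{x. max s 0 < dist_K x \<and> dist_K x \<le> T} = {}" using that by auto
      then show ?thesis by (simp only: emeasure_empty)
    qed
    ultimately show ?thesis using emeasure_shell[of "max s 0" T] T by (auto simp del: max_less_iff_conj)
  qed
  have 2: "emeasure ?M2 {s<..} = (if s \<le> T then ennreal (V T - V (max s 0)) else 0)" for s
  proof -
    have "emeasure ?M2 {s<..} = (\<integral>\<^sup>+x. ennreal (V' x) * indicator {max s 0<..T} x \<partial>lborel)"
      by (simp add: emeasure_density) (auto intro!: nn_integral_cong simp: indicator_def)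
    then show ?thesis using nn_integral_V'[of "max s 0" T] T by (auto simp: max_def)
  qed
  have "?M1 = ?M2"
    by (rule measure_eqI_lessThan) (simp_all add: 1 2)
  then have "(\<integral>\<^sup>+t. F t \<partial>?M1) = (\<integral>\<^sup>+t. F t \<partial>?M2)" by simp
  moreover have "(\<integral>\<^sup>+t. F t \<partial>?M1) = (\<integral>\<^sup>+x. F (dist_K x) * indicator {0<..T} (dist_K x) \<partial>lborel)"
    by (subst nn_integral_distr, simp, simp) (subst nn_integral_density, auto simp: ac_simps)
  moreover have "(\<integral>\<^sup>+t. F t \<partial>?M2) = (\<integral>\<^sup>+t. F t * indicator {0<..T} t * ennreal (V' t) \<partial>lborel)"
    by (subst nn_integral_density) (auto simp: ac_simps)
  ultimately show ?thesis by simp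
qed

lemma nn_integral_dist:
  assumes [measurable]: "F \<in> borel_measurable borel"
  shows "(\<integral>\<^sup>+x. F (dist_K x) * indicator (- K) x \<partial>lborel)
    = (\<integral>\<^sup>+t. F t * indicator {0<..} t * ennreal (V' t) \<partial>lborel)"
proof -
  have sup: "(SUP n. G * indicator {0<..real n} t) = G * indicator {0<..} t" for G :: ennreal and t :: real
  proof -
    have "(SUP n. indicator {0<..real n} t :: ennreal) = indicator {0<..} t"
    proof (rule antisym)
      show "(SUP n. indicator {0<..real n} t :: ennreal) \<le> indicator {0<..} t"
        by (rule SUP_least) (auto simp: indicator_def)
      obtain n where "t \<le> real n" using real_arch_simple by blast
      then have "(indicator {0<..} t :: ennreal) \<le> indicator {0<..real n} t" by (auto simp: indicator_def)
      then show "(indicator {0<..} t :: ennreal) \<le> (SUP n. indicator {0<..real n} t)"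
        by (rule SUP_upper2[OF UNIV_I])
    qed
    then show ?thesis by (simp add: SUP_mult_left_ennreal[symmetric])
  qed
  have "(\<integral>\<^sup>+x. F (dist_K x) * indicator (- K) x \<partial>lborel) = (\<integral>\<^sup>+x. (SUP n. F (dist_K x) * indicator {0<..real n} (dist_K x)) \<partial>lborel)"
    unfolding sup using dist_K_pos_iff by (intro nn_integral_cong) (auto simp: indicator_def)
  also have "\<dots> = (SUP n. \<integral>\<^sup>+x. F (dist_K x) * indicator {0<..real n} (dist_K x) \<partial>lborel)"
    by (rule nn_integral_monotone_convergence_SUP)
      (auto simp: incseq_def le_fun_def indicator_def intro!: mult_left_mono)
  also have "\<dots> = (SUP n. \<integral>\<^sup>+t. F t * ennreal (V' t) * indicator {0<..real n} t \<partial>lborel)"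
    by (simp add: nn_integral_dist_bounded ac_simps)
  also have "\<dots> = (\<integral>\<^sup>+t. (SUP n. F t * ennreal (V' t) * indicator {0<..real n} t) \<partial>lborel)"
    by (rule nn_integral_monotone_convergence_SUP[symmetric])
      (auto simp: incseq_def le_fun_def indicator_def intro!: mult_left_mono)
  also have "\<dots> = (\<integral>\<^sup>+t. F t * indicator {0<..} t * ennreal (V' t) \<partial>lborel)"
    unfolding sup by (simp add: ac_simps)
  finally show ?thesis .
qed

end

section \<open>Smooth maxima of affine functions\<close>

lemma C_1_I:
  assumes d: "\<And>x. (f has_derivative f' x) (at x)"
    and c: "\<And>b. b \<in> Basis \<Longrightarrow> continuous_on UNIV (\<lambda>x. f' x b)"
  shows "C_k 1 f"
proof -
  have "frechet_derivative f (at x) = f' x" for x using frechet_derivative_at[OF d] by simp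
  then show ?thesis using d c by (auto simp: differentiable_on_def differentiable_def)
qed

lemma compactly_supported_I:
  fixes f :: "'a::euclidean_space \<Rightarrow> 'b::real_normed_vector"
  assumes "\<And>x. r < norm x \<Longrightarrow> f x = 0"
  shows "compactly_supported f"
  unfolding compactly_supported_def
proof (rule bounded_closure[THEN compact_eq_bounded_closed[THEN iffD2, OF conjI]])
  show "bounded {x. f x \<noteq> 0}"
    unfolding bounded_iff using assms by (metis (mono_tags) mem_Collect_eq not_le)
qed simp

lemma C_1_compact_support_Lipschitz:
  fixes f :: "'a::euclidean_space \<Rightarrow> 'b::real_normed_vector"
  assumes "C_k 1 f" "compactly_supported f"
  shows "\<exists>M. \<forall>x y. norm (f x - f y) \<le> M * norm (x - y)"
proof (rule C_1_compact_support_bounds[OF assms])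
  fix M assume "\<And>x y. norm (f x - f y) \<le> M * norm (x - y)"
  then show ?thesis by blast
qed

lemma integrable_continuous_compact_support:
  fixes f :: "'a::euclidean_space \<Rightarrow> real"
  assumes c: "continuous_on UNIV f" and s: "\<And>x. r < norm x \<Longrightarrow> f x = 0"
  shows "integrable lborel f"
proof -
  have "bounded (f ` cball 0 r)"
    by (intro compact_imp_bounded compact_continuous_image continuous_on_subset[OF c]) auto
  then obtain M where M: "\<And>x. x \<in> cball 0 r \<Longrightarrow> norm (f x) \<le> M" unfolding bounded_iff by (metis imageI)
  show ?thesis
  proof (rule integrable_bounded_compact_support)
    show "f \<in> borel_measurable borel" using c by (rule borel_measurable_continuous_onI)
    show "bounded (cball (0::'a) r)" by simp
    show "f x = 0" if "x \<notin> cball 0 r" for x using s that by simp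
    show "norm (f x) \<le> max M 0" for x
    proof (cases "x \<in> cball 0 r")
      case True
      then show ?thesis using M[OF True] by linarith
    qed (use s in simp)
  qed
qed

lemma pos_part_square_has_derivative:
  "((\<lambda>x::real. (max 0 x)\<^sup>2) has_real_derivative 2 * max 0 x) (at x)"
proof -
  consider "x < 0" | "x = 0" | "0 < x" by linarith
  then show ?thesis
  proof cases
    case 1
    then have "((\<lambda>x::real. 0) has_real_derivative 2 * max 0 x) (at x)" by simp
    then show ?thesis
      by (rule has_field_derivative_transform_within_open[of _ _ _ "{..<0}"]) (use 1 in auto)
  next
    case 2
    have "((\<lambda>h::real. (max 0 h)\<^sup>2 / h) \<longlongrightarrow> 0) (at 0)"
    proof (rule Lim_null_comparison)
      show "\<forall>\<^sub>F h::real in at 0. norm ((max 0 h)\<^sup>2 / h) \<le> \<bar>h\<bar>"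
        by (intro always_eventually allI) (auto simp: max_def power2_eq_square)
      show "((\<lambda>h::real. \<bar>h\<bar>) \<longlongrightarrow> 0) (at 0)" by (intro tendsto_rabs_zero tendsto_ident_at)
    qed
    then show ?thesis using 2 by (simp add: has_field_derivative_iff)
  next
    case 3
    then have "((\<lambda>x::real. x\<^sup>2) has_real_derivative 2 * max 0 x) (at x)"
      by (auto intro!: derivative_eq_intros)
    then show ?thesis
      by (rule has_field_derivative_transform_within_open[of _ _ _ "{0<..}"]) (use 3 in auto)
  qed
qed

text \<open>The squared positive parts make the function continuously differentiable, with derivative
  \<open>cutoff'\<close>. It is \<open>1\<close> where \<open>x \<bullet> x \<le> a\<close> and \<open>0\<close> where \<open>x \<bullet> x \<ge> a + 1\<close>.\<close>

definition cutoff :: "real \<Rightarrow> 'a::euclidean_space \<Rightarrow> real" where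
  "cutoff a x = (max 0 (1 - (max 0 (x \<bullet> x - a))\<^sup>2))\<^sup>2"

definition cutoff' :: "real \<Rightarrow> 'a::euclidean_space \<Rightarrow> 'a \<Rightarrow> real" where
  "cutoff' a x h = - (8 * max 0 (1 - (max 0 (x \<bullet> x - a))\<^sup>2) * max 0 (x \<bullet> x - a)) * (x \<bullet> h)"

lemma cutoff_has_derivative: "(cutoff a has_derivative cutoff' a x) (at x)"
proof -
  have 1: "((\<lambda>x::'a. x \<bullet> x - a) has_derivative (\<lambda>h. 2 * (x \<bullet> h))) (at x)"
    by (auto intro!: derivative_eq_intros simp: inner_commute)
  have 2: "((\<lambda>x::'a. (max 0 (x \<bullet> x - a))\<^sup>2) has_derivative (\<lambda>h. 2 * max 0 (x \<bullet> x - a) * (2 * (x \<bullet> h)))) (at x)"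
    using has_derivative_compose[OF 1 pos_part_square_has_derivative[unfolded has_field_derivative_def]] by simp
  have 3: "((\<lambda>x::'a. 1 - (max 0 (x \<bullet> x - a))\<^sup>2) has_derivative (\<lambda>h. - (2 * max 0 (x \<bullet> x - a) * (2 * (x \<bullet> h))))) (at x)"
    using has_derivative_diff[OF has_derivative_const 2, of 1] by simp
  from has_derivative_compose[OF 3 pos_part_square_has_derivative[unfolded has_field_derivative_def]]
  have "(cutoff a has_derivative (\<lambda>h. 2 * max 0 (1 - (max 0 (x \<bullet> x - a))\<^sup>2) * - (2 * max 0 (x \<bullet> x - a) * (2 * (x \<bullet> h))))) (at x)"
    by (simp add: cutoff_def[abs_def])
  then show ?thesis by (rule has_derivative_eq_rhs) (simp add: cutoff'_def fun_eq_iff)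
qed

lemma cutoff_bounds: "0 \<le> cutoff a x" "cutoff a x \<le> 1"
proof -
  have "max 0 (1 - (max 0 (x \<bullet> x - a))\<^sup>2) \<le> 1" by simp
  then show "0 \<le> cutoff a x" "cutoff a x \<le> 1" unfolding cutoff_def by (auto intro!: power_le_one)
qed

lemma cutoff_inside: "x \<bullet> x \<le> a \<Longrightarrow> cutoff a x = 1" "x \<bullet> x \<le> a \<Longrightarrow> cutoff' a x h = 0"
  by (simp_all add: cutoff_def cutoff'_def)

lemma cutoff_outside:
  assumes "a + 1 \<le> x \<bullet> x" shows "cutoff a x = 0"
proof -
  have "1 \<le> (max 0 (x \<bullet> x - a))\<^sup>2" using assms by (intro one_le_power) auto
  then show ?thesis by (simp add: cutoff_def)
qed

lemma continuous_cutoff: "continuous_on S (cutoff a)" "continuous_on S (\<lambda>x. cutoff' a x h)"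
  unfolding cutoff_def cutoff'_def by (intro continuous_intros)+

text \<open>The function \<open>psi\<close> is a smooth substitute for the maximum of finitely many affine
  functions with slopes in the unit ball. Its gradient \<open>G\<close> is a convex combination of the slopes.\<close>

locale log_sum_exp =
  fixes N :: "'a::euclidean_space set" and h :: "'a \<Rightarrow> real" and k :: real
  assumes N: "finite N" "N \<noteq> {}" "N \<subseteq> cball 0 1" and k: "0 < k"
begin

definition E :: "'a \<Rightarrow> 'a \<Rightarrow> real" where "E m x = exp (k * (m \<bullet> x - h m))"
definition S :: "'a \<Rightarrow> real" where "S x = (\<Sum>m\<in>N. E m x)"
definition psi :: "'a \<Rightarrow> real" where "psi x = ln (S x) / k"
definition weight :: "'a \<Rightarrow> 'a \<Rightarrow> real" where "weight m x = E m x / S x"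
definition G :: "'a \<Rightarrow> 'a" where "G x = (\<Sum>m\<in>N. weight m x *\<^sub>R m)"
definition G' :: "'a \<Rightarrow> 'a \<Rightarrow> 'a" where
  "G' x v = (\<Sum>m\<in>N. (k * weight m x * ((m - G x) \<bullet> v)) *\<^sub>R m)"
definition div_G :: "'a \<Rightarrow> real" where "div_G x = k * (\<Sum>m\<in>N. weight m x * (norm (m - G x))\<^sup>2)"

lemma E_pos: "0 < E m x" by (simp add: E_def)

lemma S_pos: "0 < S x" unfolding S_def using N E_pos by (intro sum_pos) auto

lemma weight_pos: "0 < weight m x" using E_pos S_pos by (simp add: weight_def)

lemma sum_weight: "(\<Sum>m\<in>N. weight m x) = 1"
  using S_pos[of x] by (simp add: weight_def sum_divide_distrib[symmetric] S_def[symmetric])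

lemma norm_G: "norm (G x) \<le> 1"
proof -
  have "norm (G x) \<le> (\<Sum>m\<in>N. weight m x)" unfolding G_def
    using N weight_pos by (intro sum_norm_le) (auto simp: less_imp_le mult_left_le subset_iff)
  then show ?thesis by (simp add: sum_weight)
qed

lemma E_has_derivative: "(E m has_derivative (\<lambda>v. k * E m x * (m \<bullet> v))) (at x)"
  unfolding E_def[abs_def] by (auto intro!: derivative_eq_intros simp: fun_eq_iff)

lemma inner_G: "k * S x * (G x \<bullet> v) = (\<Sum>m\<in>N. k * E m x * (m \<bullet> v))"
  using S_pos[of x] by (simp add: G_def weight_def inner_sum_left sum_distrib_left mult.assoc)

lemma S_has_derivative: "(S has_derivative (\<lambda>v. k * S x * (G x \<bullet> v))) (at x)"
proof -
  have "((\<lambda>x. \<Sum>m\<in>N. E m x) has_derivative (\<lambda>v. \<Sum>m\<in>N. k * E m x * (m \<bullet> v))) (at x)"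
    by (intro has_derivative_sum E_has_derivative)
  moreover have "S = (\<lambda>x. \<Sum>m\<in>N. E m x)" by (simp add: fun_eq_iff S_def)
  ultimately show ?thesis unfolding inner_G by (simp only:)
qed

lemma psi_has_derivative: "(psi has_derivative (\<lambda>v. G x \<bullet> v)) (at x)"
proof -
  have "(ln has_derivative (*) (1 / S x)) (at (S x))"
    using DERIV_ln_divide[OF S_pos[of x]] by (simp add: has_field_derivative_def)
  from has_derivative_compose[OF S_has_derivative this]
  have "((\<lambda>x. ln (S x)) has_derivative (\<lambda>v. k * (G x \<bullet> v))) (at x)"
    using S_pos[of x] by simp
  from has_derivative_mult_left[OF this, of "1 / k"] show ?thesis
    using k by (simp add: psi_def[abs_def] mult.commute)
qed

lemma weight_has_derivative: "(weight m has_derivative (\<lambda>v. k * weight m x * ((m - G x) \<bullet> v))) (at x)"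
proof -
  have "((\<lambda>x. E m x / S x) has_derivative
      (\<lambda>v. - E m x * (inverse (S x) * (k * S x * (G x \<bullet> v)) * inverse (S x)) + k * E m x * (m \<bullet> v) / S x)) (at x)"
    by (rule has_derivative_divide[OF E_has_derivative S_has_derivative]) (use S_pos[of x] in simp)
  then show ?thesis unfolding weight_def[abs_def]
    by (rule has_derivative_eq_rhs) (use S_pos[of x] in \<open>simp add: fun_eq_iff field_simps inner_diff_left\<close>)
qed

lemma G_has_derivative: "(G has_derivative G' x) (at x)"
proof -
  have "((\<lambda>x. \<Sum>m\<in>N. weight m x *\<^sub>R m) has_derivative (\<lambda>v. \<Sum>m\<in>N. (k * weight m x * ((m - G x) \<bullet> v)) *\<^sub>R m)) (at x)"
    by (intro has_derivative_sum has_derivative_scaleR_left weight_has_derivative)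
  then show ?thesis by (simp add: G_def[abs_def] G'_def[abs_def])
qed

lemma continuous_weight: "continuous_on T (weight m)"
  using has_derivative_continuous[OF weight_has_derivative] by (simp add: continuous_at_imp_continuous_on)

lemma continuous_psi: "continuous_on T psi"
  using has_derivative_continuous[OF psi_has_derivative] by (simp add: continuous_at_imp_continuous_on)

lemma continuous_G: "continuous_on T G"
  using has_derivative_continuous[OF G_has_derivative] by (simp add: continuous_at_imp_continuous_on)

lemma continuous_G': "continuous_on T (\<lambda>x. G' x v)"
  unfolding G'_def by (intro continuous_intros continuous_weight continuous_G)

lemma continuous_div_G: "continuous_on T div_G"
  unfolding div_G_def by (intro continuous_intros continuous_weight continuous_G)

lemma div_G_nonneg: "0 \<le> div_G x"
  unfolding div_G_def using k weight_pos by (intro mult_nonneg_nonneg sum_nonneg) (auto intro: less_imp_le)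

text \<open>The divergence is \<open>k\<close> times the variance of the slopes under the weights, hence nonnegative.\<close>

lemma div_G_eq: "(\<Sum>b\<in>Basis. G' x b \<bullet> b) = div_G x"
proof -
  have "(\<Sum>b\<in>Basis. G' x b \<bullet> b) = (\<Sum>b\<in>Basis. \<Sum>m\<in>N. k * weight m x * (((m - G x) \<bullet> b) * (m \<bullet> b)))"
    by (simp add: G'_def inner_sum_left mult.assoc)
  also have "\<dots> = (\<Sum>m\<in>N. k * weight m x * ((m - G x) \<bullet> m))"
    by (subst sum.swap) (simp only: sum_distrib_left[symmetric] euclidean_inner[symmetric])
  also have "\<dots> = (\<Sum>m\<in>N. k * weight m x * ((m - G x) \<bullet> (m - G x))) + k * ((\<Sum>m\<in>N. weight m x *\<^sub>R (m - G x)) \<bullet> G x)"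
    by (simp add: inner_sum_left sum_distrib_left sum.distrib[symmetric] inner_diff_right algebra_simps)
  also have "(\<Sum>m\<in>N. weight m x *\<^sub>R (m - G x)) = 0"
    by (simp add: scaleR_diff_right sum_subtractf G_def[symmetric] scaleR_sum_left[symmetric] sum_weight)
  finally show ?thesis by (simp add: div_G_def sum_distrib_left dot_square_norm mult.assoc)
qed

text \<open>Jensen's inequality for the exponential function\<close>

lemma psi_tangent: "G x \<bullet> (y - x) \<le> psi y - psi x"
proof -
  have E: "E m y = E m x * exp (k * (m \<bullet> (y - x)))" for m
    by (simp add: E_def exp_add[symmetric] inner_diff_right algebra_simps)
  have "exp (\<Sum>m\<in>N. weight m x *\<^sub>R (k * (m \<bullet> (y - x)))) \<le> (\<Sum>m\<in>N. weight m x * exp (k * (m \<bullet> (y - x))))"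
    using N weight_pos sum_weight by (intro convex_on_sum[OF _ _ exp_convex]) (auto intro: less_imp_le)
  also have "(\<Sum>m\<in>N. weight m x *\<^sub>R (k * (m \<bullet> (y - x)))) = k * (G x \<bullet> (y - x))"
    by (simp add: G_def inner_sum_left sum_distrib_left ac_simps)
  also have "(\<Sum>m\<in>N. weight m x * exp (k * (m \<bullet> (y - x)))) = S y / S x"
    by (simp add: S_def E weight_def sum_divide_distrib)
  finally have "k * (G x \<bullet> (y - x)) \<le> ln (S y / S x)"
    using S_pos by (subst ln_ge_iff) (auto intro: divide_pos_pos)
  also have "\<dots> = ln (S y) - ln (S x)" using S_pos by (simp add: ln_div less_imp_neq[symmetric])
  finally show ?thesis using k by (simp add: psi_def field_simps)
qed

lemma psi_ge: "m \<in> N \<Longrightarrow> m \<bullet> x - h m \<le> psi x"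
proof -
  assume m: "m \<in> N"
  have "E m x \<le> S x" unfolding S_def using m N E_pos by (intro member_le_sum) (auto intro: less_imp_le)
  then have "k * (m \<bullet> x - h m) \<le> ln (S x)" using S_pos by (subst ln_ge_iff) (auto simp: E_def)
  then show ?thesis using k by (simp add: psi_def field_simps)
qed

lemma psi_le:
  assumes "\<And>m. m \<in> N \<Longrightarrow> m \<bullet> x - h m \<le> c"
  shows "psi x \<le> c + ln (card N) / k"
proof -
  have "S x \<le> (\<Sum>m\<in>N. exp (k * c))"
    unfolding S_def E_def using assms k by (intro sum_mono) (auto intro: mult_left_mono)
  also have "\<dots> = card N * exp (k * c)" by simp
  finally have "ln (S x) \<le> ln (card N * exp (k * c))" using S_pos[of x] by (intro ln_mono) auto
  also have "\<dots> = ln (card N) + k * c" using N by (subst ln_mult) (auto simp: card_gt_0_iff)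
  finally show ?thesis using k by (simp add: psi_def field_simps)
qed

text \<open>Integration by parts for the field \<open>\<beta>(psi) G\<close> with \<open>\<beta> s = (max 0 (T - s))\<^sup>2\<close>\<close>

lemma integral_div_G:
  assumes bd: "\<And>x. r < norm x \<Longrightarrow> T \<le> psi x"
  shows "integrable lborel (\<lambda>x. (max 0 (T - psi x))\<^sup>2 * div_G x)"
    "integrable lborel (\<lambda>x. max 0 (T - psi x) * (norm (G x))\<^sup>2)"
    "(LINT x|lborel. (max 0 (T - psi x))\<^sup>2 * div_G x) = 2 * (LINT x|lborel. max 0 (T - psi x) * (norm (G x))\<^sup>2)"
proof -
  let ?q = "\<lambda>x. max 0 (T - psi x)"
  have q0: "?q x = 0" if "r < norm x" for x using bd[OF that] by simp
  have cq: "continuous_on UNIV ?q" by (intro continuous_intros continuous_psi)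
  show int1: "integrable lborel (\<lambda>x. (?q x)\<^sup>2 * div_G x)"
    by (rule integrable_continuous_compact_support[of _ r])
      (intro continuous_intros cq continuous_div_G, simp add: q0)
  show int2: "integrable lborel (\<lambda>x. ?q x * (norm (G x))\<^sup>2)"
    by (rule integrable_continuous_compact_support[of _ r])
      (intro continuous_intros cq continuous_G, simp add: q0)
  define D where "D b x v = 2 * ?q x * - (G x \<bullet> v) * (G x \<bullet> b) + (?q x)\<^sup>2 * (G' x v \<bullet> b)" for b x v
  have parts: "integrable lborel (\<lambda>x. D b x b) \<and> (LINT x|lborel. D b x b) = 0" if b: "b \<in> Basis" for b
  proof -
    define w where "w x = (?q x)\<^sup>2 * (G x \<bullet> b)" for x
    have der: "(w has_derivative D b x) (at x)" for x
    proof -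
      have "((\<lambda>x. T - psi x) has_derivative (\<lambda>v. - (G x \<bullet> v))) (at x)"
        using has_derivative_diff[OF has_derivative_const psi_has_derivative, of T] by simp
      from has_derivative_compose[OF this pos_part_square_has_derivative[unfolded has_field_derivative_def]]
      have 1: "((\<lambda>x. (?q x)\<^sup>2) has_derivative (\<lambda>v. 2 * ?q x * - (G x \<bullet> v))) (at x)" by simp
      have 2: "((\<lambda>x. G x \<bullet> b) has_derivative (\<lambda>v. G' x v \<bullet> b)) (at x)"
        by (rule has_derivative_inner_left[OF G_has_derivative])
      show ?thesis unfolding D_def w_def[abs_def]
        by (rule has_derivative_eq_rhs[OF has_derivative_mult[OF 1 2]]) (simp add: fun_eq_iff)
    qed
    have cD: "continuous_on UNIV (\<lambda>x. D b x v)" for v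
      unfolding D_def by (intro continuous_intros cq continuous_G continuous_G')
    have w0: "w x = 0" if "r < norm x" for x using q0[OF that] by (simp add: w_def)
    have C1: "C_k 1 w" by (rule C_1_I[OF der cD])
    have cs: "compactly_supported w" using w0 by (rule compactly_supported_I)
    obtain M where M: "\<forall>x y. norm (w x - w y) \<le> M * norm (x - y)"
      using C_1_compact_support_Lipschitz[OF C1 cs] ..
    show ?thesis
    proof (intro conjI; rule integral_directional_derivative_eq_0[of "cball 0 r" w M "D b"])
      show "w x = 0" if "x \<notin> cball 0 r" for x using w0 that by simp
      show "w x = 0" if "x \<notin> cball 0 r" for x using w0 that by simp
      show "\<bar>w x - w y\<bar> \<le> M * norm (x - y)" for x y using M by simp
      show "\<bar>w x - w y\<bar> \<le> M * norm (x - y)" for x y using M by simp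
      show "(\<lambda>x. D b x b) \<in> borel_measurable borel" using cD by (rule borel_measurable_continuous_onI)
      show "(\<lambda>x. D b x b) \<in> borel_measurable borel" using cD by (rule borel_measurable_continuous_onI)
    qed (use der in auto)
  qed
  have sum: "(\<Sum>b\<in>Basis. D b x b) = (?q x)\<^sup>2 * div_G x - 2 * (?q x * (norm (G x))\<^sup>2)" for x
  proof -
    have "(\<Sum>b\<in>Basis. D b x b) = (?q x)\<^sup>2 * (\<Sum>b\<in>Basis. G' x b \<bullet> b) - 2 * (?q x * (\<Sum>b\<in>Basis. (G x \<bullet> b) * (G x \<bullet> b)))"
      by (simp add: D_def sum.distrib sum_distrib_left sum_negf mult.assoc sum_subtractf)
    then show ?thesis by (simp add: div_G_eq euclidean_inner[symmetric] dot_square_norm)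
  qed
  have "0 = (\<Sum>b\<in>Basis. LINT x|lborel. D b x b)" using parts by simp
  also have "\<dots> = (LINT x|lborel. (\<Sum>b\<in>Basis. D b x b))"
    using parts by (intro Bochner_Integration.integral_sum[symmetric]) auto
  also have "\<dots> = (LINT x|lborel. (?q x)\<^sup>2 * div_G x) - 2 * (LINT x|lborel. ?q x * (norm (G x))\<^sup>2)"
    unfolding sum using int1 int2 by simp
  finally show "(LINT x|lborel. (?q x)\<^sup>2 * div_G x) = 2 * (LINT x|lborel. ?q x * (norm (G x))\<^sup>2)" by simp
qed

text \<open>Cutting \<open>G\<close> off outside a ball makes it admissible in the definition of the perimeter.\<close>

lemma integral_div_G_le_perimeter:
  assumes K: "compact K"
  shows "ereal (LINT x:K|lborel. div_G x) \<le> perimeter K"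
proof -
  obtain r where r: "\<And>x. x \<in> K \<Longrightarrow> norm x \<le> r" using compact_imp_bounded[OF K] by (auto simp: bounded_iff)
  let ?c = "cutoff (r\<^sup>2)"
  define phi where "phi x = ?c x *\<^sub>R G x" for x
  define D where "D x v = ?c x *\<^sub>R G' x v + cutoff' (r\<^sup>2) x v *\<^sub>R G x" for x v
  have der: "(phi has_derivative D x) (at x)" for x
    unfolding phi_def[abs_def] D_def[abs_def] by (rule has_derivative_scaleR[OF cutoff_has_derivative G_has_derivative])
  have "C_k 1 phi"
    by (rule C_1_I[OF der]) (unfold D_def, intro continuous_intros continuous_cutoff continuous_G continuous_G')
  moreover have "compactly_supported phi"
  proof (rule compactly_supported_I)
    fix x :: 'a assume x: "\<bar>r\<bar> + 1 < norm x"
    have "r\<^sup>2 + 1 \<le> (\<bar>r\<bar> + 1)\<^sup>2" by (simp add: power2_sum)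
    also have "\<dots> \<le> (norm x)\<^sup>2" using x by (intro power_mono) auto
    finally show "phi x = 0" by (simp add: phi_def cutoff_outside dot_square_norm)
  qed
  moreover have "norm (phi x) \<le> 1" for x
    using cutoff_bounds[of "r\<^sup>2" x] norm_G[of x] by (simp add: phi_def mult_le_one)
  ultimately have "ereal (LINT x:K|lborel. divergence phi x) \<le> perimeter K"
    unfolding perimeter_def by (intro SUP_upper) auto
  moreover have "divergence phi x = div_G x" if "x \<in> K" for x
  proof -
    have "x \<bullet> x \<le> r\<^sup>2" using r[OF that] by (simp add: dot_square_norm power_mono)
    moreover have "frechet_derivative phi (at x) = D x" using frechet_derivative_at[OF der] by simp
    ultimately show ?thesis
      by (simp add: divergence_def D_def cutoff_inside div_G_eq)
  qed
  then have "(LINT x:K|lborel. divergence phi x) = (LINT x:K|lborel. div_G x)"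
    unfolding set_lebesgue_integral_def
    by (intro Bochner_Integration.integral_cong) (auto simp: indicator_def)
  ultimately show ?thesis by simp
qed

end

section \<open>The perimeter bounds the initial growth of volume\<close>

context convex_body
begin

lemma support_point: "\<exists>y\<in>K. \<forall>z\<in>K. m \<bullet> z \<le> m \<bullet> y"
proof -
  have "continuous_on K (\<lambda>z. m \<bullet> z)" by (intro continuous_intros)
  from continuous_attains_sup[OF compact nonempty this] show ?thesis by blast
qed

lemma net_cball:
  assumes "0 < e"
  shows "\<exists>N. finite N \<and> N \<subseteq> cball (0::'a) 1 \<and> 0 \<in> N \<and> (\<forall>n\<in>cball 0 1. \<exists>m\<in>N. norm (n - m) \<le> e)"
proof -
  obtain D where D: "D \<subseteq> cball (0::'a) 1" "finite D" "cball 0 1 \<subseteq> (\<Union>x\<in>D. ball x e)"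
    using compactE_image[OF compact_cball[of "0::'a" 1], of "cball 0 1" "\<lambda>x. ball x e"] assms by force
  have "\<exists>m\<in>insert 0 D. norm (n - m) \<le> e" if "n \<in> cball 0 1" for n
    using D(3) that by (force simp: dist_norm norm_minus_commute)
  with D show ?thesis by (intro exI[of _ "insert 0 D"]) auto
qed

text \<open>The distance to \<open>K\<close> is the supremum of the affine functions \<open>m \<bullet> x - sup (m \<bullet> K)\<close> with
  \<open>|m| \<le> 1\<close>; taking the slopes from a fine finite net and smoothing the maximum gives a smooth
  convex approximation.\<close>

lemma smooth_approx_dist:
  assumes e: "0 < e" "e < 1" and R: "\<And>x y. x \<in> K \<Longrightarrow> y \<in> K \<Longrightarrow> norm (x - y) \<le> R"
  shows "\<exists>N h k. log_sum_exp N k \<and> (\<forall>x. (1 - e) * dist_K x - e * R \<le> log_sum_exp.psi N h k x)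
    \<and> (\<forall>x. log_sum_exp.psi N h k x \<le> dist_K x + e) \<and> (\<forall>x. 0 \<le> log_sum_exp.psi N h k x)"
proof -
  obtain N where fN: "finite N" "N \<subseteq> cball (0::'a) 1" "0 \<in> N" and net: "\<And>n. n \<in> cball 0 1 \<Longrightarrow> \<exists>m\<in>N. norm (n - m) \<le> e"
    using net_cball[OF e(1)] by blast
  obtain y where y: "\<And>m. y m \<in> K" "\<And>m z. z \<in> K \<Longrightarrow> m \<bullet> z \<le> m \<bullet> y m"
    using support_point by metis
  define h where "h m = m \<bullet> y m" for m
  define k where "k = (ln (card N) + 1) / e"
  have card: "1 \<le> card N" using fN by (metis One_nat_def Suc_leI card_gt_0_iff empty_iff)
  then have lnN: "0 \<le> ln (real (card N))" by simp
  have k: "0 < k" using e lnN by (simp add: k_def add_nonneg_pos)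
  have "ln (card N) \<le> k * e" using e lnN by (simp add: k_def)
  then have lnk: "ln (card N) / k \<le> e" using k by (simp add: field_simps)
  interpret log_sum_exp N h k by standard (use fN k in auto)
  have upper: "m \<bullet> x - h m \<le> dist_K x" if "m \<in> N" for m x
  proof -
    have "m \<bullet> x - h m \<le> m \<bullet> (x - proj x)" using y(2)[OF proj_in, of m x] by (simp add: h_def inner_diff_right)
    also have "\<dots> \<le> norm m * norm (x - proj x)" by (rule norm_cauchy_schwarz)
    also have "\<dots> \<le> 1 * norm (x - proj x)" using subsetD[OF fN(2) that] by (intro mult_right_mono) auto
    finally show ?thesis by (simp add: dist_K_eq)
  qed
  have "psi x \<le> dist_K x + e" for x using psi_le[OF upper, of x] lnk by linarith
  moreover have nonneg: "0 \<le> psi x" for x using psi_ge[OF fN(3), of x] by (simp add: h_def)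
  moreover have "(1 - e) * dist_K x - e * R \<le> psi x" for x
  proof (cases "x \<in> K")
    case True
    have "0 \<le> R" using R[OF True True] by simp
    then have "0 \<le> e * R" using e by simp
    then show ?thesis using True nonneg[of x] by (simp add: infdist_zero)
  next
    case False
    let ?n = "normal x"
    obtain m where m: "m \<in> N" "norm (?n - m) \<le> e" using net[of ?n] norm_normal[OF False] by auto
    have "dist_K x = ?n \<bullet> (x - proj x)"
    proof -
      have "x \<noteq> proj x" using False proj_in[of x] by auto
      then show ?thesis by (simp add: normal_def dist_K_eq dot_square_norm power2_eq_square)
    qed
    also have "\<dots> \<le> ?n \<bullet> (x - proj x) - (y m - proj x) \<bullet> ?n"
      using inner_normal_le[OF False y(1)[of m]] by simp
    also have "\<dots> = m \<bullet> (x - y m) + (?n - m) \<bullet> (x - y m)" by (simp add: inner_diff_left inner_diff_right inner_commute)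
    also have "(?n - m) \<bullet> (x - y m) \<le> norm (?n - m) * norm (x - y m)" by (rule norm_cauchy_schwarz)
    also have "\<dots> \<le> e * (dist_K x + R)"
    proof (intro mult_mono m(2))
      have "norm (x - y m) \<le> norm (x - proj x) + norm (proj x - y m)" by (rule norm_diff_triangle_le[OF order_refl order_refl])
      then show "norm (x - y m) \<le> dist_K x + R" using R[OF proj_in[of x] y(1)[of m]] by (simp add: dist_K_eq)
    qed (use e in auto)
    finally have "(1 - e) * dist_K x - e * R \<le> m \<bullet> x - h m" by (simp add: algebra_simps h_def inner_diff_right)
    then show ?thesis using psi_ge[OF m(1), of x] by linarith
  qed
  ultimately show ?thesis using log_sum_exp_axioms by blast
qed

text \<open>The unit normal field of \<open>K\<close>, replaced by the smooth field \<open>G\<close>, is tested in the definition of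
  the perimeter of \<open>M\<close>. Its divergence is nonnegative, so the integral over \<open>M\<close> is at least the
  integral against the weight \<open>(max 0 (T - psi))\<^sup>2 / T\<^sup>2\<close>, which is at most \<open>1\<close> and supported in \<open>M\<close>. Integration by
  parts turns the latter into an integral of \<open>|G|\<^sup>2\<close>, and \<open>|G|\<close> is nearly \<open>1\<close> away from \<open>K\<close>.\<close>

lemma perimeter_superset_ge_approx:
  assumes M: "compact M" and T: "0 < T" "\<And>x. dist_K x \<le> 2 * T \<Longrightarrow> x \<in> M"
    and d: "0 < d" "d < 1" "d < T"
  shows "ereal ((1 - d) ^ 3 * V' 0 * ((T - d)\<^sup>2 - d\<^sup>2) / T\<^sup>2) \<le> perimeter M"
proof -
  obtain R where R: "0 < R" "\<And>x y. x \<in> K \<Longrightarrow> y \<in> K \<Longrightarrow> norm (x - y) \<le> R"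
  proof -
    have b: "bounded K" using compact by (rule compact_imp_bounded)
    show ?thesis
    proof (rule that)
      show "0 < diameter K + 1" using diameter_ge_0[OF b] by simp
      show "norm (x - y) \<le> diameter K + 1" if "x \<in> K" "y \<in> K" for x y
        using diameter_bounded_bound[OF b that] by (simp add: dist_norm)
    qed
  qed
  \<comment> \<open>accuracy of \<open>psi\<close>: the first two bounds keep the support of the weight inside \<open>M\<close>; the others ensure
    that \<open>T - psi\<close> is at least \<open>1 - d\<close> times \<open>T - dist_K\<close>, and \<open>|G|\<close> at least \<open>1 - d\<close>, where
    \<open>d \<le> dist_K \<le> T - d\<close>\<close>
  define e where "e = Min {1/4, T / (4 * R), d\<^sup>2, d / (1 + (R + 1) / d)}"
  have "0 < e" unfolding e_def using T(1) R(1) d by (subst Min_gr_iff) (auto intro!: divide_pos_pos add_pos_pos)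
  have "e \<le> 1/4" "e \<le> T / (4 * R)" "e \<le> d\<^sup>2" "e \<le> d / (1 + (R + 1) / d)" unfolding e_def by (rule Min_le; simp)+
  note e_le = this
  have e: "e \<le> 1/4" "e * R \<le> T / 4" "e \<le> d * d" "e + e * (R + 1) / d \<le> d"
  proof -
    show "e \<le> 1/4" by (rule e_le(1))
    show "e * R \<le> T / 4" using mult_right_mono[OF e_le(2), of R] R(1) by simp
    show "e \<le> d * d" using e_le(3) by (simp add: power2_eq_square)
    have "0 < 1 + (R + 1) / d" using R(1) d by (intro add_pos_pos divide_pos_pos) auto
    then have "e * (1 + (R + 1) / d) \<le> d" using e_le(4) by (simp add: pos_le_divide_eq)
    then show "e + e * (R + 1) / d \<le> d" by (simp add: distrib_left)
  qed
  have "e < 1" using e by simp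
  obtain N h k where lse: "log_sum_exp N k" and
    low: "\<And>x. (1 - e) * dist_K x - e * R \<le> log_sum_exp.psi N h k x" and
    up: "\<And>x. log_sum_exp.psi N h k x \<le> dist_K x + e" and nonneg: "\<And>x. 0 \<le> log_sum_exp.psi N h k x"
    using smooth_approx_dist[OF \<open>0 < e\<close> \<open>e < 1\<close> R(2)] by blast
  interpret log_sum_exp N h k by (rule lse)
  have inM: "x \<in> M" if "psi x < T" for x
  proof (rule T(2), rule ccontr)
    assume "\<not> dist_K x \<le> 2 * T"
    then have "3/4 * (2 * T) \<le> (1 - e) * dist_K x" using e(1) T(1) by (intro mult_mono) auto
    then show False using low[of x] e(2) that T(1) by linarith
  qed
  obtain r where r: "\<And>x. x \<in> M \<Longrightarrow> norm x \<le> r" using compact_imp_bounded[OF M] by (auto simp: bounded_iff)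
  have far: "T \<le> psi x" if "r < norm x" for x using inM[of x] r[of x] that by fastforce
  note parts = integral_div_G[of r T, OF far]
  have G_ge: "1 - d \<le> norm (G x)" if x: "d \<le> dist_K x" for x
  proof -
    have pos: "0 < dist_K x" using x d by simp
    have "psi x - psi (proj x) \<le> G x \<bullet> (x - proj x)"
      using psi_tangent[of x "proj x"] by (simp add: inner_diff_right)
    also have "\<dots> \<le> norm (G x) * dist_K x" by (simp add: dist_K_eq norm_cauchy_schwarz)
    finally have "(1 - e) * dist_K x - e * R - e \<le> norm (G x) * dist_K x"
      using low[of x] up[of "proj x"] infdist_zero[OF proj_in[of x]] by linarith
    then have "(1 - e) * dist_K x - norm (G x) * dist_K x \<le> e * (R + 1)" by (simp add: algebra_simps)
    then have "1 - e - norm (G x) \<le> e * (R + 1) / dist_K x" using pos by (simp add: field_simps)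
    also have "\<dots> \<le> e * (R + 1) / d" using x d R(1) \<open>0 < e\<close> by (intro divide_left_mono) auto
    finally show ?thesis using e(4) by linarith
  qed
  define F where "F t = (1 - d) ^ 3 * (T - t)" for t
  have F_le: "F (dist_K x) \<le> max 0 (T - psi x) * (norm (G x))\<^sup>2" if x: "d \<le> dist_K x" "dist_K x \<le> T - d" for x
  proof -
    have "d * d \<le> d * (T - dist_K x)" using x d by (intro mult_left_mono) auto
    with e(3) have "e \<le> d * (T - dist_K x)" by linarith
    then have "(1 - d) * (T - dist_K x) \<le> max 0 (T - psi x)" using up[of x] by (simp add: algebra_simps)
    moreover have "(1 - d)\<^sup>2 \<le> (norm (G x))\<^sup>2" using G_ge[OF x(1)] d by (intro power_mono) auto
    ultimately have "((1 - d) * (T - dist_K x)) * (1 - d)\<^sup>2 \<le> max 0 (T - psi x) * (norm (G x))\<^sup>2"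
      using d x by (intro mult_mono) auto
    then show ?thesis by (simp add: F_def power3_eq_cube power2_eq_square ac_simps)
  qed
  let ?I = "LINT x|lborel. max 0 (T - psi x) * (norm (G x))\<^sup>2"
  let ?c = "(1 - d) ^ 3 * V' 0 * ((T - d)\<^sup>2 - d\<^sup>2) / 2"
  have "?c \<le> ?I"
  proof (cases "d \<le> T - d")
    case False
    then have "(T - d)\<^sup>2 \<le> d\<^sup>2" using d by (intro power_mono) auto
    then have "?c \<le> 0" using d V'_nonneg[of 0] by (intro divide_nonpos_nonneg mult_nonneg_nonpos) auto
    also have "0 \<le> ?I" by (intro Bochner_Integration.integral_nonneg) auto
    finally show ?thesis .
  next
    case True
    have [measurable]: "F \<in> borel_measurable borel" unfolding F_def by measurable
    have "ennreal ?c = (\<integral>\<^sup>+t. ennreal (F t * V' 0) * indicator {d..T - d} t \<partial>lborel)"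
    proof -
      define A where "A t = - ((1 - d) ^ 3 * V' 0 * (T - t)\<^sup>2 / 2)" for t
      have "(\<integral>\<^sup>+t. ennreal (F t * V' 0) * indicator {d..T - d} t \<partial>lborel) = ennreal (A (T - d) - A d)"
      proof (rule nn_integral_FTC_Icc[where F = A])
        fix t assume t: "t \<in> {d..T - d}"
        show "(A has_real_derivative F t * V' 0) (at t)"
          unfolding F_def A_def[abs_def] by (auto intro!: derivative_eq_intros simp: field_simps)
        show "0 \<le> F t * V' 0" unfolding F_def using t d V'_nonneg[of 0] by auto
      qed (use True in auto)
      also have "A (T - d) - A d = ?c" by (simp add: A_def field_simps)
      finally show ?thesis by simp
    qed
    also have "\<dots> \<le> (\<integral>\<^sup>+t. (ennreal (F t) * indicator {d..T - d} t) * indicator {0<..T} t * ennreal (V' t) \<partial>lborel)"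
    proof (rule nn_integral_mono)
      fix t
      show "ennreal (F t * V' 0) * indicator {d..T - d} t
          \<le> (ennreal (F t) * indicator {d..T - d} t) * indicator {0<..T} t * ennreal (V' t)"
      proof (cases "t \<in> {d..T - d}")
        case t: True
        have "0 \<le> F t" using t d by (auto simp: F_def)
        moreover have "V' 0 \<le> V' t" using t d by (intro V'_ge) auto
        ultimately have "ennreal (F t * V' 0) \<le> ennreal (F t) * ennreal (V' t)"
          using V'_nonneg[of t] V'_nonneg[of 0] by (subst ennreal_mult[symmetric]) (auto intro!: ennreal_leI mult_left_mono)
        then show ?thesis using t d by (auto simp: indicator_def)
      qed simp
    qed
    also have "\<dots> = (\<integral>\<^sup>+x. (ennreal (F (dist_K x)) * indicator {d..T - d} (dist_K x)) * indicator {0<..T} (dist_K x) \<partial>lborel)"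
      using T(1) by (intro nn_integral_dist_bounded[symmetric]) auto
    also have "\<dots> \<le> (\<integral>\<^sup>+x. ennreal (max 0 (T - psi x) * (norm (G x))\<^sup>2) \<partial>lborel)"
      using F_le by (intro nn_integral_mono) (auto simp: indicator_def intro: ennreal_leI)
    also have "\<dots> = ennreal ?I"
      by (intro nn_integral_eq_integral parts(2)) auto
    finally show ?thesis
      by (subst (asm) ennreal_le_iff) (auto intro!: Bochner_Integration.integral_nonneg)
  qed
  also have "?I \<le> T\<^sup>2 * (LINT x:M|lborel. div_G x) / 2"
  proof -
    have "(LINT x|lborel. (max 0 (T - psi x))\<^sup>2 * div_G x) \<le> (LINT x|lborel. T\<^sup>2 * (indicator M x *\<^sub>R div_G x))"
    proof (rule integral_mono)
      show "integrable lborel (\<lambda>x. T\<^sup>2 * (indicator M x *\<^sub>R div_G x))"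
        using borel_integrable_compact[OF M continuous_div_G] by simp
      fix x
      show "(max 0 (T - psi x))\<^sup>2 * div_G x \<le> T\<^sup>2 * (indicator M x *\<^sub>R div_G x)"
      proof (cases "psi x < T")
        case True
        then have "(max 0 (T - psi x))\<^sup>2 \<le> T\<^sup>2" using nonneg[of x] by (intro power_mono) auto
        then show ?thesis using inM[OF True] div_G_nonneg[of x] by (simp add: mult_right_mono)
      next
        case False
        then show ?thesis using div_G_nonneg[of x] by (simp add: max_def indicator_def)
      qed
    qed (rule parts(1))
    then show ?thesis unfolding set_lebesgue_integral_def using parts(3) by simp
  qed
  finally have "(1 - d) ^ 3 * V' 0 * ((T - d)\<^sup>2 - d\<^sup>2) / T\<^sup>2 \<le> (LINT x:M|lborel. div_G x)"
    using T(1) by (simp add: field_simps)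
  also have "ereal \<dots> \<le> perimeter M" by (rule integral_div_G_le_perimeter[OF M])
  finally show ?thesis by simp
qed

lemma perimeter_superset_ge:
  assumes M: "compact M" and T: "0 < T" "\<And>x. dist_K x \<le> 2 * T \<Longrightarrow> x \<in> M"
  shows "ereal (V' 0) \<le> perimeter M"
proof (rule tendsto_upperbound)
  have "((\<lambda>d. (1 - d) ^ 3 * V' 0 * ((T - d)\<^sup>2 - d\<^sup>2) / T\<^sup>2) \<longlongrightarrow> (1 - 0) ^ 3 * V' 0 * ((T - 0)\<^sup>2 - 0\<^sup>2) / T\<^sup>2) (at_right 0)"
    using T(1) by (intro tendsto_intros) auto
  then show "((\<lambda>d. ereal ((1 - d) ^ 3 * V' 0 * ((T - d)\<^sup>2 - d\<^sup>2) / T\<^sup>2)) \<longlongrightarrow> ereal (V' 0)) (at_right 0)"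
    using T(1) by simp
  have "0 < min 1 T" using T(1) by simp
  then show "\<forall>\<^sub>F d in at_right 0. ereal ((1 - d) ^ 3 * V' 0 * ((T - d)\<^sup>2 - d\<^sup>2) / T\<^sup>2) \<le> perimeter M"
    using eventually_at_right_real[of 0 "min 1 T"]
    by (auto elim!: eventually_mono intro!: perimeter_superset_ge_approx M T)
qed simp

lemma V_ge_tangent: "0 \<le> s \<Longrightarrow> V 0 + s * V' 0 \<le> V s"
proof -
  assume s: "0 \<le> s"
  have "(\<Sum>k\<le>DIM('a). coeff k * 0 ^ k + s * (coeff k * (real k * 0 ^ (k - 1)))) \<le> (\<Sum>k\<le>DIM('a). coeff k * s ^ k)"
  proof (rule sum_mono)
    fix k :: nat
    consider "k = 0" | "k = 1" | "2 \<le> k" by linarith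
    then show "coeff k * 0 ^ k + s * (coeff k * (real k * 0 ^ (k - 1))) \<le> coeff k * s ^ k"
      using s coeff(1)[of k] by cases (auto simp: power_0_left)
  qed
  then show ?thesis by (simp add: V_def V'_def sum.distrib sum_distrib_left)
qed

lemma V_diff_le: "0 \<le> s \<Longrightarrow> s \<le> 1 \<Longrightarrow> V s - V 0 \<le> s * (V 1 - V 0)"
proof -
  assume s: "0 \<le> s" "s \<le> 1"
  have "(\<Sum>k\<le>DIM('a). coeff k * s ^ k - coeff k * 0 ^ k) \<le> (\<Sum>k\<le>DIM('a). s * (coeff k * 1 ^ k - coeff k * 0 ^ k))"
  proof (rule sum_mono)
    fix k :: nat
    show "coeff k * s ^ k - coeff k * 0 ^ k \<le> s * (coeff k * 1 ^ k - coeff k * 0 ^ k)"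
    proof (cases k)
      case (Suc n)
      have "s ^ Suc n \<le> s * 1" unfolding power_Suc using s by (intro mult_left_mono power_le_one) auto
      then have "coeff k * s ^ Suc n \<le> coeff k * s" using coeff(1)[of k] by (intro mult_left_mono) auto
      then show ?thesis using Suc by (simp add: ac_simps)
    qed simp
  qed
  then show ?thesis by (simp add: V_def sum_subtractf sum_distrib_left[symmetric])
qed

text \<open>The previous estimate needs room between the two bodies. The copy of \<open>K\<close> contracted by \<open>1 - e\<close>
  towards an interior point has a parallel body inside \<open>K\<close>, and its volume grows at the rate
  \<open>(1 - e) ^ (DIM('a) - 1) V' 0\<close>.\<close>

lemma perimeter_ge_contracted:
  assumes e: "0 < e" "e < 1"
  shows "ereal ((1 - e) ^ (DIM('a) - 1) * V' 0) \<le> perimeter K"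
proof -
  obtain x0 r where r: "0 < r" "cball x0 r \<subseteq> K"
    using interior_nonempty mem_interior_cball by blast
  define L where "L = (\<lambda>x. (1 - e) *\<^sub>R x + e *\<^sub>R x0) ` K"
  have vL: "vol (L + cball 0 t) = (1 - e) ^ DIM('a) * V (t / (1 - e))" if "0 \<le> t" for t
  proof -
    have "L + cball 0 t = (\<lambda>x. (1 - e) *\<^sub>R x + e *\<^sub>R x0) ` (K + cball 0 (t / (1 - e)))"
    proof (intro equalityI subsetI)
      fix x assume "x \<in> L + cball 0 t"
      then obtain k z where x: "x = (1 - e) *\<^sub>R k + e *\<^sub>R x0 + z" "k \<in> K" "norm z \<le> t"
        by (auto simp: set_plus_def L_def)
      then have "k + (1 / (1 - e)) *\<^sub>R z \<in> K + cball 0 (t / (1 - e))"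
        using e by (intro set_plus_intro) (auto simp: divide_right_mono)
      moreover have "x = (1 - e) *\<^sub>R (k + (1 / (1 - e)) *\<^sub>R z) + e *\<^sub>R x0"
        using x e by (simp add: scaleR_add_right)
      ultimately show "x \<in> (\<lambda>x. (1 - e) *\<^sub>R x + e *\<^sub>R x0) ` (K + cball 0 (t / (1 - e)))" by blast
    next
      fix x assume "x \<in> (\<lambda>x. (1 - e) *\<^sub>R x + e *\<^sub>R x0) ` (K + cball 0 (t / (1 - e)))"
      then obtain w where w: "x = (1 - e) *\<^sub>R w + e *\<^sub>R x0" "w \<in> K + cball 0 (t / (1 - e))" by blast
      from w(2) obtain k z where "w = k + z" "k \<in> K" "z \<in> cball 0 (t / (1 - e))" by (rule set_plus_elim)
      with w(1) have x: "x = (1 - e) *\<^sub>R (k + z) + e *\<^sub>R x0" "k \<in> K" "norm z \<le> t / (1 - e)" by auto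
      have "norm ((1 - e) *\<^sub>R z) \<le> t" using x(3) e by (simp add: pos_le_divide_eq mult.commute)
      then have "((1 - e) *\<^sub>R k + e *\<^sub>R x0) + (1 - e) *\<^sub>R z \<in> L + cball 0 t"
        using x(2) unfolding L_def by (intro set_plus_intro imageI) (simp_all only: mem_cball_0)
      then show "x \<in> L + cball 0 t" using x by (simp add: scaleR_add_right ac_simps)
    qed
    then show ?thesis using e that by (simp add: measure_lebesgue_affine coeff(2))
  qed
  have cL: "convex L" 
    using convex_affinity[OF convex, of "e *\<^sub>R x0" "1 - e"] by (simp add: L_def add.commute)
  have kL: "compact L" unfolding L_def using compact by (intro compact_continuous_image continuous_intros)
  have "vol L = (1 - e) ^ DIM('a) * V 0" using vL[of 0] by simp
  then have "vol L > 0" using e V_pos[of 0] by simp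
  then have iL: "interior L \<noteq> {}"
    using negligible_convex_interior[OF cL] negligible_imp_measure0[of L] by auto
  interpret L: convex_body L by standard (rule cL kL iL)+
  have "ereal (L.V' 0) \<le> perimeter K"
  proof (rule L.perimeter_superset_ge[OF compact])
    show "0 < e * r / 2" using e r by simp
    fix x assume x: "infdist x L \<le> 2 * (e * r / 2)"
    have "L.proj x \<in> L" by (rule L.proj_in)
    then obtain k where k: "k \<in> K" "L.proj x = (1 - e) *\<^sub>R k + e *\<^sub>R x0" by (auto simp: L_def)
    have n: "norm (x - L.proj x) \<le> e * r" using x by (simp add: L.dist_K_eq)
    have "norm ((1 / e) *\<^sub>R (x - L.proj x)) = norm (x - L.proj x) / e" using e by (simp only: norm_scaleR) simp
    also have "\<dots> \<le> r" using n e by (simp add: pos_divide_le_eq mult.commute)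
    finally have "x0 + (1 / e) *\<^sub>R (x - L.proj x) \<in> cball x0 r"
      by (simp only: mem_cball dist_norm norm_minus_commute[of x0] add_diff_cancel_left')
    then have "(1 - e) *\<^sub>R k + e *\<^sub>R (x0 + (1 / e) *\<^sub>R (x - L.proj x)) \<in> K"
      using r(2) k(1) e by (intro convexD[OF convex]) auto
    also have "(1 - e) *\<^sub>R k + e *\<^sub>R (x0 + (1 / e) *\<^sub>R (x - L.proj x)) = L.proj x + (x - L.proj x)"
      using e by (simp add: scaleR_add_right k(2) del: add_diff_cancel_left' diff_add_cancel)
    finally show "x \<in> K" by simp
  qed
  moreover have "(1 - e) ^ (DIM('a) - 1) * V' 0 \<le> L.V' 0"
  proof (rule tendsto_lowerbound)
    have "((\<lambda>t. (L.V t - L.V 0) / t) \<longlongrightarrow> L.V' 0) (at 0)"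
      using L.V_has_derivative[of 0] by (simp add: has_field_derivative_iff)
    then show "((\<lambda>t. (L.V t - L.V 0) / t) \<longlongrightarrow> L.V' 0) (at_right 0)"
      by (rule filterlim_mono[OF _ order_refl]) (simp add: at_le)
    show "\<forall>\<^sub>F t in at_right 0. (1 - e) ^ (DIM('a) - 1) * V' 0 \<le> (L.V t - L.V 0) / t"
      using eventually_at_right_real[OF zero_less_one]
    proof eventually_elim
      case (elim t)
      have L: "L.V t = (1 - e) ^ DIM('a) * V (t / (1 - e))" if "0 \<le> t" for t
        using vL[OF that] L.coeff(2)[OF that] by simp
      have "(1 - e) ^ DIM('a) * (t / (1 - e) * V' 0) \<le> (1 - e) ^ DIM('a) * (V (t / (1 - e)) - V 0)"
        using V_ge_tangent[of "t / (1 - e)"] elim e by (intro mult_left_mono) auto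
      also have "\<dots> = L.V t - L.V 0" using elim by (simp add: L right_diff_distrib)
      also have "(1 - e) ^ DIM('a) = (1 - e) * (1 - e) ^ (DIM('a) - 1)"
        by (metis DIM_positive Suc_pred' power_Suc)
      also have "(1 - e) * (1 - e) ^ (DIM('a) - 1) * (t / (1 - e) * V' 0) = (1 - e) ^ (DIM('a) - 1) * V' 0 * t"
        using e by simp
      finally show ?case using elim by (simp add: pos_le_divide_eq)
    qed
  qed simp
  ultimately show ?thesis by (meson ereal_less_eq(3) order_trans)
qed

theorem V'_le_perimeter: "ereal (V' 0) \<le> perimeter K"
proof (rule tendsto_upperbound)
  have "((\<lambda>e. (1 - e) ^ (DIM('a) - 1) * V' 0) \<longlongrightarrow> (1 - 0) ^ (DIM('a) - 1) * V' 0) (at_right 0)"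
    by (intro tendsto_intros)
  then show "((\<lambda>e. ereal ((1 - e) ^ (DIM('a) - 1) * V' 0)) \<longlongrightarrow> ereal (V' 0)) (at_right 0)" by simp
  show "\<forall>\<^sub>F e in at_right 0. ereal ((1 - e) ^ (DIM('a) - 1) * V' 0) \<le> perimeter K"
    using eventually_at_right_real[OF zero_less_one]
    by eventually_elim (rule perimeter_ge_contracted; simp)
qed simp

end

section \<open>Finiteness of the perimeter\<close>

context convex_body
begin

lemma measure_shell: "0 \<le> h \<Longrightarrow> measure lborel {x. 0 < dist_K x \<and> dist_K x \<le> h} = V h - V 0"
  using emeasure_shell[of 0 h] V_mono[of 0 h] by (simp add: measure_def)

text \<open>The difference quotients of \<open>w\<close> in direction \<open>b\<close>, integrated over \<open>K\<close>, are controlled by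
  the part of the translate \<open>K + h b\<close> outside \<open>K\<close>, which lies in a parallel shell of width \<open>h\<close>.\<close>

lemma integral_translate_diff_le:
  fixes w :: "'a \<Rightarrow> real"
  assumes [measurable]: "w \<in> borel_measurable borel" and w: "\<And>x. \<bar>w x\<bar> \<le> 1" and b: "norm b = 1" and h: "0 \<le> h"
  shows "(LINT x|lborel. indicator K x * (w (x + h *\<^sub>R b) - w x)) \<le> 2 * (V h - V 0)"
proof -
  have [measurable]: "K \<in> sets borel" using compact by (simp add: borel_compact)
  let ?K' = "(\<lambda>x. x - h *\<^sub>R b) -` K"
  have [measurable]: "?K' \<in> sets borel" by (intro measurable_sets_borel[of _ borel]) auto
  have K'eq: "?K' = (+) (h *\<^sub>R b) ` K" by (auto intro: image_eqI[of _ _ "_ - h *\<^sub>R b"])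
  have fK: "emeasure lborel K < \<infinity>" using emeasure_compact_finite[OF compact] .
  have fK': "emeasure lborel ?K' < \<infinity>"
    unfolding K'eq using compact by (intro emeasure_compact_finite compact_translation)
  have iK: "integrable lborel (indicator K :: 'a \<Rightarrow> real)" "integrable lborel (indicator ?K' :: 'a \<Rightarrow> real)"
    using fK fK' by auto
  have mK: "(LINT x|lborel. indicator ?K' x :: real) = (LINT x|lborel. indicator K x)"
  proof -
    have "measure lebesgue ?K' = measure lebesgue K" unfolding K'eq by (rule measure_translation)
    then show ?thesis by simp
  qed
  have bound: "integrable lborel (\<lambda>x. indicator A x * v x)"
    if "A \<in> sets borel" "emeasure lborel A < \<infinity>" "v \<in> borel_measurable borel" "\<And>x. \<bar>v x\<bar> \<le> 1" for A and v :: "'a \<Rightarrow> real"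
  proof (rule Bochner_Integration.integrable_bound)
    show "integrable lborel (indicator A :: 'a \<Rightarrow> real)" using that by simp
    show "(\<lambda>x. indicator A x * v x) \<in> borel_measurable lborel" using that by measurable
    show "AE x in lborel. norm (indicator A x * v x) \<le> norm (indicator A x :: real)"
      using that(4) by (auto simp: indicator_def)
  qed
  have int: "integrable lborel (\<lambda>x. indicator K x * w (x + h *\<^sub>R b))" "integrable lborel (\<lambda>x. indicator K x * w x)"
    "integrable lborel (\<lambda>x. indicator ?K' x * w x)"
    using w fK fK' by (auto intro!: bound)
  have plus: "(\<lambda>x. x + h *\<^sub>R b) = (+) (h *\<^sub>R b)" by (simp add: fun_eq_iff add.commute)
  have "(LINT x|lborel. indicator ?K' x * w x) = (LINT x|distr lborel borel (\<lambda>x. x + h *\<^sub>R b). indicator ?K' x * w x)"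
    unfolding plus lborel_distr_plus ..
  also have "\<dots> = (LINT x|lborel. indicator ?K' (x + h *\<^sub>R b) * w (x + h *\<^sub>R b))"
    by (rule integral_distr) auto
  also have "\<dots> = (LINT x|lborel. indicator K x * w (x + h *\<^sub>R b))"
    by (intro Bochner_Integration.integral_cong) (auto simp: indicator_def)
  finally have shift: "(LINT x|lborel. indicator K x * w (x + h *\<^sub>R b)) = (LINT x|lborel. indicator ?K' x * w x)" ..
  let ?S = "{x. 0 < dist_K x \<and> dist_K x \<le> h}"
  have fS: "emeasure lborel ?S < \<infinity>" using emeasure_shell[of 0 h] h by (simp add: less_top)
  have "(LINT x|lborel. indicator K x * (w (x + h *\<^sub>R b) - w x))
      = (LINT x|lborel. indicator ?K' x * w x) - (LINT x|lborel. indicator K x * w x)"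
    using int by (simp add: right_diff_distrib shift)
  also have "\<dots> = (LINT x|lborel. indicator ?K' x * w x - indicator K x * w x)" using int by simp
  also have "\<dots> \<le> (LINT x|lborel. 2 * indicator ?S x + (indicator K x - indicator ?K' x))"
  proof (rule integral_mono)
    show "integrable lborel (\<lambda>x. indicator ?K' x * w x - indicator K x * w x)" using int by simp
    show "integrable lborel (\<lambda>x. 2 * indicator ?S x + (indicator K x - indicator ?K' x) :: real)"
      using iK fS by (intro Bochner_Integration.integrable_add integrable_mult_right Bochner_Integration.integrable_diff) auto
    fix x
    have "x \<in> ?S" if x: "x \<in> ?K'" "x \<notin> K"
    proof -
      have "dist_K x \<le> norm (x - (x - h *\<^sub>R b))" using x by (intro dist_K_le) simp
      then show ?thesis using x b h dist_K_pos_iff by simp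
    qed
    moreover have "w x \<le> 1" "- w x \<le> 1" using w[of x] by (auto simp: abs_le_iff)
    ultimately show "indicator ?K' x * w x - indicator K x * w x \<le> 2 * indicator ?S x + (indicator K x - indicator ?K' x)"
      by (cases "x \<in> ?K'"; cases "x \<in> K"; cases "x \<in> ?S") simp_all
  qed
  also have "\<dots> = 2 * (V h - V 0)"
    using iK fS mK measure_shell[OF h] by simp
  finally show ?thesis .
qed

lemma integral_directional_derivative_le:
  assumes phi: "C_k 1 \<phi>" "compactly_supported \<phi>" "\<And>x. norm (\<phi> x) \<le> 1" and b: "b \<in> Basis"
  shows "integrable lborel (\<lambda>x. indicator K x * (frechet_derivative \<phi> (at x) b \<bullet> b))"
    "(LINT x|lborel. indicator K x * (frechet_derivative \<phi> (at x) b \<bullet> b)) \<le> 2 * (V 1 - V 0)"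
proof -
  let ?D = "\<lambda>x. frechet_derivative \<phi> (at x)"
  obtain M where M: "\<forall>x y. norm (\<phi> x - \<phi> y) \<le> M * norm (x - y)"
    using C_1_compact_support_Lipschitz[OF phi(1,2)] ..
  have [measurable]: "K \<in> sets borel" using compact by (simp add: borel_compact)
  have [measurable]: "\<phi> \<in> borel_measurable borel"
    by (intro borel_measurable_continuous_onI C_1_continuous phi)
  have Dm: "(\<lambda>x. ?D x b) \<in> borel_measurable borel"
    by (intro borel_measurable_continuous_onI C_1_continuous_derivative phi b)
  have nb: "norm b = 1" using b by simp
  define w where "w x = \<phi> x \<bullet> b" for x
  have [measurable]: "w \<in> borel_measurable borel" unfolding w_def[abs_def] by measurable
  have w1: "\<bar>w x\<bar> \<le> 1" for x using Basis_le_norm[OF b, of "\<phi> x"] phi(3)[of x] by (simp add: w_def)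
  have wlip: "\<bar>w x - w y\<bar> \<le> M * norm (x - y)" for x y
    using Basis_le_norm[OF b, of "\<phi> x - \<phi> y"] M by (simp add: w_def inner_diff_left) (meson order_trans)
  define h where "h n = inverse (real (Suc n))" for n
  have h: "h n > 0" "h n \<le> 1" for n by (auto simp: h_def field_simps)
  have h0: "h \<longlonglongrightarrow> 0" "\<And>n. h n \<noteq> 0"
    using h(1) LIMSEQ_inverse_real_of_nat unfolding h_def[abs_def] by auto
  define s where "s n x = indicator K x * ((w (x + h n *\<^sub>R b) - w x) / h n)" for n x
  have sm: "s n \<in> borel_measurable lborel" for n unfolding s_def[abs_def] by measurable
  have bound: "\<bar>s n x\<bar> \<le> indicator K x * M" for n x
  proof -
    have "\<bar>w (x + h n *\<^sub>R b) - w x\<bar> \<le> M * h n" using wlip[of "x + h n *\<^sub>R b" x] h[of n] nb by simp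
    then have "\<bar>(w (x + h n *\<^sub>R b) - w x) / h n\<bar> \<le> M" using h[of n] by (simp add: pos_divide_le_eq)
    then show ?thesis by (simp add: s_def indicator_def)
  qed
  have ib: "integrable lborel (\<lambda>x. indicator K x * M)"
    using emeasure_compact_finite[OF compact] by simp
  have lim: "AE x in lborel. (\<lambda>n. s n x) \<longlonglongrightarrow> indicator K x * (?D x b \<bullet> b)"
  proof (rule AE_I2)
    fix x
    have "(w has_derivative (\<lambda>v. ?D x v \<bullet> b)) (at x)"
      unfolding w_def[abs_def] by (rule has_derivative_inner_left[OF C_1_has_derivative[OF phi(1)]])
    from directional_difference_quotient_tendsto[OF this h0, of b]
    have "(\<lambda>n. (w (x + h n *\<^sub>R b) - w x) / h n) \<longlonglongrightarrow> ?D x b \<bullet> b" .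
    then show "(\<lambda>n. s n x) \<longlonglongrightarrow> indicator K x * (?D x b \<bullet> b)" unfolding s_def by (intro tendsto_mult tendsto_const)
  qed
  have lm: "(\<lambda>x. indicator K x * (?D x b \<bullet> b)) \<in> borel_measurable lborel"
    using borel_measurable_inner[OF Dm borel_measurable_const, of b] by simp
  show "integrable lborel (\<lambda>x. indicator K x * (?D x b \<bullet> b))"
    by (rule integrable_dominated_convergence[OF lm sm ib lim]) (auto intro!: AE_I2 bound)
  have "(\<lambda>n. LINT x|lborel. s n x) \<longlonglongrightarrow> (LINT x|lborel. indicator K x * (?D x b \<bullet> b))"
    by (rule integral_dominated_convergence[OF lm sm ib lim]) (auto intro!: AE_I2 bound)
  moreover have "(LINT x|lborel. s n x) \<le> 2 * (V 1 - V 0)" for n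
  proof -
    have "(LINT x|lborel. s n x) = (LINT x|lborel. indicator K x * (w (x + h n *\<^sub>R b) - w x)) / h n"
      unfolding s_def by simp
    also have "\<dots> \<le> 2 * (V (h n) - V 0) / h n"
      using h[of n] by (intro divide_right_mono integral_translate_diff_le w1 nb) auto
    also have "\<dots> \<le> 2 * (h n * (V 1 - V 0)) / h n"
      using h[of n] V_diff_le[of "h n"] by (intro divide_right_mono mult_left_mono) auto
    finally show ?thesis using h[of n] by simp
  qed
  ultimately show "(LINT x|lborel. indicator K x * (?D x b \<bullet> b)) \<le> 2 * (V 1 - V 0)"
    by (intro LIMSEQ_le_const2) auto
qed

theorem perimeter_finite: "perimeter K < \<infinity>"
proof -
  have "perimeter K \<le> ereal (DIM('a) * (2 * (V 1 - V 0)))"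
    unfolding perimeter_def
  proof (rule SUP_least)
    fix \<phi> :: "'a \<Rightarrow> 'a"
    assume "\<phi> \<in> {\<phi>. C_k 1 \<phi> \<and> compactly_supported \<phi> \<and> (\<forall>x. norm (\<phi> x) \<le> 1)}"
    then have phi: "C_k 1 \<phi>" "compactly_supported \<phi>" "\<And>x. norm (\<phi> x) \<le> 1" by blast+
    note D = integral_directional_derivative_le[OF phi]
    have "(LINT x:K|lborel. divergence \<phi> x) = (LINT x|lborel. (\<Sum>b\<in>Basis. indicator K x * (frechet_derivative \<phi> (at x) b \<bullet> b)))"
      by (simp add: set_lebesgue_integral_def divergence_def sum_distrib_left)
    also have "\<dots> = (\<Sum>b\<in>Basis. LINT x|lborel. indicator K x * (frechet_derivative \<phi> (at x) b \<bullet> b))"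
      by (rule Bochner_Integration.integral_sum) (rule D(1))
    also have "\<dots> \<le> (\<Sum>b\<in>(Basis::'a set). 2 * (V 1 - V 0))" by (rule sum_mono) (rule D(2))
    finally show "ereal (LINT x:K|lborel. divergence \<phi> x) \<le> ereal (DIM('a) * (2 * (V 1 - V 0)))" by simp
  qed
  then show ?thesis by (rule le_less_trans) simp
qed

section \<open>Test functions of the distance\<close>

text \<open>The function \<open>f (dist_K x)\<close> is admissible, with gradient \<open>- f' (dist_K x)\<close> times the unit normal.\<close>

theorem p_capacity_le_radial:
  fixes f f' :: "real \<Rightarrow> real"
  assumes p: "1 < p" and f0: "f 0 = 1"
    and deriv: "\<And>t. 0 \<le> t \<Longrightarrow> (f has_real_derivative - f' t) (at t)"
    and f': "\<And>t. 0 \<le> t \<Longrightarrow> 0 \<le> f' t" "\<And>t. 0 \<le> t \<Longrightarrow> f' t \<le> L"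
    and f_nonneg: "\<And>t. 0 \<le> t \<Longrightarrow> 0 \<le> f t" and lim: "(f \<longlongrightarrow> 0) at_top"
    and meas [measurable]: "f' \<in> borel_measurable borel"
    and fin: "(\<integral>\<^sup>+t. ennreal (f' t powr p) * indicator {0<..} t * ennreal (V' t) \<partial>lborel) < \<infinity>"
  shows "p_capacity p K \<le> (\<integral>\<^sup>+t. ennreal (f' t powr p) * indicator {0<..} t * ennreal (V' t) \<partial>lborel)"
proof -
  define u where "u x = f (dist_K x)" for x
  define g where "g x = - f' (dist_K x) *\<^sub>R normal x" for x
  have L: "0 \<le> L" using f'(1,2)[of 0] by simp
  have anti: "f t \<le> f s" if "0 \<le> s" "s \<le> t" for s t
    using that by (intro DERIV_nonpos_imp_nonincreasing[of s t f]) (auto intro!: exI[of _ "- f' _"] deriv f')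
  have lipf: "\<bar>f s - f t\<bar> \<le> L * \<bar>s - t\<bar>" if "0 \<le> s" "0 \<le> t" for s t
  proof -
    have "norm (f s - f t) \<le> L * norm (s - t)"
    proof (rule field_differentiable_bound[where S = "{0..}" and f' = "\<lambda>t. - f' t"])
      show "(f has_field_derivative - f' z) (at z within {0..})" if "z \<in> {0..}" for z
        by (rule has_field_derivative_at_within[OF deriv]) (use that in simp)
      show "norm (- f' z) \<le> L" if "z \<in> {0..}" for z using that f'[of z] by simp
    qed (use that in auto)
    then show ?thesis by simp
  qed
  have u_lip: "\<bar>u x - u y\<bar> \<le> L * norm (x - y)" for x y
  proof -
    have "\<bar>u x - u y\<bar> \<le> L * \<bar>dist_K x - dist_K y\<bar>" unfolding u_def by (intro lipf) (auto simp: infdist_nonneg)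
    also have "\<dots> \<le> L * norm (x - y)" using L by (intro mult_left_mono dist_K_Lipschitz)
    finally show ?thesis .
  qed
  have u1: "0 \<le> u x" "u x \<le> 1" for x
    using f_nonneg[of "dist_K x"] anti[of 0 "dist_K x"] f0 by (auto simp: u_def infdist_nonneg)
  have contf: "continuous_on {0..} f"
    by (intro continuous_at_imp_continuous_on ballI DERIV_isCont[OF deriv]) auto
  have contu: "continuous_on UNIV u"
    unfolding u_def by (rule continuous_on_compose2[OF contf continuous_dist_K]) (auto simp: infdist_nonneg)
  have [measurable]: "u \<in> borel_measurable borel" using contu by (rule borel_measurable_continuous_onI)
  have [measurable]: "g \<in> borel_measurable borel" unfolding g_def[abs_def] by measurable
  have norm_g: "norm (g x) = f' (dist_K x) * indicator (- K) x" for x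
    using f'(1)[of "dist_K x"] norm_normal[of x] normal_in[of x]
    by (cases "x \<in> K") (auto simp: g_def infdist_nonneg)
  have "weak_gradient u g"
  proof (rule weak_gradient_Lipschitz[OF u_lip, of 1])
    show "\<bar>u x\<bar> \<le> 1" for x using u1[of x] by simp
    show "norm (g x) \<le> L" for x
      using f'(2)[of "dist_K x"] L by (auto simp: norm_g infdist_nonneg indicator_def)
    show "AE x in lborel. (u has_derivative (\<lambda>h. g x \<bullet> h)) (at x)"
      using AE_not_frontier
    proof eventually_elim
      case (elim x)
      have "((\<lambda>y. dist_K y) has_derivative (\<lambda>h. normal x \<bullet> h)) (at x)"
      proof (cases "x \<in> K")
        case True
        then have "x \<in> interior K" using elim closed by (auto simp: frontier_def closure_closed)
        then show ?thesis by (rule dist_K_has_derivative_interior)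
      next
        case False
        then show ?thesis by (rule dist_K_has_derivative)
      qed
      from has_derivative_compose[OF this, of f "(*) (- f' (dist_K x))"] deriv[of "dist_K x"]
      show ?case by (simp add: u_def[abs_def] g_def has_field_derivative_def infdist_nonneg)
    qed
  qed measurable
  moreover have "indicator K x \<le> u x" for x
    using u1(1)[of x] f0 by (cases "x \<in> K") (auto simp: u_def infdist_zero)
  moreover have "emeasure lborel {x. u x > \<epsilon>} < \<infinity>" if "0 < \<epsilon>" for \<epsilon>
  proof -
    have "eventually (\<lambda>t. f t < \<epsilon> \<and> 0 \<le> t) at_top"
      using order_tendstoD(2)[OF lim that] eventually_ge_at_top[of 0] by eventually_elim auto
    then obtain t where t: "f t < \<epsilon>" "0 \<le> t" by (auto simp: eventually_at_top_linorder)
    have "dist_K x \<le> t" if "u x > \<epsilon>" for x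
    proof (rule ccontr)
      assume "\<not> dist_K x \<le> t"
      then have "u x \<le> f t" unfolding u_def using t by (intro anti) auto
      then show False using that t by simp
    qed
    then have "{x. u x > \<epsilon>} \<subseteq> {x. dist_K x \<le> t}" by blast
    then have "emeasure lborel {x. u x > \<epsilon>} \<le> emeasure lborel {x. dist_K x \<le> t}"
      using sublevel_closed by (intro emeasure_mono) auto
    also have "\<dots> < \<infinity>" using t(2) by (simp add: emeasure_sublevel)
    finally show ?thesis .
  qed
  moreover have energy: "(\<integral>\<^sup>+x. ennreal (norm (g x) powr p) \<partial>lborel)
      = (\<integral>\<^sup>+t. ennreal (f' t powr p) * indicator {0<..} t * ennreal (V' t) \<partial>lborel)"
  proof -
    have "(\<integral>\<^sup>+x. ennreal (norm (g x) powr p) \<partial>lborel) = (\<integral>\<^sup>+x. ennreal (f' (dist_K x) powr p) * indicator (- K) x \<partial>lborel)"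
      by (intro nn_integral_cong) (auto simp: norm_g indicator_def)
    also have "\<dots> = (\<integral>\<^sup>+t. ennreal (f' t powr p) * indicator {0<..} t * ennreal (V' t) \<partial>lborel)"
      by (rule nn_integral_dist) measurable
    finally show ?thesis .
  qed
  ultimately show ?thesis
    unfolding p_capacity_def using contu fin by (intro Inf_lower) (auto intro!: exI[of _ u] exI[of _ g])
qed

end

section \<open>The capacity estimate\<close>

text \<open>Here \<open>P\<close> stands for the perimeter of \<open>K\<close>, \<open>I\<close> is the isoperimetric ratio, and \<open>1 / c\<close> serves as
  unit of length.\<close>

locale convex_body_perimeter = convex_body K for K :: "'a::euclidean_space set" +
  fixes P :: real
  assumes dim: "3 \<le> DIM('a)" and V'_0_le: "V' 0 \<le> P"
begin

definition c :: real where "c = P / (DIM('a) * vol K)"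

definition I :: real where "I = vol (ball (0::'a) 1) * DIM('a) ^ DIM('a) * vol K ^ (DIM('a) - 1) / P ^ DIM('a)"

lemma V'_split:
  fixes t :: real
  shows "V' t = DIM('a) * coeff DIM('a) * t ^ (DIM('a) - 1) + (\<Sum>k<DIM('a). coeff k * (k * t ^ (k - 1)))"
proof -
  have "{..DIM('a)} = insert DIM('a) {..<DIM('a)}" by auto
  then show ?thesis by (simp add: V'_def)
qed

lemma remainder_nonneg:
  fixes t :: real
  shows "0 \<le> t \<Longrightarrow> 0 \<le> (\<Sum>k<DIM('a). coeff k * (k * t ^ (k - 1)))"
  using coeff(1) by (intro sum_nonneg mult_nonneg_nonneg) auto

lemma lead_pos: "0 < coeff DIM('a)"
  using content_ball_pos[of 1 "0::'a"] by (simp add: coeff(4))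

lemma P_pos: "0 < P"
proof (rule ccontr)
  assume "\<not> 0 < P"
  then have "V' 0 = 0" using V'_0_le V'_nonneg[of 0] by simp
  then have "V' 1 \<le> 0" using V'_le[of 1] by simp
  moreover have "0 < V' 1" using V'_split[of 1] remainder_nonneg[of 1] lead_pos by (simp add: add_pos_nonneg)
  ultimately show False by simp
qed

lemma c_pos: "0 < c" using P_pos vol_pos by (simp add: c_def)

lemma I_pos: "0 < I"
  using P_pos vol_pos content_ball_pos[of 1 "0::'a"] by (simp add: I_def)

text \<open>In the variable \<open>s = c t\<close> the polynomial \<open>V' / P\<close> has leading coefficient \<open>I\<close>.\<close>

lemma lead: "DIM('a) * coeff DIM('a) = P * I * c ^ (DIM('a) - 1)"
proof -
  have pow: "x ^ DIM('a) = x * x ^ (DIM('a) - 1)" for x :: real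
    by (metis DIM_positive Suc_pred' power_Suc)
  show ?thesis
    unfolding I_def c_def coeff(4) pow power_divide power_mult_distrib
    using P_pos vol_pos by (simp add: field_simps pow[of "real DIM('a)"])
qed

lemma V'_le_P: "0 \<le> t \<Longrightarrow> V' t \<le> P * (1 + c * t) ^ (DIM('a) - 1)"
proof -
  assume t: "0 \<le> t"
  have "V' t \<le> V' 0 * (1 + t * V' 0 / (DIM('a) * vol K)) ^ (DIM('a) - 1)" by (rule V'_le[OF t])
  also have "\<dots> \<le> P * (1 + c * t) ^ (DIM('a) - 1)"
  proof (intro mult_mono power_mono)
    have "V' 0 * (t / (DIM('a) * vol K)) \<le> P * (t / (DIM('a) * vol K))"
      using V'_0_le t vol_pos by (intro mult_right_mono) auto
    then show "1 + t * V' 0 / (DIM('a) * vol K) \<le> 1 + c * t" by (simp add: c_def ac_simps)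
    show "0 \<le> 1 + t * V' 0 / (DIM('a) * vol K)" "0 \<le> (1 + t * V' 0 / (DIM('a) * vol K)) ^ (DIM('a) - 1)"
      using t V'_nonneg[of 0] vol_pos by (auto intro!: add_nonneg_nonneg)
  qed (use V'_0_le P_pos in auto)
  finally show ?thesis .
qed

text \<open>The isoperimetric inequality follows by comparing the leading coefficients in \<open>V'_le_P\<close>.\<close>

lemma I_le_1: "I \<le> 1"
proof (rule tendsto_lowerbound)
  have "((\<lambda>s::real. (1 / s + 1) ^ (DIM('a) - 1)) \<longlongrightarrow> (0 + 1) ^ (DIM('a) - 1)) at_top"
    by (intro tendsto_intros tendsto_divide_0[OF tendsto_const] filterlim_at_top_imp_at_infinity filterlim_ident)
  then show "((\<lambda>s::real. (1 / s + 1) ^ (DIM('a) - 1)) \<longlongrightarrow> 1) at_top" by simp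
  show "\<forall>\<^sub>F s in at_top. I \<le> (1 / s + 1) ^ (DIM('a) - 1)"
    using eventually_gt_at_top[of 0]
  proof eventually_elim
    case (elim s)
    have "P * I * c ^ (DIM('a) - 1) * (s / c) ^ (DIM('a) - 1) \<le> V' (s / c)"
      using V'_split[of "s / c"] remainder_nonneg[of "s / c"] elim c_pos by (simp add: lead)
    also have "\<dots> \<le> P * (1 + c * (s / c)) ^ (DIM('a) - 1)" using elim c_pos by (intro V'_le_P) auto
    finally have "I * s ^ (DIM('a) - 1) \<le> (1 + s) ^ (DIM('a) - 1)"
      using P_pos c_pos by (simp add: power_divide mult.assoc)
    also have "\<dots> = (1 / s + 1) ^ (DIM('a) - 1) * s ^ (DIM('a) - 1)"
      using elim by (simp add: power_mult_distrib[symmetric] field_simps)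
    finally show ?case using elim by (simp add: mult_le_cancel_right)
  qed
qed simp

text \<open>For \<open>c t \<le> 1\<close> this is the Brunn--Minkowski bound. For \<open>c t \<ge> 1\<close> the part of \<open>V' t\<close> of degree
  at most \<open>d - 2\<close> grows at most like \<open>t ^ (d - 2)\<close> starting from \<open>t = 1 / c\<close>.\<close>

lemma V'_le_profile:
  assumes t: "0 \<le> t"
  shows "V' t \<le> (real DIM('a) - 1) * 2 ^ (DIM('a) - 2) * P * ((1 + c * t) * (1 + I * (c * t))) ^ (DIM('a) - 2)"
proof -
  define s where "s = c * t"
  have s: "0 \<le> s" using t c_pos by (simp add: s_def)
  have Is: "1 \<le> 1 + I * s" using s I_pos by simp
  have n: "DIM('a) - 1 = Suc (DIM('a) - 2)" using dim by simp
  have main: "V' t \<le> P * (2 * 2 ^ (DIM('a) - 2) * ((1 + s) ^ (DIM('a) - 2) * (1 + I * s)))"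
  proof (cases "s \<le> 1")
    case True
    have "V' t \<le> P * (1 + s) ^ (DIM('a) - 1)" using V'_le_P[OF t] by (simp add: s_def)
    also have "\<dots> = P * ((1 + s) * ((1 + s) ^ (DIM('a) - 2) * 1))" unfolding n by simp
    also have "\<dots> \<le> P * ((2 * 2 ^ (DIM('a) - 2)) * ((1 + s) ^ (DIM('a) - 2) * (1 + I * s)))"
    proof (intro mult_left_mono mult_mono)
      have "1 + s \<le> 2 * 1" using True by simp
      also have "\<dots> \<le> 2 * 2 ^ (DIM('a) - 2)" by (intro mult_left_mono one_le_power) auto
      finally show "1 + s \<le> 2 * 2 ^ (DIM('a) - 2)" .
    qed (use s Is P_pos in auto)
    finally show ?thesis .
  next
    case False
    have "(\<Sum>k<DIM('a). coeff k * (k * t ^ (k - 1))) \<le> (\<Sum>k<DIM('a). s ^ (DIM('a) - 2) * (coeff k * (k * (1 / c) ^ (k - 1))))"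
    proof (rule sum_mono)
      fix k assume k: "k \<in> {..<DIM('a)}"
      have "t ^ (k - 1) = s ^ (k - 1) * (1 / c) ^ (k - 1)"
        using c_pos by (simp add: s_def flip: power_mult_distrib)
      also have "\<dots> \<le> s ^ (DIM('a) - 2) * (1 / c) ^ (k - 1)"
        using k False c_pos by (intro mult_right_mono power_increasing) auto
      finally have "(coeff k * k) * t ^ (k - 1) \<le> (coeff k * k) * (s ^ (DIM('a) - 2) * (1 / c) ^ (k - 1))"
        using coeff(1)[of k] by (intro mult_left_mono) auto
      then show "coeff k * (k * t ^ (k - 1)) \<le> s ^ (DIM('a) - 2) * (coeff k * (k * (1 / c) ^ (k - 1)))"
        by (simp add: ac_simps)
    qed
    also have "\<dots> = s ^ (DIM('a) - 2) * (\<Sum>k<DIM('a). coeff k * (k * (1 / c) ^ (k - 1)))" by (simp add: sum_distrib_left)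
    also have "\<dots> \<le> s ^ (DIM('a) - 2) * V' (1 / c)"
    proof (intro mult_left_mono)
      show "(\<Sum>k<DIM('a). coeff k * (k * (1 / c) ^ (k - 1))) \<le> V' (1 / c)"
        using lead_pos c_pos unfolding V'_split[of "1 / c"] by simp
    qed (use s in simp)
    also have "\<dots> \<le> s ^ (DIM('a) - 2) * (P * 2 ^ (DIM('a) - 1))"
      using V'_le_P[of "1 / c"] c_pos s by (intro mult_left_mono) auto
    finally have "V' t \<le> P * I * c ^ (DIM('a) - 1) * t ^ (DIM('a) - 1) + s ^ (DIM('a) - 2) * (P * 2 ^ (DIM('a) - 1))"
      unfolding V'_split[of t] lead by simp
    also have "P * I * c ^ (DIM('a) - 1) * t ^ (DIM('a) - 1) = P * I * s ^ (DIM('a) - 1)" by (simp add: s_def power_mult_distrib)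
    also have "P * I * s ^ (DIM('a) - 1) + s ^ (DIM('a) - 2) * (P * 2 ^ (DIM('a) - 1)) = P * (s ^ (DIM('a) - 2) * (2 * 2 ^ (DIM('a) - 2) + I * s))"
      unfolding n by (simp add: algebra_simps)
    also have "\<dots> \<le> P * ((1 + s) ^ (DIM('a) - 2) * ((2 * 2 ^ (DIM('a) - 2)) * (1 + I * s)))"
    proof (intro mult_left_mono mult_mono power_mono)
      have "1 * (I * s) \<le> (2 * 2 ^ (DIM('a) - 2)) * (I * s)"
        using s I_pos one_le_power[of "2::real" "Suc (DIM('a) - 2)"] by (intro mult_right_mono) auto
      then show "2 * 2 ^ (DIM('a) - 2) + I * s \<le> (2 * 2 ^ (DIM('a) - 2)) * (1 + I * s)" by (simp add: distrib_left)
    qed (use s I_pos P_pos in auto)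
    finally show ?thesis by (simp add: ac_simps)
  qed
  also have "\<dots> \<le> P * ((real DIM('a) - 1) * 2 ^ (DIM('a) - 2) * ((1 + s) ^ (DIM('a) - 2) * (1 + I * s) ^ (DIM('a) - 2)))"
  proof (intro mult_left_mono mult_mono)
    show "1 + I * s \<le> (1 + I * s) ^ (DIM('a) - 2)" using Is dim by (intro self_le_power) auto
    show "2 \<le> real DIM('a) - 1" using dim by simp
  qed (use s Is P_pos dim in auto)
  finally show ?thesis by (simp add: s_def power_mult_distrib ac_simps)
qed

text \<open>Replace \<open>V'\<close> by its bound \<open>M\<close> and minimise the energy \<open>\<integral> f' ^ (d - 1) M\<close> over all profiles: the optimal
  \<open>f'\<close> is proportional to \<open>M powr (- 1 / (d - 2))\<close>, that is to \<open>1 / ((1 + c t) (1 + I c t))\<close>, whose primitive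
  is a difference of logarithms with total increment \<open>ln (1 / I)\<close>, up to a factor.\<close>

theorem p_capacity_le:
  assumes I1: "I < 1"
  shows "p_capacity (real DIM('a) - 1) K \<le> ennreal ((real DIM('a) - 1) * 2 ^ (DIM('a) - 2) * P * (c / ln (inverse I)) ^ (DIM('a) - 2))"
proof -
  define l where "l = ln (inverse I)"
  have l: "0 < l" using I1 I_pos by (simp add: l_def ln_inverse)
  define q where "q t = (1 + c * t) * (1 + I * (c * t))" for t
  define f where "f t = 1 - (ln (1 + c * t) - ln (1 + I * (c * t))) / l" for t
  define f' where "f' t = c * (1 - I) / l / q t" for t
  have pos: "1 \<le> 1 + c * t" "1 \<le> 1 + I * (c * t)" "1 \<le> q t" if "0 \<le> t" for t
  proof -
    show 1: "1 \<le> 1 + c * t" "1 \<le> 1 + I * (c * t)" using that c_pos I_pos by auto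
    show "1 \<le> q t" unfolding q_def using mult_mono[OF 1] 1 by simp
  qed
  have [measurable]: "f' \<in> borel_measurable borel" unfolding f'_def[abs_def] q_def by measurable
  have dlog: "((\<lambda>t. ln (1 + c * t) - ln (1 + I * (c * t))) has_real_derivative c * (1 - I) / q t) (at t)" if "0 \<le> t" for t
  proof -
    have "((\<lambda>t. ln (1 + c * t) - ln (1 + I * (c * t))) has_real_derivative c / (1 + c * t) - I * c / (1 + I * (c * t))) (at t)"
      using pos(1,2)[OF that] by (auto intro!: derivative_eq_intros)
    moreover have "c / (1 + c * t) - I * c / (1 + I * (c * t)) = c * (1 - I) / q t"
      unfolding q_def using pos(1,2)[OF that] by (subst diff_frac_eq) (auto simp: algebra_simps)
    ultimately show ?thesis by simp
  qed
  have limlog: "((\<lambda>t. ln (1 + c * t) - ln (1 + I * (c * t))) \<longlongrightarrow> l) at_top"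
  proof -
    have inv0: "((\<lambda>t::real. 1 / t) \<longlongrightarrow> 0) at_top"
      by (intro tendsto_divide_0[OF tendsto_const] filterlim_at_top_imp_at_infinity filterlim_ident)
    have "((\<lambda>t. ln ((1 / t + c) / (1 / t + I * c))) \<longlongrightarrow> ln ((0 + c) / (0 + I * c))) at_top"
      using c_pos I_pos by (intro tendsto_intros inv0) auto
    also have "(0 + c) / (0 + I * c) = inverse I" using c_pos by (simp add: field_simps)
    finally have "((\<lambda>t. ln ((1 / t + c) / (1 / t + I * c))) \<longlongrightarrow> l) at_top" unfolding l_def .
    moreover have "\<forall>\<^sub>F t in at_top. ln ((1 / t + c) / (1 / t + I * c)) = ln (1 + c * t) - ln (1 + I * (c * t))"
      using eventually_gt_at_top[of 0]
    proof eventually_elim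
      case (elim t)
      have "(1 / t + c) / (1 / t + I * c) = (1 + c * t) / (1 + I * (c * t))"
      proof -
        have "1 / t + c = (1 + c * t) / t" "1 / t + I * c = (1 + I * (c * t)) / t"
          using elim by (simp_all add: field_simps)
        then show ?thesis using elim by simp
      qed
      then show ?case using pos(1,2)[of t] elim by (simp add: ln_div)
    qed
    ultimately show ?thesis by (rule Lim_transform_eventually)
  qed
  have "(f \<longlongrightarrow> 1 - l / l) at_top" unfolding f_def[abs_def] using l by (intro tendsto_intros limlog) auto
  then have lim: "(f \<longlongrightarrow> 0) at_top" using l by simp
  have deriv: "(f has_real_derivative - f' t) (at t)" if "0 \<le> t" for t
  proof -
    have "(f has_real_derivative 0 - c * (1 - I) / q t / l) (at t)"
      unfolding f_def[abs_def] by (intro DERIV_diff DERIV_const DERIV_cdivide dlog that)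
    then show ?thesis by (simp add: f'_def ac_simps)
  qed
  have f'pos: "0 < f' t" if "0 \<le> t" for t
    unfolding f'_def using pos(3)[OF that] c_pos I1 l by (intro divide_pos_pos mult_pos_pos) auto
  have f'le: "f' t \<le> c * (1 - I) / l" if "0 \<le> t" for t
  proof -
    have "c * (1 - I) / l / q t \<le> c * (1 - I) / l / 1"
      using pos(3)[OF that] c_pos I1 l by (intro divide_left_mono) auto
    then show ?thesis by (simp add: f'_def)
  qed
  have f_nonneg: "0 \<le> f t" if "0 \<le> t" for t
  proof (rule tendsto_upperbound[OF lim])
    show "\<forall>\<^sub>F s in at_top. f s \<le> f t"
      using eventually_ge_at_top[of t]
    proof eventually_elim
      case (elim s)
      show ?case
      proof (rule DERIV_nonpos_imp_nonincreasing[OF elim])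
        fix x assume "t \<le> x" "x \<le> s"
        then show "\<exists>y. (f has_real_derivative y) (at x) \<and> y \<le> 0"
          using deriv[of x] f'pos[of x] that by (intro exI[of _ "- f' x"]) simp
      qed
    qed
  qed simp
  \<comment> \<open>with \<open>A\<close> defined here, \<open>f' ^ (DIM('a) - 1)\<close> times the bound on \<open>V'\<close> equals \<open>A c (1 - I) / q\<close>\<close>
  define B where "B = (real DIM('a) - 1) * 2 ^ (DIM('a) - 2) * P"
  define A where "A = B * (c * (1 - I) / l) ^ (DIM('a) - 2) / l"
  have B: "0 \<le> B" using P_pos dim by (simp add: B_def)
  have A: "0 \<le> A" using B c_pos I1 l by (simp add: A_def)
  have n: "DIM('a) - 1 = Suc (DIM('a) - 2)" using dim by simp
  have integrand: "f' t powr (real DIM('a) - 1) * V' t \<le> A * (c * (1 - I) / q t)" if "0 \<le> t" for t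
  proof -
    have q: "q t > 0" using pos(3)[OF that] by simp
    have "f' t powr (real DIM('a) - 1) = f' t ^ (DIM('a) - 1)"
      using powr_realpow[OF f'pos[OF that], of "DIM('a) - 1"] dim by (simp add: of_nat_diff)
    then have "f' t powr (real DIM('a) - 1) * V' t \<le> f' t ^ (DIM('a) - 1) * (B * q t ^ (DIM('a) - 2))"
      using V'_le_profile[OF that] f'pos[OF that] by (simp add: B_def q_def mult_left_mono)
    also have "\<dots> = B * (f' t * q t) ^ (DIM('a) - 2) * f' t" unfolding n by (simp add: power_mult_distrib)
    also have "f' t * q t = c * (1 - I) / l" using q by (simp add: f'_def)
    also have "B * (c * (1 - I) / l) ^ (DIM('a) - 2) * f' t = A * (c * (1 - I) / q t)"
      by (simp add: A_def f'_def)
    finally show ?thesis .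
  qed
  have "(\<integral>\<^sup>+t. ennreal (f' t powr (real DIM('a) - 1)) * indicator {0<..} t * ennreal (V' t) \<partial>lborel)
      \<le> (\<integral>\<^sup>+t. ennreal (A * (c * (1 - I) / q t)) * indicator {0..} t \<partial>lborel)"
  proof (rule nn_integral_mono)
    fix t
    show "ennreal (f' t powr (real DIM('a) - 1)) * indicator {0<..} t * ennreal (V' t)
        \<le> ennreal (A * (c * (1 - I) / q t)) * indicator {0..} t"
    proof (cases "0 < t")
      case True
      then show ?thesis
        using integrand[of t] V'_nonneg[of t] by (simp add: ennreal_mult[symmetric] ennreal_leI)
    qed simp
  qed
  also have "\<dots> = ennreal (A * l - A * (ln (1 + c * 0) - ln (1 + I * (c * 0))))"
  proof (rule nn_integral_FTC_atLeast[where F = "\<lambda>t. A * (ln (1 + c * t) - ln (1 + I * (c * t)))"])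
    show "(\<lambda>t. A * (c * (1 - I) / q t)) \<in> borel_measurable borel" unfolding q_def by measurable
    show "((\<lambda>t. A * (ln (1 + c * t) - ln (1 + I * (c * t)))) has_real_derivative A * (c * (1 - I) / q t)) (at t)"
      if "0 \<le> t" for t by (intro DERIV_cmult dlog that)
    show "0 \<le> A * (c * (1 - I) / q t)" if "0 \<le> t" for t
      using A c_pos I1 pos(3)[OF that] by (intro mult_nonneg_nonneg divide_nonneg_nonneg) auto
    show "((\<lambda>t. A * (ln (1 + c * t) - ln (1 + I * (c * t)))) \<longlongrightarrow> A * l) at_top"
      by (intro tendsto_intros limlog)
  qed
  also have "\<dots> = ennreal (B * (c * (1 - I) / l) ^ (DIM('a) - 2))" using l by (simp add: A_def)
  also have "\<dots> \<le> ennreal (B * (c / l) ^ (DIM('a) - 2))"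
  proof (intro ennreal_leI mult_left_mono power_mono divide_right_mono)
    show "c * (1 - I) \<le> c" using c_pos I_pos by (simp add: mult_left_le)
  qed (use B c_pos I1 l in auto)
  finally have energy: "(\<integral>\<^sup>+t. ennreal (f' t powr (real DIM('a) - 1)) * indicator {0<..} t * ennreal (V' t) \<partial>lborel)
      \<le> ennreal (B * (c / l) ^ (DIM('a) - 2))" .
  have "p_capacity (real DIM('a) - 1) K \<le> (\<integral>\<^sup>+t. ennreal (f' t powr (real DIM('a) - 1)) * indicator {0<..} t * ennreal (V' t) \<partial>lborel)"
  proof (rule p_capacity_le_radial[where f = f and L = "c * (1 - I) / l"])
    show "1 < real DIM('a) - 1" using dim by simp
    show "f 0 = 1" by (simp add: f_def)
    show "(\<integral>\<^sup>+t. ennreal (f' t powr (real DIM('a) - 1)) * indicator {0<..} t * ennreal (V' t) \<partial>lborel) < \<infinity>"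
      using energy by (rule le_less_trans) simp
  qed (use deriv f'pos f'le f_nonneg lim in \<open>auto intro: less_imp_le\<close>)
  also note energy
  finally show ?thesis by (simp add: B_def l_def)
qed

end

theorem theorem2:
  fixes K :: "'a::euclidean_space set" and d :: nat
  assumes "DIM('a) = d" and "d \<ge> 3"
    and "convex K" and "compact K" and "interior K \<noteq> {}"
  shows "p_capacity (real d - 1) K \<le>
    (if isoperimetric_ratio K = 1 then \<infinity>
     else ennreal (real d powi (2 - int d) * (real d - 1) * 2 ^ (d - 2)
            * (real_of_ereal (perimeter K) ^ (d - 1) / measure lborel K ^ (d - 2))
            * ln (inverse (isoperimetric_ratio K)) powi (2 - int d)))"
proof -
  interpret convex_body K by standard (use assms in auto)
  define P where "P = real_of_ereal (perimeter K)"
  have "perimeter K = ereal P"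
    using V'_le_perimeter perimeter_finite by (cases "perimeter K") (simp_all add: P_def)
  then have "V' 0 \<le> P" using V'_le_perimeter by simp
  then interpret convex_body_perimeter K P by unfold_locales (use assms in auto)
  have volK: "vol K = measure lborel K" using compact by (simp add: borel_compact)
  have ratio: "isoperimetric_ratio K = I"
    by (simp add: isoperimetric_ratio_def I_def volK flip: P_def)
  show ?thesis
  proof (cases "I = 1")
    case False
    then have I1: "I < 1" using I_le_1 by simp
    let ?l = "ln (inverse I)"
    have dn: "2 - int d = - int (d - 2)" using assms(2) by simp
    have pw: "x powi (2 - int d) = inverse (x ^ (d - 2))" for x :: real
      unfolding dn by (simp add: power_int_minus)
    have "d - 1 = Suc (d - 2)" using assms(2) by simp
    then have "P ^ (d - 1) = P * P ^ (d - 2)" by (simp only: power_Suc)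
    then have "real d powi (2 - int d) * (real d - 1) * 2 ^ (d - 2) * (P ^ (d - 1) / measure lborel K ^ (d - 2)) * ?l powi (2 - int d)
        = (real d - 1) * 2 ^ (d - 2) * P * (P / (d * measure lborel K) / ?l) ^ (d - 2)"
      unfolding pw by (simp add: power_mult_distrib divide_inverse power_inverse ac_simps)
    with p_capacity_le[OF I1] False show ?thesis
      by (simp add: ratio P_def[symmetric] c_def volK assms(1))
  qed (simp add: ratio)
qed

end
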